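(* Let $F$ be a field, let $n\ge m\ge1$ be integers, and let $S$ be the homogeneous coordinate ring of the scroll $\mathbb{F}(m,n)\subset\mathbb{P}^{m+n+1}$ over $F$. For $[a:b]\in\mathbb{P}^1(F)$ let $f_{a,b}=a\,x_{0m}+b\,x_{1n}\in S$. Then there exists an isomorphism $$\operatorname{Proj} S_{\rm un}(f_{a,b})\;\cong\;\begin{cases}\mathbb{F}(m,n+1)&\text{if }[a:b]=[0:1],\\ \mathbb{F}(m+1,n)&\text{otherwise,}\end{cases}$$ which is induced by a projective linear transformation of the ambient $\mathbb{P}^{m+n+2}$.
   Context: For integers $m,n\ge1$ let $R=F[x_{00},\dots,x_{0m},x_{10},\dots,x_{1n}]$ with the standard grading, let $Q\subset R$ be the ideal generated by the $2\times 2$ minors of $$\left(\begin{array}{ccc|ccc} x_{00}&\dots&x_{0,m-1}&x_{10}&\dots&x_{1,n-1}\\ x_{01}&\dots&x_{0m}&x_{11}&\dots&x_{1n}\end{array}\right),$$ and let $S=R/Q$, which is a domain. The surface scroll is $\mathbb{F}(m,n)=\operatorname{Proj} S\subset\mathbb{P}^{m+n+1}$ (interchanging the two blocks identifies $\mathbb{F}(m,n)$ with $\mathbb{F}(n,m)$ by a permutation of coordinates). Let $I=(x_{00},\dots,x_{0,m-1},x_{10},\dots,x_{1,n-1})\subset S$. Let $\phi:I\to S$ be the degree-zero homomorphism of graded $S$-modules with $\phi(x_{0i})=x_{0,i+1}$ for $0\le i\le m-1$ and $\phi(x_{1j})=x_{1,j+1}$ for $0\le j\le n-1$ (it is multiplication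 by $x_{01}/x_{00}$ in the field of fractions of $S$). For $f\in S$ homogeneous of degree $k\ge1$, the generalised unprojection ring is $$S_{\rm un}(f)=\frac{S[T]}{(Tu-f\phi(u),\ u\in I)},$$ where $T$ is a variable of degree $k$. For $k=1$, $\operatorname{Proj} S_{\rm un}(f)$ is a closed subscheme of $\mathbb{P}^{m+n+2}$ with homogeneous coordinates $x_{ij},T$. *)

theory Defs
  imports
    "HOL-Analysis.Analysis"
    "HOL-Algebra.UnivPoly"
    "HOL-Algebra.QuotRing"
    "HOL-Library.Poly_Mapping"
    "Jordan_Normal_Form.Matrix"
begin

section \<open>Graded rings\<close>

text \<open>A commutative ring together with its homogeneous parts \<open>grade G d\<close>, graded by the
  natural numbers.\<close>

record 'a graded_ring = "'a ring" + grade :: "nat \<Rightarrow> 'a set"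

definition homogeneous_elems :: "('a, 'z) graded_ring_scheme \<Rightarrow> 'a set" where
  "homogeneous_elems G = (\<Union>d. grade G d)"

definition homogeneous_ideal :: "'a set \<Rightarrow> ('a, 'z) graded_ring_scheme \<Rightarrow> bool" where
  "homogeneous_ideal J G \<longleftrightarrow> ideal J G \<and> J = genideal G (J \<inter> homogeneous_elems G)"

definition irrelevant_ideal :: "('a, 'z) graded_ring_scheme \<Rightarrow> 'a set" where
  "irrelevant_ideal G = genideal G (\<Union>d\<in>{1..}. grade G d)"

definition gquot :: "('a, 'z) graded_ring_scheme \<Rightarrow> 'a set \<Rightarrow> 'a set graded_ring" where
  "gquot G J = ring.extend (G Quot J)
     (graded_ring.fields (\<lambda>d. (\<lambda>x. J +>\<^bsub>G\<^esub> x) ` grade G d))"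

text \<open>The polynomial ring \<open>G[T]\<close> with \<open>deg T = k\<close>.\<close>

definition gadjoin :: "('a, 'z) graded_ring_scheme \<Rightarrow> nat \<Rightarrow> (nat \<Rightarrow> 'a) graded_ring" where
  "gadjoin G k = ring.extend (ring.truncate (UP G))
     (graded_ring.fields (\<lambda>d. {p \<in> carrier (UP G). \<forall>i.
        if i * k \<le> d then up_ring.coeff (UP G) p i \<in> grade G (d - i * k)
        else up_ring.coeff (UP G) p i = \<zero>\<^bsub>G\<^esub>}))"

section \<open>Polynomial rings in several variables\<close>

text \<open>A polynomial maps monomials (exponent vectors \<open>'v \<Rightarrow>\<^sub>0 nat\<close>) to coefficients;
  \<open>mpoly_ring V\<close> is the polynomial ring over the field \<open>'a\<close> in the variables \<open>V\<close>,
  with the standard grading.\<close>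

type_synonym ('v, 'a) mpol = "('v \<Rightarrow>\<^sub>0 nat) \<Rightarrow>\<^sub>0 'a"

definition mpoly_ring :: "'v set \<Rightarrow> ('v, 'a::field) mpol graded_ring" where
  "mpoly_ring V =
    \<lparr>carrier = {p. \<forall>t \<in> Poly_Mapping.keys p. Poly_Mapping.keys t \<subseteq> V},
     monoid.mult = (*), one = 1, zero = 0, add = (+),
     grade = (\<lambda>d. {p. \<forall>t \<in> Poly_Mapping.keys p. Poly_Mapping.keys t \<subseteq> V \<and>
                      (\<Sum>v\<in>Poly_Mapping.keys t. Poly_Mapping.lookup t v) = d})\<rparr>"

definition mconst :: "'a::field \<Rightarrow> ('v, 'a) mpol" where
  "mconst c = Poly_Mapping.single 0 c"

definition mvar :: "'v \<Rightarrow> ('v, 'a::field) mpol" where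
  "mvar v = Poly_Mapping.single (Poly_Mapping.single v 1) 1"

text \<open>Evaluation in a commutative ring \<open>G\<close>: constants are mapped by \<open>c\<close>, the variable \<open>v\<close>
  goes to \<open>y v\<close>.\<close>

definition meval ::
  "('b, 'z) ring_scheme \<Rightarrow> ('a::field \<Rightarrow> 'b) \<Rightarrow> ('v \<Rightarrow> 'b) \<Rightarrow> ('v, 'a) mpol \<Rightarrow> 'b" where
  "meval G c y p = (\<Oplus>\<^bsub>G\<^esub>t\<in>Poly_Mapping.keys p.
     c (Poly_Mapping.lookup p t) \<otimes>\<^bsub>G\<^esub>
     (\<Otimes>\<^bsub>G\<^esub>v\<in>Poly_Mapping.keys t. y v [^]\<^bsub>G\<^esub> Poly_Mapping.lookup t v))"

section \<open>Ringed spaces\<close>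

record ('p, 's) ringed_space =
  space_top :: "'p topology"
  sections :: "'p set \<Rightarrow> 's ring"
  restr :: "'p set \<Rightarrow> 'p set \<Rightarrow> 's \<Rightarrow> 's"

record ('p, 's, 'q, 't) rs_map =
  base :: "'p \<Rightarrow> 'q"
  comorph :: "'q set \<Rightarrow> 't \<Rightarrow> 's"

definition rs_vimage :: "('p, 's) ringed_space \<Rightarrow> ('p, 's, 'q, 't) rs_map \<Rightarrow> 'q set \<Rightarrow> 'p set" where
  "rs_vimage X f V = {p \<in> topspace (space_top X). base f p \<in> V}"

text \<open>Being an isomorphism of ringed spaces, such a map induces isomorphisms on all stalks; so
  between locally ringed spaces it is an isomorphism of locally ringed spaces.\<close>

definition rs_iso ::
  "('p, 's) ringed_space \<Rightarrow> ('q, 't) ringed_space \<Rightarrow> ('p, 's, 'q, 't) rs_map \<Rightarrow> bool" where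
  "rs_iso X Y f \<longleftrightarrow>
     homeomorphic_map (space_top X) (space_top Y) (base f) \<and>
     (\<forall>V. openin (space_top Y) V \<longrightarrow>
        comorph f V \<in> ring_iso (sections Y V) (sections X (rs_vimage X f V))) \<and>
     (\<forall>V W. openin (space_top Y) V \<longrightarrow> openin (space_top Y) W \<longrightarrow> W \<subseteq> V \<longrightarrow>
        (\<forall>s \<in> carrier (sections Y V).
           comorph f W (restr Y V W s) =
           restr X (rs_vimage X f V) (rs_vimage X f W) (comorph f V s)))"

text \<open>The composition of \<open>f : X \<rightarrow> Y\<close> and \<open>g : Y \<rightarrow> Z\<close>.\<close>

definition rs_comp ::
  "('q, 't) ringed_space \<Rightarrow> ('q, 't, 'r, 'u) rs_map \<Rightarrow> ('p, 's, 'q, 't) rs_map \<Rightarrow>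
   ('p, 's, 'r, 'u) rs_map" where
  "rs_comp Y g f = \<lparr>base = base g \<circ> base f,
                    comorph = (\<lambda>W. comorph f (rs_vimage Y g W) \<circ> comorph g W)\<rparr>"

text \<open>Equality of morphisms \<open>X \<rightarrow> Y\<close>, ignoring junk values outside the carriers.\<close>

definition rs_map_eq ::
  "('p, 's) ringed_space \<Rightarrow> ('q, 't) ringed_space \<Rightarrow>
   ('p, 's, 'q, 't) rs_map \<Rightarrow> ('p, 's, 'q, 't) rs_map \<Rightarrow> bool" where
  "rs_map_eq X Y f g \<longleftrightarrow>
     (\<forall>p \<in> topspace (space_top X). base f p = base g p) \<and>
     (\<forall>V. openin (space_top Y) V \<longrightarrow>
        (\<forall>s \<in> carrier (sections Y V). comorph f V s = comorph g V s))"

section \<open>Proj of a graded ring\<close>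

definition proj_points :: "('a, 'z) graded_ring_scheme \<Rightarrow> 'a set set" where
  "proj_points G =
     {p. primeideal p G \<and> homogeneous_ideal p G \<and> \<not> irrelevant_ideal G \<subseteq> p}"

text \<open>The Zariski topology, given by the basis of sets \<open>D\<^sub>+(f)\<close>, \<open>f\<close> homogeneous.\<close>

definition proj_top :: "('a, 'z) graded_ring_scheme \<Rightarrow> 'a set topology" where
  "proj_top G = topology_generated_by
     ((\<lambda>f. {p \<in> proj_points G. f \<notin> p}) ` homogeneous_elems G)"

text \<open>The degree zero part \<open>G\<^sub>(\<^sub>p\<^sub>)\<close> of the localisation of \<open>G\<close> at the homogeneous elements
  outside \<open>p\<close>: classes of fractions \<open>a/f\<close>, represented as pairs \<open>(a, f)\<close>.\<close>

definition hpairs :: "('a, 'z) graded_ring_scheme \<Rightarrow> 'a set \<Rightarrow> ('a \<times> 'a) set" where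
  "hpairs G p = {(a, f). \<exists>d. a \<in> grade G d \<and> f \<in> grade G d \<and> f \<notin> p}"

definition hfrac_rel :: "('a, 'z) graded_ring_scheme \<Rightarrow> 'a set \<Rightarrow> ('a \<times> 'a) rel" where
  "hfrac_rel G p = {((a, f), (b, g)). (a, f) \<in> hpairs G p \<and> (b, g) \<in> hpairs G p \<and>
     (\<exists>h \<in> homogeneous_elems G - p.
        h \<otimes>\<^bsub>G\<^esub> (a \<otimes>\<^bsub>G\<^esub> g \<ominus>\<^bsub>G\<^esub> b \<otimes>\<^bsub>G\<^esub> f) = \<zero>\<^bsub>G\<^esub>)}"

definition hfrac :: "('a, 'z) graded_ring_scheme \<Rightarrow> 'a set \<Rightarrow> 'a \<Rightarrow> 'a \<Rightarrow> ('a \<times> 'a) set" where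
  "hfrac G p a f = hfrac_rel G p `` {(a, f)}"

definition hloc :: "('a, 'z) graded_ring_scheme \<Rightarrow> 'a set \<Rightarrow> ('a \<times> 'a) set ring" where
  "hloc G p =
    \<lparr>carrier = hpairs G p // hfrac_rel G p,
     monoid.mult = (\<lambda>c c'. \<Union>(a, f)\<in>c. \<Union>(b, g)\<in>c'. hfrac G p (a \<otimes>\<^bsub>G\<^esub> b) (f \<otimes>\<^bsub>G\<^esub> g)),
     one = hfrac G p \<one>\<^bsub>G\<^esub> \<one>\<^bsub>G\<^esub>,
     zero = hfrac G p \<zero>\<^bsub>G\<^esub> \<one>\<^bsub>G\<^esub>,
     add = (\<lambda>c c'. \<Union>(a, f)\<in>c. \<Union>(b, g)\<in>c'.
              hfrac G p (a \<otimes>\<^bsub>G\<^esub> g \<oplus>\<^bsub>G\<^esub> b \<otimes>\<^bsub>G\<^esub> f) (f \<otimes>\<^bsub>G\<^esub> g))\<rparr>"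

text \<open>Sections over \<open>U\<close>: functions \<open>s\<close> with \<open>s p \<in> G\<^sub>(\<^sub>p\<^sub>)\<close> that are locally given by a fraction.\<close>

definition proj_sections ::
  "('a, 'z) graded_ring_scheme \<Rightarrow> 'a set set \<Rightarrow> ('a set \<Rightarrow> ('a \<times> 'a) set) ring" where
  "proj_sections G U =
    \<lparr>carrier = {s \<in> (\<Pi>\<^sub>E p\<in>U. carrier (hloc G p)).
        \<forall>p\<in>U. \<exists>V. openin (proj_top G) V \<and> p \<in> V \<and> V \<subseteq> U \<and>
          (\<exists>d. \<exists>a \<in> grade G d. \<exists>f \<in> grade G d. \<forall>q\<in>V. f \<notin> q \<and> s q = hfrac G q a f)},
     monoid.mult = (\<lambda>s t. \<lambda>p\<in>U. s p \<otimes>\<^bsub>hloc G p\<^esub> t p),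
     one = (\<lambda>p\<in>U. \<one>\<^bsub>hloc G p\<^esub>),
     zero = (\<lambda>p\<in>U. \<zero>\<^bsub>hloc G p\<^esub>),
     add = (\<lambda>s t. \<lambda>p\<in>U. s p \<oplus>\<^bsub>hloc G p\<^esub> t p)\<rparr>"

definition Proj ::
  "('a, 'z) graded_ring_scheme \<Rightarrow> ('a set, 'a set \<Rightarrow> ('a \<times> 'a) set) ringed_space" where
  "Proj G = \<lparr>space_top = proj_top G, sections = proj_sections G,
             restr = (\<lambda>U V s. restrict s V)\<rparr>"

text \<open>The morphism \<open>Proj H \<rightarrow> Proj G\<close> induced by a homomorphism \<open>h : G \<rightarrow> H\<close> of graded rings.
  It is everywhere defined when \<open>h\<close> is surjective, a closed immersion in that case.\<close>

definition Proj_map ::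
  "('a, 'y) graded_ring_scheme \<Rightarrow> ('b, 'z) graded_ring_scheme \<Rightarrow> ('a \<Rightarrow> 'b) \<Rightarrow>
   ('b set, 'b set \<Rightarrow> ('b \<times> 'b) set, 'a set, 'a set \<Rightarrow> ('a \<times> 'a) set) rs_map" where
  "Proj_map G H h =
    \<lparr>base = (\<lambda>q. {x \<in> carrier G. h x \<in> q}),
     comorph = (\<lambda>V s. \<lambda>q\<in>{q \<in> proj_points H. {x \<in> carrier G. h x \<in> q} \<in> V}.
        \<Union>(a, f)\<in>s {x \<in> carrier G. h x \<in> q}. hfrac H q (h a) (h f))\<rparr>"

section \<open>Projective space and its linear automorphisms\<close>

definition proj_coord_ring :: "nat \<Rightarrow> (nat, 'a::field) mpol graded_ring" where
  "proj_coord_ring N = mpoly_ring {..N}"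

text \<open>The automorphism \<open>y \<mapsto> A y\<close> of \<open>Proj F[y\<^sub>0,\<dots>,y\<^sub>N]\<close>: the coordinate \<open>y\<^sub>i\<close> pulls back to
  \<open>\<Sum>\<^sub>j A\<^sub>i\<^sub>j y\<^sub>j\<close>.\<close>

definition proj_linear_map where
  "proj_linear_map N (A :: 'a::field mat) =
     Proj_map (proj_coord_ring N) (proj_coord_ring N)
       (meval (proj_coord_ring N) mconst (\<lambda>i. \<Sum>j\<le>N. mconst (A $$ (i, j)) * mvar j))"

text \<open>\<open>i : X \<rightarrow> P\<^sup>N\<close> and \<open>j : Y \<rightarrow> P\<^sup>N\<close> are embedded schemes over \<open>F\<close>.  There is an isomorphism
  \<open>\<psi> : X \<rightarrow> Y\<close> induced by a projective linear transformation \<open>g\<close>, that is,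
  \<open>j \<circ> \<psi> = g \<circ> i\<close> as morphisms of schemes; in particular \<open>\<psi>\<close> is an isomorphism over \<open>F\<close>.\<close>

definition proj_linearly_isomorphic ::
  "nat \<Rightarrow> ('p, 's) ringed_space \<Rightarrow>
   ('p, 's, (nat, 'a) mpol set, (nat, 'a) mpol set \<Rightarrow> ((nat, 'a) mpol \<times> (nat, 'a) mpol) set) rs_map \<Rightarrow>
   ('q, 't) ringed_space \<Rightarrow>
   ('q, 't, (nat, 'a::field) mpol set, (nat, 'a) mpol set \<Rightarrow> ((nat, 'a) mpol \<times> (nat, 'a) mpol) set) rs_map
   \<Rightarrow> bool" where
  "proj_linearly_isomorphic N X i Y j \<longleftrightarrow>
     (\<exists>A \<in> carrier_mat (N + 1) (N + 1). invertible_mat A \<and>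
       (\<exists>\<psi>. rs_iso X Y \<psi> \<and>
          rs_map_eq X (Proj (proj_coord_ring N))
            (rs_comp Y j \<psi>)
            (rs_comp (Proj (proj_coord_ring N)) (proj_linear_map N A) i)))"

text \<open>Equality of the points \<open>[a : b]\<close> and \<open>[c : d]\<close> of the projective line.\<close>

definition proj_line_eq :: "'a::field \<times> 'a \<Rightarrow> 'a \<times> 'a \<Rightarrow> bool" where
  "proj_line_eq P P' \<longleftrightarrow> (\<exists>t. t \<noteq> 0 \<and> fst P = t * fst P' \<and> snd P = t * snd P')"

section \<open>Surface scrolls\<close>

text \<open>The variable \<open>x\<^sub>i\<^sub>j\<close> is indexed by the pair \<open>(i, j)\<close>.\<close>

definition scroll_vars :: "nat \<Rightarrow> nat \<Rightarrow> (nat \<times> nat) set" where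
  "scroll_vars m n = {0} \<times> {..m} \<union> {1} \<times> {..n}"

definition scroll_poly_ring :: "nat \<Rightarrow> nat \<Rightarrow> (nat \<times> nat, 'a::field) mpol graded_ring" where
  "scroll_poly_ring m n = mpoly_ring (scroll_vars m n)"

text \<open>The columns of the matrix, indexed by the position of their upper entry \<open>x\<^sub>i\<^sub>j\<close>;
  the lower entry is \<open>x\<^sub>i\<^sub>,\<^sub>j\<^sub>+\<^sub>1\<close>.\<close>

definition scroll_cols :: "nat \<Rightarrow> nat \<Rightarrow> (nat \<times> nat) set" where
  "scroll_cols m n = {0} \<times> {..<m} \<union> {1} \<times> {..<n}"

definition scroll_minors :: "nat \<Rightarrow> nat \<Rightarrow> (nat \<times> nat, 'a::field) mpol set" where
  "scroll_minors m n =
     {mvar (i, j) * mvar (k, l + 1) - mvar (k, l) * mvar (i, j + 1) | i j k l.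
        (i, j) \<in> scroll_cols m n \<and> (k, l) \<in> scroll_cols m n}"

definition scroll_ideal :: "nat \<Rightarrow> nat \<Rightarrow> (nat \<times> nat, 'a::field) mpol set" where
  "scroll_ideal m n = genideal (scroll_poly_ring m n) (scroll_minors m n)"

definition scroll_ring :: "nat \<Rightarrow> nat \<Rightarrow> (nat \<times> nat, 'a::field) mpol set graded_ring" where
  "scroll_ring m n = gquot (scroll_poly_ring m n) (scroll_ideal m n)"

text \<open>The class in \<open>S = R/Q\<close> of a polynomial.\<close>

definition scroll_cls ::
  "nat \<Rightarrow> nat \<Rightarrow> (nat \<times> nat, 'a::field) mpol \<Rightarrow> (nat \<times> nat, 'a) mpol set" where
  "scroll_cls m n r = scroll_ideal m n +>\<^bsub>scroll_poly_ring m n\<^esub> r"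

text \<open>The homogeneous coordinates in the order \<open>x\<^sub>0\<^sub>0, \<dots>, x\<^sub>0\<^sub>m, x\<^sub>1\<^sub>0, \<dots>, x\<^sub>1\<^sub>n\<close>.\<close>

definition scroll_coord :: "nat \<Rightarrow> nat \<Rightarrow> nat \<times> nat" where
  "scroll_coord m k = (if k \<le> m then (0, k) else (1, k - (m + 1)))"

definition scroll where
  "scroll m n = Proj (scroll_ring m n :: (nat \<times> nat, 'a::field) mpol set graded_ring)"

definition scroll_embedding where
  "scroll_embedding m n =
     Proj_map (proj_coord_ring (m + n + 1)) (scroll_ring m n)
       (meval (scroll_ring m n) (\<lambda>c :: 'a::field. scroll_cls m n (mconst c))
          (\<lambda>k. scroll_cls m n (mvar (scroll_coord m k))))"

section \<open>Unprojection\<close>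

definition unproj_ideal :: "nat \<Rightarrow> nat \<Rightarrow> (nat \<times> nat, 'a::field) mpol set set" where
  "unproj_ideal m n = genideal (scroll_ring m n)
     ((\<lambda>v. scroll_cls m n (mvar v)) ` scroll_cols m n)"

text \<open>\<open>\<phi> : I \<rightarrow> S\<close> is a degree zero homomorphism of graded \<open>S\<close>-modules.\<close>

definition graded_ideal_hom ::
  "('a, 'z) graded_ring_scheme \<Rightarrow> 'a set \<Rightarrow> ('a \<Rightarrow> 'a) \<Rightarrow> bool" where
  "graded_ideal_hom S I \<phi> \<longleftrightarrow>
     \<phi> \<in> I \<rightarrow> carrier S \<and>
     (\<forall>u\<in>I. \<forall>v\<in>I. \<phi> (u \<oplus>\<^bsub>S\<^esub> v) = \<phi> u \<oplus>\<^bsub>S\<^esub> \<phi> v) \<and>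
     (\<forall>s\<in>carrier S. \<forall>u\<in>I. \<phi> (s \<otimes>\<^bsub>S\<^esub> u) = s \<otimes>\<^bsub>S\<^esub> \<phi> u) \<and>
     (\<forall>d. \<forall>u \<in> I \<inter> grade S d. \<phi> u \<in> grade S d)"

text \<open>The defining property of the homomorphism \<open>\<phi>\<close>; it determines \<open>\<phi>\<close> on the ideal \<open>I\<close>.\<close>

definition scroll_shift_hom ::
  "nat \<Rightarrow> nat \<Rightarrow> ((nat \<times> nat, 'a::field) mpol set \<Rightarrow> (nat \<times> nat, 'a) mpol set) \<Rightarrow> bool" where
  "scroll_shift_hom m n \<phi> \<longleftrightarrow>
     graded_ideal_hom (scroll_ring m n) (unproj_ideal m n) \<phi> \<and>
     (\<forall>i<m. \<phi> (scroll_cls m n (mvar (0, i))) = scroll_cls m n (mvar (0, i + 1))) \<and>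
     (\<forall>j<n. \<phi> (scroll_cls m n (mvar (1, j))) = scroll_cls m n (mvar (1, j + 1)))"

text \<open>The ideal \<open>(T u - f \<phi>(u), u \<in> I)\<close> of \<open>S[T]\<close> and the graded ring
  \<open>S[T] / (T u - f \<phi>(u), u \<in> I)\<close>, where \<open>deg T = k\<close>.\<close>

definition unprojection_ideal ::
  "('a, 'z) graded_ring_scheme \<Rightarrow> 'a set \<Rightarrow> ('a \<Rightarrow> 'a) \<Rightarrow> nat \<Rightarrow> 'a \<Rightarrow> (nat \<Rightarrow> 'a) set" where
  "unprojection_ideal S I \<phi> k f = genideal (gadjoin S k)
     {up_ring.monom (UP S) u 1 \<ominus>\<^bsub>gadjoin S k\<^esub> up_ring.monom (UP S) (f \<otimes>\<^bsub>S\<^esub> \<phi> u) 0 | u. u \<in> I}"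

definition unprojection_ring ::
  "('a, 'z) graded_ring_scheme \<Rightarrow> 'a set \<Rightarrow> ('a \<Rightarrow> 'a) \<Rightarrow> nat \<Rightarrow> 'a \<Rightarrow> (nat \<Rightarrow> 'a) set graded_ring" where
  "unprojection_ring S I \<phi> k f = gquot (gadjoin S k) (unprojection_ideal S I \<phi> k f)"

definition unprojection_cls ::
  "('a, 'z) graded_ring_scheme \<Rightarrow> 'a set \<Rightarrow> ('a \<Rightarrow> 'a) \<Rightarrow> nat \<Rightarrow> 'a \<Rightarrow> (nat \<Rightarrow> 'a) \<Rightarrow> (nat \<Rightarrow> 'a) set" where
  "unprojection_cls S I \<phi> k f p = unprojection_ideal S I \<phi> k f +>\<^bsub>gadjoin S k\<^esub> p"

definition scroll_unproj_ring where
  "scroll_unproj_ring m n \<phi> k (f :: (nat \<times> nat, 'a::field) mpol set) =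
     unprojection_ring (scroll_ring m n) (unproj_ideal m n) \<phi> k f"

text \<open>The embedding of \<open>Proj S\<^sub>u\<^sub>n(f)\<close> in projective space, for \<open>f\<close> of degree \<open>1\<close>, by the homogeneous
  coordinates \<open>x\<^sub>0\<^sub>0, \<dots>, x\<^sub>0\<^sub>m, x\<^sub>1\<^sub>0, \<dots>, x\<^sub>1\<^sub>n, T\<close>.\<close>

definition scroll_unproj_embedding where
  "scroll_unproj_embedding m n \<phi> (f :: (nat \<times> nat, 'a::field) mpol set) =
    (let S = scroll_ring m n;
         cls = unprojection_cls S (unproj_ideal m n) \<phi> 1 f;
         P = UP S
     in Proj_map (proj_coord_ring (m + n + 2)) (scroll_unproj_ring m n \<phi> 1 f)
          (meval (scroll_unproj_ring m n \<phi> 1 f)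
             (\<lambda>c. cls (up_ring.monom P (scroll_cls m n (mconst c)) 0))
             (\<lambda>k. if k = m + n + 2 then cls (up_ring.monom P \<one>\<^bsub>S\<^esub> 1)
                  else cls (up_ring.monom P (scroll_cls m n (mvar (scroll_coord m k))) 0))))"

definition scroll_linear_form :: "nat \<Rightarrow> nat \<Rightarrow> 'a::field \<Rightarrow> 'a \<Rightarrow> (nat \<times> nat, 'a) mpol set" where
  "scroll_linear_form m n a b =
     scroll_cls m n (mconst a * mvar (0, m) + mconst b * mvar (1, n))"

end

theory Submission
  imports Defs "Jordan_Normal_Form.Determinant"
begin

text \<open>
  By construction \<open>S\<^sub>u\<^sub>n(f)\<close> is the quotient of the polynomial ring in the \<open>x\<^sub>i\<^sub>j\<close> and \<open>T\<close> by the
  \<open>2 \<times> 2\<close> minors of the scroll matrix enlarged by the column with entries \<open>f\<close> and \<open>T\<close>.  If \<open>a = 0\<close>,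
  then \<open>f = b x\<^sub>1\<^sub>n\<close> and \<open>T / b\<close> plays the role of \<open>x\<^sub>1\<^sub>,\<^sub>n\<^sub>+\<^sub>1\<close>.  If \<open>a \<noteq> 0\<close>, put
  \<open>y\<^sub>j = a x\<^sub>0\<^sub>j + b x\<^sub>1\<^sub>,\<^sub>n\<^sub>-\<^sub>m\<^sub>+\<^sub>j\<close> for \<open>j \<le> m\<close> and \<open>y\<^sub>m\<^sub>+\<^sub>1 = T\<close>: then \<open>y\<^sub>m = f\<close>, and the columns with entries
  \<open>y\<^sub>j\<close> and \<open>y\<^sub>j\<^sub>+\<^sub>1\<close> together with the unchanged second block arise from the enlarged matrix by
  invertible column operations, which preserve the ideal of minors.  The isomorphism of graded rings
  and its inverse are obtained from the universal properties of both sides, so the kernels of the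
  coordinate maps are never computed.
\<close>

section \<open>Functoriality of Proj\<close>

text \<open>The index \<open>n - m + j\<close> comes from aligning the two blocks at their right
  ends: the new column has upper entry \<open>f\<close>, a combination of the last entries
  \<open>x_{0,m}\<close> and \<open>x_{1,n}\<close>, so \<open>y_m\<close> must combine exactly
  these, and the earlier \<open>y_j\<close> arise by lowering both indices together. That this stays
  inside the second block is the hypothesis m \<le> n. Both rows are combined with the same
  coefficients, so a linear substitution of the coordinates acts on the matrix as a column
  operation. For a \<noteq> 0 each \<open>x_{0,j}\<close> can be recovered from \<open>y_j\<close>
  and the second block; for a = 0 it cannot, but then \<open>f\<close> belongs to the second block
  alone, which is the one that grows. That the isomorphism is induced by a linear map of the ambient
  space is an equality of morphisms of ringed spaces. It is reduced to an equality of ring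
  homomorphisms out of the polynomial ring, which requires composing maps of the form
  \<open>Proj_map\<close>. These are total functions, although a prime pulled back along a graded
  homomorphism may contain the irrelevant ideal; each composition has to account for this.\<close>

lemma UN_pair_const:
  assumes "(x, y) \<in> A" "\<And>x y. (x, y) \<in> A \<Longrightarrow> F x y = c"
  shows "(\<Union>(x, y)\<in>A. F x y) = c"
  using assms by fastforce

text \<open>The axioms are closure properties of the homogeneous parts, without a decomposition of
  arbitrary elements. They suffice for computing with fractions of equal degree, and they pass to
  \<open>gquot\<close> for any ideal.\<close>

locale graded_cring = cring G for G :: "('a, 'z) graded_ring_scheme" (structure) +
  assumes grade_subset: "grade G d \<subseteq> carrier G"
    and zero_grade: "\<zero> \<in> grade G d"
    and one_grade: "\<one> \<in> grade G 0"
    and add_grade: "\<lbrakk>x \<in> grade G d; y \<in> grade G d\<rbrakk> \<Longrightarrow> x \<oplus> y \<in> grade G d"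
    and mult_grade: "\<lbrakk>x \<in> grade G d; y \<in> grade G e\<rbrakk> \<Longrightarrow> x \<otimes> y \<in> grade G (d + e)"
begin

lemma grade_carrier: "x \<in> grade G d \<Longrightarrow> x \<in> carrier G"
  using grade_subset by blast

lemma homogeneous_carrier: "x \<in> homogeneous_elems G \<Longrightarrow> x \<in> carrier G"
  by (auto simp: homogeneous_elems_def grade_carrier)

lemma homogeneous_mult:
  "\<lbrakk>x \<in> homogeneous_elems G; y \<in> homogeneous_elems G\<rbrakk> \<Longrightarrow> x \<otimes> y \<in> homogeneous_elems G"
  by (auto simp: homogeneous_elems_def intro: mult_grade)

lemma one_homogeneous: "\<one> \<in> homogeneous_elems G"
  using one_grade by (auto simp: homogeneous_elems_def)

lemma primeideal_mult_notin:
  "\<lbrakk>primeideal p G; a \<in> carrier G; b \<in> carrier G; a \<notin> p; b \<notin> p\<rbrakk> \<Longrightarrow> a \<otimes> b \<notin> p"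
  by (auto dest: primeideal.I_prime)

lemma primeideal_one_notin: "primeideal p G \<Longrightarrow> \<one> \<notin> p"
  by (metis ideal.one_imp_carrier primeideal.I_notcarr primeideal_def)

section \<open>Homogeneous localisation at a prime\<close>

lemma hpairs_carrier: "(a, f) \<in> hpairs G p \<Longrightarrow> a \<in> carrier G \<and> f \<in> carrier G"
  by (auto simp: hpairs_def grade_carrier)

lemma hpairs_mult:
  assumes "primeideal p G" "(a, f) \<in> hpairs G p" "(b, g) \<in> hpairs G p"
  shows "(a \<otimes> b, f \<otimes> g) \<in> hpairs G p"
proof -
  from assms(2,3) obtain d e where "a \<in> grade G d" "f \<in> grade G d" "f \<notin> p"
    and "b \<in> grade G e" "g \<in> grade G e" "g \<notin> p"
    by (auto simp: hpairs_def)
  moreover from this have "f \<otimes> g \<notin> p"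
    using primeideal_mult_notin[OF assms(1)] grade_carrier by simp
  ultimately show ?thesis using mult_grade
    by (auto simp: hpairs_def intro!: exI[of _ "d + e"])
qed

lemma hpairs_add:
  assumes "primeideal p G" "(a, f) \<in> hpairs G p" "(b, g) \<in> hpairs G p"
  shows "(a \<otimes> g \<oplus> b \<otimes> f, f \<otimes> g) \<in> hpairs G p"
proof -
  from assms(2,3) obtain d e where "a \<in> grade G d" "f \<in> grade G d" "f \<notin> p"
    and "b \<in> grade G e" "g \<in> grade G e" "g \<notin> p"
    by (auto simp: hpairs_def)
  moreover from this have "a \<otimes> g \<in> grade G (d + e)" "b \<otimes> f \<in> grade G (d + e)"
    using mult_grade[of b e f d] by (auto intro: mult_grade simp: add.commute)
  moreover from calculation have "f \<otimes> g \<notin> p"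
    using primeideal_mult_notin[OF assms(1)] grade_carrier by simp
  ultimately show ?thesis using mult_grade add_grade
    by (auto simp: hpairs_def intro!: exI[of _ "d + e"])
qed

lemma hpairs_one: "primeideal p G \<Longrightarrow> (\<one>, \<one>) \<in> hpairs G p"
  using primeideal_one_notin one_grade by (auto simp: hpairs_def)

text \<open>Only transitivity needs an idea, since \<open>G\<close> may have zero divisors: if h1
  and h2 witness the two given equalities and g is the middle denominator, then h1 h2 g witnesses
  the third. It lies outside \<open>p\<close> because \<open>p\<close> is prime.\<close>

lemma hfrac_rel_equiv:
  assumes p: "primeideal p G"
  shows "equiv (hpairs G p) (hfrac_rel G p)"
proof (rule equivI)
  show "hfrac_rel G p \<subseteq> hpairs G p \<times> hpairs G p"
    by (auto simp: hfrac_rel_def)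
  show "refl_on (hpairs G p) (hfrac_rel G p)"
  proof (rule refl_onI)
    fix x assume x: "x \<in> hpairs G p"
    obtain a f where [simp]: "x = (a, f)" by force
    have c: "a \<in> carrier G" "f \<in> carrier G" using x hpairs_carrier by auto
    then have "\<one> \<otimes> (a \<otimes> f \<ominus> a \<otimes> f) = \<zero>" by algebra
    then show "(x, x) \<in> hfrac_rel G p"
      using x primeideal_one_notin[OF p] one_homogeneous by (auto simp: hfrac_rel_def)
  qed
  show "sym (hfrac_rel G p)"
  proof (rule symI)
    fix x y assume xy: "(x, y) \<in> hfrac_rel G p"
    obtain a f b g where [simp]: "x = (a, f)" "y = (b, g)" by force
    obtain h where h: "h \<in> homogeneous_elems G - p" "h \<otimes> (a \<otimes> g \<ominus> b \<otimes> f) = \<zero>"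
      and P: "(a, f) \<in> hpairs G p" "(b, g) \<in> hpairs G p"
      using xy by (auto simp: hfrac_rel_def)
    have c: "a \<in> carrier G" "f \<in> carrier G" "b \<in> carrier G" "g \<in> carrier G" "h \<in> carrier G"
      using P hpairs_carrier homogeneous_carrier h by auto
    then have "h \<otimes> (b \<otimes> f \<ominus> a \<otimes> g) = \<ominus> (h \<otimes> (a \<otimes> g \<ominus> b \<otimes> f))" by algebra
    then have "h \<otimes> (b \<otimes> f \<ominus> a \<otimes> g) = \<zero>" using h by simp
    then show "(y, x) \<in> hfrac_rel G p" using h P by (auto simp: hfrac_rel_def)
  qed
  show "trans (hfrac_rel G p)"
  proof (rule transI)
    fix x y z assume xy: "(x, y) \<in> hfrac_rel G p" and yz: "(y, z) \<in> hfrac_rel G p"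
    obtain a f b g c k where [simp]: "x = (a, f)" "y = (b, g)" "z = (c, k)"
      by (metis surj_pair)
    obtain h1 where h1: "h1 \<in> homogeneous_elems G - p" "h1 \<otimes> (a \<otimes> g \<ominus> b \<otimes> f) = \<zero>"
      and P: "(a, f) \<in> hpairs G p" "(b, g) \<in> hpairs G p"
      using xy by (auto simp: hfrac_rel_def)
    obtain h2 where h2: "h2 \<in> homogeneous_elems G - p" "h2 \<otimes> (b \<otimes> k \<ominus> c \<otimes> g) = \<zero>"
      and Q: "(c, k) \<in> hpairs G p"
      using yz by (auto simp: hfrac_rel_def)
    have car: "a \<in> carrier G" "f \<in> carrier G" "b \<in> carrier G" "g \<in> carrier G"
      "c \<in> carrier G" "k \<in> carrier G" "h1 \<in> carrier G" "h2 \<in> carrier G"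
      using P Q hpairs_carrier homogeneous_carrier h1 h2 by auto
    \<comment> \<open>On the right the two multiples of b f k cancel, and g splits off from what
      remains.\<close>
    have "h1 \<otimes> h2 \<otimes> g \<otimes> (a \<otimes> k \<ominus> c \<otimes> f) =
        h2 \<otimes> k \<otimes> (h1 \<otimes> (a \<otimes> g \<ominus> b \<otimes> f)) \<oplus> h1 \<otimes> f \<otimes> (h2 \<otimes> (b \<otimes> k \<ominus> c \<otimes> g))"
      using car by algebra
    then have "h1 \<otimes> h2 \<otimes> g \<otimes> (a \<otimes> k \<ominus> c \<otimes> f) = \<zero>" using h1 h2 car by simp
    moreover have "g \<in> homogeneous_elems G - p"
      using P by (auto simp: hpairs_def homogeneous_elems_def)
    then have "h1 \<otimes> h2 \<otimes> g \<in> homogeneous_elems G - p"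
      using h1 h2 car primeideal_mult_notin[OF p] homogeneous_mult by simp
    ultimately show "(x, z) \<in> hfrac_rel G p" using P Q by (auto simp: hfrac_rel_def)
  qed
qed

lemma hfrac_eq_iff:
  assumes "primeideal p G" "(a, f) \<in> hpairs G p" "(b, g) \<in> hpairs G p"
  shows "hfrac G p a f = hfrac G p b g \<longleftrightarrow> ((a, f), (b, g)) \<in> hfrac_rel G p"
  unfolding hfrac_def using eq_equiv_class_iff[OF hfrac_rel_equiv] assms by auto

lemma hfrac_self: "\<lbrakk>primeideal p G; (a, f) \<in> hpairs G p\<rbrakk> \<Longrightarrow> (a, f) \<in> hfrac G p a f"
  unfolding hfrac_def by (rule equiv_class_self[OF hfrac_rel_equiv])

lemma hfrac_memD:
  assumes "primeideal p G" "(b, g) \<in> hfrac G p a f"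
  shows "(b, g) \<in> hpairs G p" "hfrac G p b g = hfrac G p a f"
proof -
  have r: "((a, f), (b, g)) \<in> hfrac_rel G p" using assms(2) by (simp add: hfrac_def)
  then show "(b, g) \<in> hpairs G p" by (auto simp: hfrac_rel_def)
  show "hfrac G p b g = hfrac G p a f"
    unfolding hfrac_def using equiv_class_eq[OF hfrac_rel_equiv[OF assms(1)] r] by simp
qed

lemma hfrac_carrier: "(a, f) \<in> hpairs G p \<Longrightarrow> hfrac G p a f \<in> carrier (hloc G p)"
  by (simp add: hloc_def hfrac_def quotientI)

lemma hloc_carrierE:
  assumes "c \<in> carrier (hloc G p)"
  obtains a f where "(a, f) \<in> hpairs G p" "c = hfrac G p a f"
  using assms by (auto simp: hloc_def hfrac_def elim!: quotientE)

text \<open>The product in \<open>hloc\<close> is a union over all pairs of representatives, so the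
  work is to show that each pair yields the same class; \<open>UN_pair_const\<close> then collapses
  the union. If h1 and h2 witness a/f = a'/f' and b/g = b'/g', then h1 h2 serves for the products,
  by the telescoping a b f' g' - a' b' f g = b g' (a f' - a' f) + a' f (b g' - b' g).\<close>

lemma hfrac_mult:
  assumes p: "primeideal p G" and af: "(a, f) \<in> hpairs G p" and bg: "(b, g) \<in> hpairs G p"
  shows "hfrac G p a f \<otimes>\<^bsub>hloc G p\<^esub> hfrac G p b g = hfrac G p (a \<otimes> b) (f \<otimes> g)"
proof -
  have *: "hfrac G p (a' \<otimes> b') (f' \<otimes> g') = hfrac G p (a \<otimes> b) (f \<otimes> g)"
    if af': "(a', f') \<in> hfrac G p a f" and bg': "(b', g') \<in> hfrac G p b g" for a' f' b' g'
  proof -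
    have P: "(a', f') \<in> hpairs G p" "(b', g') \<in> hpairs G p"
      using hfrac_memD[OF p] af' bg' by auto
    obtain h1 where h1: "h1 \<in> homogeneous_elems G - p" "h1 \<otimes> (a \<otimes> f' \<ominus> a' \<otimes> f) = \<zero>"
      using af' by (auto simp: hfrac_def hfrac_rel_def)
    obtain h2 where h2: "h2 \<in> homogeneous_elems G - p" "h2 \<otimes> (b \<otimes> g' \<ominus> b' \<otimes> g) = \<zero>"
      using bg' by (auto simp: hfrac_def hfrac_rel_def)
    have car: "a \<in> carrier G" "f \<in> carrier G" "b \<in> carrier G" "g \<in> carrier G"
      "a' \<in> carrier G" "f' \<in> carrier G" "b' \<in> carrier G" "g' \<in> carrier G"
      "h1 \<in> carrier G" "h2 \<in> carrier G"
      using P af bg hpairs_carrier homogeneous_carrier h1 h2 by auto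
    have "h1 \<otimes> h2 \<otimes> ((a \<otimes> b) \<otimes> (f' \<otimes> g') \<ominus> (a' \<otimes> b') \<otimes> (f \<otimes> g)) =
        h2 \<otimes> (b \<otimes> g') \<otimes> (h1 \<otimes> (a \<otimes> f' \<ominus> a' \<otimes> f)) \<oplus>
        h1 \<otimes> (a' \<otimes> f) \<otimes> (h2 \<otimes> (b \<otimes> g' \<ominus> b' \<otimes> g))"
      using car by algebra
    then have "h1 \<otimes> h2 \<otimes> ((a \<otimes> b) \<otimes> (f' \<otimes> g') \<ominus> (a' \<otimes> b') \<otimes> (f \<otimes> g)) = \<zero>"
      using h1 h2 car by simp
    moreover have "h1 \<otimes> h2 \<in> homogeneous_elems G - p"
      using h1 h2 car primeideal_mult_notin[OF p] homogeneous_mult by simp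
    ultimately have "((a \<otimes> b, f \<otimes> g), (a' \<otimes> b', f' \<otimes> g')) \<in> hfrac_rel G p"
      using hpairs_mult[OF p] af bg P unfolding hfrac_rel_def by blast
    then show ?thesis using hfrac_eq_iff[OF p] hpairs_mult[OF p] af bg P by metis
  qed
  have "(\<Union>(b', g')\<in>hfrac G p b g. hfrac G p (a' \<otimes> b') (f' \<otimes> g')) = hfrac G p (a \<otimes> b) (f \<otimes> g)"
    if "(a', f') \<in> hfrac G p a f" for a' f'
    using * that hfrac_self[OF p bg] by (intro UN_pair_const)
  then show ?thesis
    using hfrac_self[OF p af] by (simp add: hloc_def UN_pair_const)
qed

lemma hfrac_add:
  assumes p: "primeideal p G" and af: "(a, f) \<in> hpairs G p" and bg: "(b, g) \<in> hpairs G p"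
  shows "hfrac G p a f \<oplus>\<^bsub>hloc G p\<^esub> hfrac G p b g = hfrac G p (a \<otimes> g \<oplus> b \<otimes> f) (f \<otimes> g)"
proof -
  have *: "hfrac G p (a' \<otimes> g' \<oplus> b' \<otimes> f') (f' \<otimes> g') = hfrac G p (a \<otimes> g \<oplus> b \<otimes> f) (f \<otimes> g)"
    if af': "(a', f') \<in> hfrac G p a f" and bg': "(b', g') \<in> hfrac G p b g" for a' f' b' g'
  proof -
    have P: "(a', f') \<in> hpairs G p" "(b', g') \<in> hpairs G p"
      using hfrac_memD[OF p] af' bg' by auto
    obtain h1 where h1: "h1 \<in> homogeneous_elems G - p" "h1 \<otimes> (a \<otimes> f' \<ominus> a' \<otimes> f) = \<zero>"
      using af' by (auto simp: hfrac_def hfrac_rel_def)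
    obtain h2 where h2: "h2 \<in> homogeneous_elems G - p" "h2 \<otimes> (b \<otimes> g' \<ominus> b' \<otimes> g) = \<zero>"
      using bg' by (auto simp: hfrac_def hfrac_rel_def)
    have car: "a \<in> carrier G" "f \<in> carrier G" "b \<in> carrier G" "g \<in> carrier G"
      "a' \<in> carrier G" "f' \<in> carrier G" "b' \<in> carrier G" "g' \<in> carrier G"
      "h1 \<in> carrier G" "h2 \<in> carrier G"
      using P af bg hpairs_carrier homogeneous_carrier h1 h2 by auto
    have "h1 \<otimes> h2 \<otimes> ((a \<otimes> g \<oplus> b \<otimes> f) \<otimes> (f' \<otimes> g') \<ominus> (a' \<otimes> g' \<oplus> b' \<otimes> f') \<otimes> (f \<otimes> g)) =
        h2 \<otimes> (g \<otimes> g') \<otimes> (h1 \<otimes> (a \<otimes> f' \<ominus> a' \<otimes> f)) \<oplus>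
        h1 \<otimes> (f \<otimes> f') \<otimes> (h2 \<otimes> (b \<otimes> g' \<ominus> b' \<otimes> g))"
      using car by algebra
    then have "h1 \<otimes> h2 \<otimes> ((a \<otimes> g \<oplus> b \<otimes> f) \<otimes> (f' \<otimes> g') \<ominus> (a' \<otimes> g' \<oplus> b' \<otimes> f') \<otimes> (f \<otimes> g)) = \<zero>"
      using h1 h2 car by simp
    moreover have "h1 \<otimes> h2 \<in> homogeneous_elems G - p"
      using h1 h2 car primeideal_mult_notin[OF p] homogeneous_mult by simp
    ultimately have
      "((a \<otimes> g \<oplus> b \<otimes> f, f \<otimes> g), (a' \<otimes> g' \<oplus> b' \<otimes> f', f' \<otimes> g')) \<in> hfrac_rel G p"
      using hpairs_add[OF p] af bg P unfolding hfrac_rel_def by blast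
    then show ?thesis using hfrac_eq_iff[OF p] hpairs_add[OF p] af bg P by metis
  qed
  have "(\<Union>(b', g')\<in>hfrac G p b g. hfrac G p (a' \<otimes> g' \<oplus> b' \<otimes> f') (f' \<otimes> g')) = hfrac G p (a \<otimes> g \<oplus> b \<otimes> f) (f \<otimes> g)"
    if "(a', f') \<in> hfrac G p a f" for a' f'
    using * that hfrac_self[OF p bg] by (intro UN_pair_const)
  then show ?thesis
    using hfrac_self[OF p af] by (simp add: hloc_def UN_pair_const)
qed

text \<open>The basic open set of the homogeneous element 1 is already the whole space, since no
  prime contains 1.\<close>

lemma topspace_proj: "topspace (proj_top G) = proj_points G"
  using one_homogeneous primeideal_one_notin
  by (auto simp: proj_top_def proj_points_def)

lemma open_subset_proj_points: "openin (proj_top G) V \<Longrightarrow> V \<subseteq> proj_points G"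
  using openin_subset topspace_proj by metis

lemma proj_points_prime: "p \<in> proj_points G \<Longrightarrow> primeideal p G"
  by (simp add: proj_points_def)

lemma proj_sectionsE:
  assumes "s \<in> carrier (proj_sections G V)" "p \<in> V"
  obtains a f where "(a, f) \<in> hpairs G p" "s p = hfrac G p a f"
proof -
  have "s p \<in> carrier (hloc G p)" using assms by (auto simp: proj_sections_def)
  then show ?thesis using that hloc_carrierE by metis
qed

end

section \<open>Morphisms induced by graded homomorphisms\<close>

definition graded_hom :: "('a, 'y) graded_ring_scheme \<Rightarrow> ('b, 'z) graded_ring_scheme \<Rightarrow> ('a \<Rightarrow> 'b) set"
  where "graded_hom G H = {h \<in> Ring.ring_hom G H. \<forall>d. \<forall>x \<in> grade G d. h x \<in> grade H d}"

definition pullback :: "('a, 'z) graded_ring_scheme \<Rightarrow> ('a \<Rightarrow> 'b) \<Rightarrow> 'b set \<Rightarrow> 'a set" where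
  "pullback G h q = {x \<in> carrier G. h x \<in> q}"

lemma base_Proj_map: "base (Proj_map G H h) q = pullback G h q"
  by (simp add: Proj_map_def pullback_def)

locale graded_hom_cring = G: graded_cring G + H: graded_cring H
  for G :: "('a, 'y) graded_ring_scheme" and H :: "('b, 'z) graded_ring_scheme" +
  fixes h :: "'a \<Rightarrow> 'b"
  assumes graded_hom: "h \<in> graded_hom G H"
begin

sublocale ring_hom_cring G H h
  using graded_hom by unfold_locales (simp add: graded_hom_def)

lemma hom_grade: "x \<in> grade G d \<Longrightarrow> h x \<in> grade H d"
  using graded_hom by (simp add: graded_hom_def)

lemma hom_homogeneous: "x \<in> homogeneous_elems G \<Longrightarrow> h x \<in> homogeneous_elems H"
  by (auto simp: homogeneous_elems_def intro: hom_grade)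

lemma hom_minus: "\<lbrakk>x \<in> carrier G; y \<in> carrier G\<rbrakk> \<Longrightarrow> h (x \<ominus>\<^bsub>G\<^esub> y) = h x \<ominus>\<^bsub>H\<^esub> h y"
  by (simp add: a_minus_def)

lemma primeideal_pullback:
  assumes "primeideal q H" shows "primeideal (pullback G h q) G"
proof (rule primeidealI)
  interpret q: primeideal q H by fact
  show "ideal (pullback G h q) G"
    unfolding pullback_def using ring.ideal_vimage[OF q.ideal_axioms] by simp
  show "carrier G \<noteq> pullback G h q"
    using H.primeideal_one_notin[OF assms] G.one_closed hom_one
    unfolding pullback_def by (metis (no_types, lifting) mem_Collect_eq)
qed (auto simp: pullback_def G.cring_axioms dest: primeideal.I_prime[OF assms, rotated -1])

lemma hpairs_hom:
  "(a, f) \<in> hpairs G (pullback G h q) \<Longrightarrow> (h a, h f) \<in> hpairs H q"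
  by (auto simp: hpairs_def pullback_def G.grade_carrier intro: hom_grade)

text \<open>The comorphism of \<open>Proj_map\<close> is again a union over representatives. A
  witness t outside the pullback of \<open>q\<close> is mapped to h t outside \<open>q\<close>, so
  equal fractions have equal images and the union has a single value.\<close>

lemma hfrac_hom:
  assumes q: "primeideal q H" and af: "(a, f) \<in> hpairs G (pullback G h q)"
  shows "(\<Union>(b, g)\<in>hfrac G (pullback G h q) a f. hfrac H q (h b) (h g)) = hfrac H q (h a) (h f)"
proof -
  note p = primeideal_pullback[OF q]
  have "hfrac H q (h b) (h g) = hfrac H q (h a) (h f)"
    if bg: "(b, g) \<in> hfrac G (pullback G h q) a f" for b g
  proof -
    have P: "(b, g) \<in> hpairs G (pullback G h q)" by (rule G.hfrac_memD[OF p bg])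
    obtain t where t: "t \<in> homogeneous_elems G - pullback G h q"
      "t \<otimes>\<^bsub>G\<^esub> (a \<otimes>\<^bsub>G\<^esub> g \<ominus>\<^bsub>G\<^esub> b \<otimes>\<^bsub>G\<^esub> f) = \<zero>\<^bsub>G\<^esub>"
      using bg by (auto simp: hfrac_def hfrac_rel_def)
    have car: "a \<in> carrier G" "f \<in> carrier G" "b \<in> carrier G" "g \<in> carrier G" "t \<in> carrier G"
      using P af G.hpairs_carrier G.homogeneous_carrier t by auto
    have "h t \<otimes>\<^bsub>H\<^esub> (h a \<otimes>\<^bsub>H\<^esub> h g \<ominus>\<^bsub>H\<^esub> h b \<otimes>\<^bsub>H\<^esub> h f)
        = h (t \<otimes>\<^bsub>G\<^esub> (a \<otimes>\<^bsub>G\<^esub> g \<ominus>\<^bsub>G\<^esub> b \<otimes>\<^bsub>G\<^esub> f))"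
      using car by (simp add: hom_minus)
    also have "\<dots> = \<zero>\<^bsub>H\<^esub>" using t by simp
    finally have "((h a, h f), (h b, h g)) \<in> hfrac_rel H q"
      using t car hpairs_hom[OF P] hpairs_hom[OF af] hom_homogeneous
      unfolding hfrac_rel_def pullback_def by blast
    then show ?thesis using H.hfrac_eq_iff[OF q] hpairs_hom[OF P] hpairs_hom[OF af] by metis
  qed
  then show ?thesis using G.hfrac_self[OF p af] by (intro UN_pair_const)
qed

lemma comorph_Proj_map:
  assumes "q \<in> proj_points H" "pullback G h q \<in> V"
    and "(a, f) \<in> hpairs G (pullback G h q)" "s (pullback G h q) = hfrac G (pullback G h q) a f"
  shows "comorph (Proj_map G H h) V s q = hfrac H q (h a) (h f)"
  using assms hfrac_hom[OF H.proj_points_prime] by (simp add: Proj_map_def pullback_def)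

text \<open>Sections are extensional functions. Equality of sections is tested at every argument, so
  the default value off the domain has to be known as well.\<close>

lemma comorph_Proj_map_outside:
  assumes "\<not> (q \<in> proj_points H \<and> pullback G h q \<in> V)"
  shows "comorph (Proj_map G H h) V s q = undefined"
  using assms by (auto simp: Proj_map_def pullback_def)

lemma rs_vimage_Proj_map:
  "rs_vimage (Proj H) (Proj_map G H h) V = {q \<in> proj_points H. pullback G h q \<in> V}"
  by (simp add: rs_vimage_def base_Proj_map Proj_def H.topspace_proj)

end

text \<open>In general \<open>Proj_map\<close> is only defined on an open subset; the locale excludes this.\<close>

locale proj_hom = graded_hom_cring +
  assumes pullback_proj_points: "q \<in> proj_points H \<Longrightarrow> pullback G h q \<in> proj_points G"
begin

text \<open>The preimage of the basic open set of a homogeneous f is the basic open set of h f; the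
  totality assumption of the locale ensures that the preimage is cut out by this condition
  alone.\<close>

lemma continuous_pullback: "continuous_map (proj_top H) (proj_top G) (pullback G h)"
  unfolding proj_top_def[of G]
proof (rule continuous_on_generated_topo)
  fix U assume "U \<in> (\<lambda>f. {p \<in> proj_points G. f \<notin> p}) ` homogeneous_elems G"
  then obtain f where f: "f \<in> homogeneous_elems G" and U: "U = {p \<in> proj_points G. f \<notin> p}"
    by auto
  have "pullback G h -` U \<inter> topspace (proj_top H) = {q \<in> proj_points H. h f \<notin> q}"
    using G.homogeneous_carrier[OF f] pullback_proj_points
    by (auto simp: U H.topspace_proj pullback_def)
  moreover have "openin (proj_top H) {q \<in> proj_points H. h f \<notin> q}"
    unfolding proj_top_def using hom_homogeneous[OF f]
    by (intro topology_generated_by_Basis) auto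
  ultimately show "openin (proj_top H) (pullback G h -` U \<inter> topspace (proj_top H))" by simp
next
  have "\<Union> ((\<lambda>f. {p \<in> proj_points G. f \<notin> p}) ` homogeneous_elems G) = proj_points G"
    using G.topspace_proj unfolding proj_top_def by simp
  then show "pullback G h ` topspace (proj_top H)
      \<subseteq> \<Union> ((\<lambda>f. {p \<in> proj_points G. f \<notin> p}) ` homogeneous_elems G)"
    using pullback_proj_points by (auto simp: H.topspace_proj)
qed

lemma openin_vimage:
  assumes "openin (proj_top G) V"
  shows "openin (proj_top H) {q \<in> proj_points H. pullback G h q \<in> V}"
  using openin_continuous_map_preimage[OF continuous_pullback assms] H.topspace_proj by simp

text \<open>If a section equals a/f on a neighbourhood \<open>W\<close> of the pulled back point,
  its image equals h a / h f on the preimage of \<open>W\<close>, which is open by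
  continuity.\<close>

lemma comorph_closed:
  assumes s: "s \<in> carrier (proj_sections G V)"
  shows "comorph (Proj_map G H h) V s
    \<in> carrier (proj_sections H {q \<in> proj_points H. pullback G h q \<in> V})"
proof -
  let ?U = "{q \<in> proj_points H. pullback G h q \<in> V}"
  let ?s = "comorph (Proj_map G H h) V s"
  have "?s \<in> (\<Pi>\<^sub>E q\<in>?U. carrier (hloc H q))"
  proof (rule PiE_I)
    fix q assume q: "q \<in> ?U"
    obtain a f where af: "(a, f) \<in> hpairs G (pullback G h q)"
      "s (pullback G h q) = hfrac G (pullback G h q) a f"
      using G.proj_sectionsE[OF s] q by blast
    then show "?s q \<in> carrier (hloc H q)"
      using q H.hfrac_carrier[OF hpairs_hom] comorph_Proj_map by simp
  qed (use comorph_Proj_map_outside in blast)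
  moreover have "\<exists>W. openin (proj_top H) W \<and> q \<in> W \<and> W \<subseteq> ?U \<and>
      (\<exists>d. \<exists>a \<in> grade H d. \<exists>f \<in> grade H d. \<forall>r\<in>W. f \<notin> r \<and> ?s r = hfrac H r a f)"
    if q: "q \<in> ?U" for q
  proof -
    have "\<exists>W. openin (proj_top G) W \<and> pullback G h q \<in> W \<and> W \<subseteq> V \<and>
        (\<exists>d. \<exists>a \<in> grade G d. \<exists>f \<in> grade G d. \<forall>p\<in>W. f \<notin> p \<and> s p = hfrac G p a f)"
      using s q by (simp add: proj_sections_def)
    then obtain W where W: "openin (proj_top G) W" "pullback G h q \<in> W" "W \<subseteq> V"
      and "\<exists>d. \<exists>a \<in> grade G d. \<exists>f \<in> grade G d. \<forall>p\<in>W. f \<notin> p \<and> s p = hfrac G p a f"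
      by - (erule exE, (erule conjE)+, rule that)
    then obtain d a f where af: "a \<in> grade G d" "f \<in> grade G d"
      and frac: "\<forall>p\<in>W. f \<notin> p \<and> s p = hfrac G p a f"
      by (elim exE bexE)
    let ?W = "{r \<in> proj_points H. pullback G h r \<in> W}"
    have "h f \<notin> r \<and> ?s r = hfrac H r (h a) (h f)" if r: "r \<in> ?W" for r
    proof -
      have "(a, f) \<in> hpairs G (pullback G h r)" using af frac r by (auto simp: hpairs_def)
      then have "?s r = hfrac H r (h a) (h f)"
        using comorph_Proj_map r W frac by auto
      moreover have "h f \<notin> r" using r frac G.grade_carrier[OF af(2)] by (auto simp: pullback_def)
      ultimately show ?thesis by simp
    qed
    then have "\<exists>d. \<exists>a \<in> grade H d. \<exists>f \<in> grade H d. \<forall>r\<in>?W. f \<notin> r \<and> ?s r = hfrac H r a f"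
      using hom_grade[OF af(1)] hom_grade[OF af(2)]
      by (intro exI[of _ d] bexI[of _ "h a"] bexI[of _ "h f"] ballI)
    moreover have "?W \<subseteq> ?U" "q \<in> ?W" using W q by auto
    ultimately show ?thesis using openin_vimage[OF W(1)] by (intro exI[of _ ?W] conjI)
  qed
  ultimately show ?thesis by (simp add: proj_sections_def)
qed

text \<open>Everything is checked pointwise. At a point of the domain, representatives of both
  sections at the pulled back prime are multiplied or added as fractions and then mapped; elsewhere
  both sides are \<open>undefined\<close>.\<close>

lemma comorph_ring_hom:
  assumes V: "V \<subseteq> proj_points G"
  shows "comorph (Proj_map G H h) V
    \<in> Ring.ring_hom (proj_sections G V) (proj_sections H {q \<in> proj_points H. pullback G h q \<in> V})"
proof (rule ring_hom_memI)
  let ?U = "{q \<in> proj_points H. pullback G h q \<in> V}"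
  let ?c = "comorph (Proj_map G H h) V"
  fix s t assume st: "s \<in> carrier (proj_sections G V)" "t \<in> carrier (proj_sections G V)"
  have "?c (s \<otimes>\<^bsub>proj_sections G V\<^esub> t) q = (?c s \<otimes>\<^bsub>proj_sections H ?U\<^esub> ?c t) q \<and>
      ?c (s \<oplus>\<^bsub>proj_sections G V\<^esub> t) q = (?c s \<oplus>\<^bsub>proj_sections H ?U\<^esub> ?c t) q" for q
  proof (cases "q \<in> ?U")
    case False
    then have "?c u q = undefined" for u using comorph_Proj_map_outside by blast
    then show ?thesis using False by (auto simp: proj_sections_def)
  next
    case True
    let ?p = "pullback G h q"
    have q: "q \<in> proj_points H" and pV: "?p \<in> V" using True by auto
    note qp = H.proj_points_prime[OF q] and pp = primeideal_pullback[OF H.proj_points_prime[OF q]]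
    obtain a f where af: "(a, f) \<in> hpairs G ?p" "s ?p = hfrac G ?p a f"
      using G.proj_sectionsE[OF st(1) pV] .
    obtain b g where bg: "(b, g) \<in> hpairs G ?p" "t ?p = hfrac G ?p b g"
      using G.proj_sectionsE[OF st(2) pV] .
    have car: "a \<in> carrier G" "f \<in> carrier G" "b \<in> carrier G" "g \<in> carrier G"
      using af bg G.hpairs_carrier by auto
    have "(s \<otimes>\<^bsub>proj_sections G V\<^esub> t) ?p = hfrac G ?p (a \<otimes>\<^bsub>G\<^esub> b) (f \<otimes>\<^bsub>G\<^esub> g)"
      using pV G.hfrac_mult[OF pp] af bg by (simp add: proj_sections_def)
    then have "?c (s \<otimes>\<^bsub>proj_sections G V\<^esub> t) q = hfrac H q (h (a \<otimes>\<^bsub>G\<^esub> b)) (h (f \<otimes>\<^bsub>G\<^esub> g))"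
      using comorph_Proj_map[OF q pV G.hpairs_mult[OF pp af(1) bg(1)]] by simp
    also have "\<dots> = (?c s \<otimes>\<^bsub>proj_sections H ?U\<^esub> ?c t) q"
      using True car comorph_Proj_map[where s = s, OF q pV af] comorph_Proj_map[where s = t, OF q pV bg]
        H.hfrac_mult[OF qp hpairs_hom[OF af(1)] hpairs_hom[OF bg(1)]]
      by (simp add: proj_sections_def)
    finally have 1: "?c (s \<otimes>\<^bsub>proj_sections G V\<^esub> t) q = (?c s \<otimes>\<^bsub>proj_sections H ?U\<^esub> ?c t) q" .
    have "(s \<oplus>\<^bsub>proj_sections G V\<^esub> t) ?p
        = hfrac G ?p (a \<otimes>\<^bsub>G\<^esub> g \<oplus>\<^bsub>G\<^esub> b \<otimes>\<^bsub>G\<^esub> f) (f \<otimes>\<^bsub>G\<^esub> g)"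
      using pV G.hfrac_add[OF pp] af bg by (simp add: proj_sections_def)
    then have "?c (s \<oplus>\<^bsub>proj_sections G V\<^esub> t) q
        = hfrac H q (h (a \<otimes>\<^bsub>G\<^esub> g \<oplus>\<^bsub>G\<^esub> b \<otimes>\<^bsub>G\<^esub> f)) (h (f \<otimes>\<^bsub>G\<^esub> g))"
      using comorph_Proj_map[OF q pV G.hpairs_add[OF pp af(1) bg(1)]] by simp
    also have "\<dots> = (?c s \<oplus>\<^bsub>proj_sections H ?U\<^esub> ?c t) q"
      using True car comorph_Proj_map[where s = s, OF q pV af] comorph_Proj_map[where s = t, OF q pV bg]
        H.hfrac_add[OF qp hpairs_hom[OF af(1)] hpairs_hom[OF bg(1)]]
      by (simp add: proj_sections_def)
    finally show ?thesis using 1 by simp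
  qed
  then show "?c (s \<otimes>\<^bsub>proj_sections G V\<^esub> t) = ?c s \<otimes>\<^bsub>proj_sections H ?U\<^esub> ?c t"
    "?c (s \<oplus>\<^bsub>proj_sections G V\<^esub> t) = ?c s \<oplus>\<^bsub>proj_sections H ?U\<^esub> ?c t"
    by auto
next
  let ?U = "{q \<in> proj_points H. pullback G h q \<in> V}"
  have "comorph (Proj_map G H h) V \<one>\<^bsub>proj_sections G V\<^esub> q = \<one>\<^bsub>proj_sections H ?U\<^esub> q" for q
  proof (cases "q \<in> ?U")
    case True
    then have "primeideal q H" using H.proj_points_prime by simp
    then show ?thesis
      using True comorph_Proj_map[of q V "\<one>\<^bsub>G\<^esub>" "\<one>\<^bsub>G\<^esub>" "\<one>\<^bsub>proj_sections G V\<^esub>"]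
        G.hpairs_one primeideal_pullback
      by (simp add: proj_sections_def hloc_def)
  qed (use comorph_Proj_map_outside in \<open>auto simp: proj_sections_def\<close>)
  then show "comorph (Proj_map G H h) V \<one>\<^bsub>proj_sections G V\<^esub> = \<one>\<^bsub>proj_sections H ?U\<^esub>" by auto
qed (rule comorph_closed)

lemma comorph_restr:
  assumes "s \<in> carrier (proj_sections G V)" "W \<subseteq> V"
  shows "comorph (Proj_map G H h) W (restrict s W)
    = restrict (comorph (Proj_map G H h) V s) {q \<in> proj_points H. pullback G h q \<in> W}"
  using assms(2) by (fastforce simp: Proj_map_def pullback_def)

end

section \<open>Graded isomorphisms and isomorphisms of Proj\<close>

locale graded_iso_cring = graded_hom_cring G H h + inv: graded_hom_cring H G k
  for G :: "('a, 'y) graded_ring_scheme" and H :: "('b, 'z) graded_ring_scheme"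
    and h :: "'a \<Rightarrow> 'b" and k :: "'b \<Rightarrow> 'a" +
  assumes inv_hom: "x \<in> carrier G \<Longrightarrow> k (h x) = x"
    and hom_inv: "y \<in> carrier H \<Longrightarrow> h (k y) = y"
begin

text \<open>The inverse \<open>k\<close> is a parameter of the locale, in place of bijectivity of
  \<open>h\<close>. Interpreting the locale with exchanged roles therefore supplies each result for
  the inverse map too.\<close>

lemma graded_iso_sym: "graded_iso_cring H G k h"
  by (intro graded_iso_cring.intro graded_iso_cring_axioms.intro
      graded_hom_cring_axioms inv.graded_hom_cring_axioms hom_inv inv_hom)

lemma pullback_pullback:
  assumes "p \<subseteq> carrier G" shows "pullback G h (pullback H k p) = p"
  using assms inv_hom by (auto simp: pullback_def)

text \<open>Elements cannot be split into homogeneous components here, so homogeneous generators are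
  transported through the inverse: the ideal \<open>?J\<close> generated by the homogeneous elements
  of the pullback, pulled back along \<open>k\<close>, contains the homogeneous generators of
  \<open>q\<close> and hence \<open>q\<close>; applying \<open>k\<close> to images under
  \<open>h\<close> gives the inclusion of the pullback in \<open>?J\<close>.\<close>

lemma homogeneous_pullback:
  assumes "homogeneous_ideal q H" shows "homogeneous_ideal (pullback G h q) G"
proof -
  have q: "ideal q H" and qgen: "q = genideal H (q \<inter> homogeneous_elems H)"
    using assms by (auto simp: homogeneous_ideal_def)
  have p: "ideal (pullback G h q) G"
    unfolding pullback_def using ring.ideal_vimage[OF q] by simp
  let ?J = "genideal G (pullback G h q \<inter> homogeneous_elems G)"
  have S: "pullback G h q \<inter> homogeneous_elems G \<subseteq> carrier G" by (auto simp: pullback_def)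
  have J: "ideal ?J G" by (rule G.genideal_ideal[OF S])
  have kJ: "ideal (pullback H k ?J) H"
    using inv.ring.ideal_vimage[OF J] by (simp add: pullback_def[of H k])
  have "q \<inter> homogeneous_elems H \<subseteq> pullback H k ?J"
  proof
    fix y assume y: "y \<in> q \<inter> homogeneous_elems H"
    then have "y \<in> carrier H" using H.homogeneous_carrier by auto
    then have "k y \<in> pullback G h q \<inter> homogeneous_elems G"
      using y hom_inv inv.hom_homogeneous by (auto simp: pullback_def)
    then show "y \<in> pullback H k ?J"
      using G.genideal_self[OF S] \<open>y \<in> carrier H\<close> by (auto simp: pullback_def)
  qed
  then have "q \<subseteq> pullback H k ?J" using H.genideal_minimal[OF kJ] qgen by metis
  then have "pullback G h q \<subseteq> ?J" using inv_hom by (force simp: pullback_def)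
  moreover have "?J \<subseteq> pullback G h q" by (rule G.genideal_minimal[OF p]) simp
  ultimately show ?thesis using p by (auto simp: homogeneous_ideal_def)
qed

lemma proj_points_pullback:
  assumes "q \<in> proj_points H" shows "pullback G h q \<in> proj_points G"
proof -
  have q: "primeideal q H" "homogeneous_ideal q H" "\<not> irrelevant_ideal H \<subseteq> q"
    using assms by (auto simp: proj_points_def)
  \<comment> \<open>This is the contrapositive of the third condition on points. An element y of
    positive degree equals h (k y), and k y has the same degree, so it lies in the irrelevant ideal
    of \<open>G\<close>.\<close>
  have "irrelevant_ideal H \<subseteq> q" if "irrelevant_ideal G \<subseteq> pullback G h q"
  proof -
    have "grade H d \<subseteq> q" if "d \<in> {1..}" for d
    proof
      fix y assume y: "y \<in> grade H d"
      have "(\<Union>d\<in>{1..}. grade G d) \<subseteq> carrier G" using G.grade_carrier by auto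
      from G.genideal_self[OF this] have "k y \<in> irrelevant_ideal G"
        unfolding irrelevant_ideal_def using inv.hom_grade[OF y] that by blast
      then show "y \<in> q"
        using \<open>irrelevant_ideal G \<subseteq> pullback G h q\<close> hom_inv H.grade_carrier[OF y]
        by (auto simp: pullback_def)
    qed
    then show ?thesis unfolding irrelevant_ideal_def
      by (intro H.genideal_minimal[OF primeideal.axioms(1)[OF q(1)]]) blast
  qed
  then show ?thesis
    using primeideal_pullback homogeneous_pullback q by (auto simp: proj_points_def)
qed

sublocale proj_hom G H h
  by unfold_locales (rule proj_points_pullback)

lemma inv_pullback_proj_points:
  assumes "q \<in> proj_points H" shows "pullback H k (pullback G h q) = q"
proof -
  have "q \<subseteq> carrier H"
    using ideal.Icarr[OF primeideal.axioms(1)[OF H.proj_points_prime[OF assms]]] by auto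
  then show ?thesis using hom_inv by (auto simp: pullback_def)
qed

text \<open>A fraction a/f goes to h a / h f and back to k (h a) / k (h f), which is a/f. Outside
  \<open>V\<close> both sides are \<open>undefined\<close>, since \<open>s\<close> is
  extensional.\<close>

lemma comorph_comorph:
  assumes V: "V \<subseteq> proj_points G" and s: "s \<in> carrier (proj_sections G V)"
  shows "comorph (Proj_map H G k) {q \<in> proj_points H. pullback G h q \<in> V}
    (comorph (Proj_map G H h) V s) = s"
proof
  let ?U = "{q \<in> proj_points H. pullback G h q \<in> V}"
  fix p
  interpret sym: graded_iso_cring H G k h by (rule graded_iso_sym)
  show "comorph (Proj_map H G k) ?U (comorph (Proj_map G H h) V s) p = s p"
  proof (cases "p \<in> V")
    case True
    let ?q = "pullback H k p"
    have p: "p \<in> proj_points G" using True V by auto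
    have q: "?q \<in> proj_points H" and pq: "pullback G h ?q = p"
      using sym.proj_points_pullback[OF p] sym.inv_pullback_proj_points[OF p] by auto
    obtain a f where af: "(a, f) \<in> hpairs G p" "s p = hfrac G p a f"
      using G.proj_sectionsE[OF s True] .
    have "comorph (Proj_map G H h) V s ?q = hfrac H ?q (h a) (h f)"
      using comorph_Proj_map[of ?q V a f s] q pq af True by simp
    then show ?thesis
      using inv.comorph_Proj_map[of p ?U "h a" "h f"] p q pq True af hpairs_hom[of a f ?q]
        G.hpairs_carrier[OF af(1)] inv_hom by simp
  next
    case False
    then have "\<not> (p \<in> proj_points G \<and> pullback H k p \<in> ?U)"
      using sym.inv_pullback_proj_points by auto
    moreover have "s p = undefined" using False s by (auto simp: proj_sections_def intro: PiE_arb)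
    ultimately show ?thesis using inv.comorph_Proj_map_outside by simp
  qed
qed

lemma homeomorphic_pullback: "homeomorphic_map (proj_top H) (proj_top G) (pullback G h)"
proof -
  interpret sym: graded_iso_cring H G k h by (rule graded_iso_sym)
  have "homeomorphic_maps (proj_top H) (proj_top G) (pullback G h) (pullback H k)"
    using continuous_pullback sym.continuous_pullback inv_pullback_proj_points
      sym.inv_pullback_proj_points
    by (simp add: homeomorphic_maps_def G.topspace_proj H.topspace_proj)
  then show ?thesis by (rule homeomorphic_maps_imp_map)
qed

theorem rs_iso_Proj_map: "rs_iso (Proj H) (Proj G) (Proj_map G H h)"
proof -
  interpret sym: graded_iso_cring H G k h by (rule graded_iso_sym)
  have "comorph (Proj_map G H h) V
      \<in> ring_iso (proj_sections G V) (proj_sections H {q \<in> proj_points H. pullback G h q \<in> V})"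
    if "openin (proj_top G) V" for V
  proof -
    let ?U = "{q \<in> proj_points H. pullback G h q \<in> V}"
    have V: "V \<subseteq> proj_points G" using G.open_subset_proj_points that .
    \<comment> \<open>Pulling \<open>?U\<close> back along the inverse returns \<open>V\<close>, so
      the comorphism of the inverse over \<open>?U\<close> lands in the sections over
      \<open>V\<close> and can serve as the inverse function.\<close>
    have VU: "{p \<in> proj_points G. pullback H k p \<in> ?U} = V"
      using V sym.proj_points_pullback sym.inv_pullback_proj_points by auto
    have "bij_betw (comorph (Proj_map G H h) V)
        (carrier (proj_sections G V)) (carrier (proj_sections H ?U))"
    proof (rule bij_betw_byWitness[where f' = "comorph (Proj_map H G k) ?U"])
      show "\<forall>s\<in>carrier (proj_sections G V).
          comorph (Proj_map H G k) ?U (comorph (Proj_map G H h) V s) = s"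
        using comorph_comorph[OF V] by simp
      show "\<forall>t\<in>carrier (proj_sections H ?U).
          comorph (Proj_map G H h) V (comorph (Proj_map H G k) ?U t) = t"
        using sym.comorph_comorph[of ?U] VU by auto
      show "comorph (Proj_map G H h) V ` carrier (proj_sections G V)
          \<subseteq> carrier (proj_sections H ?U)"
        using comorph_closed by auto
      show "comorph (Proj_map H G k) ?U ` carrier (proj_sections H ?U)
          \<subseteq> carrier (proj_sections G V)"
        using sym.comorph_closed[of _ ?U] VU by auto
    qed
    then show ?thesis using comorph_ring_hom[OF V] by (simp add: ring_iso_def)
  qed
  moreover have "base (Proj_map G H h) = pullback G h" by (auto simp: base_Proj_map)
  ultimately show ?thesis
    unfolding rs_iso_def rs_vimage_Proj_map
    using homeomorphic_pullback comorph_restr by (simp add: Proj_def)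
qed

end

section \<open>Polynomial rings\<close>

lemma update_eq_add_single:
  fixes f :: "'b \<Rightarrow>\<^sub>0 'c::monoid_add"
  assumes "k \<notin> Poly_Mapping.keys f"
  shows "Poly_Mapping.update k v f = f + Poly_Mapping.single k v"
proof (rule poly_mapping_eqI)
  fix i
  show "Poly_Mapping.lookup (Poly_Mapping.update k v f) i =
      Poly_Mapping.lookup (f + Poly_Mapping.single k v) i"
    using assms by (cases "i = k")
      (auto simp: lookup_update lookup_add lookup_single in_keys_iff)
qed

text \<open>At a fresh key, \<open>update\<close> is addition of a single term. In this additive
  form the induction fits the additivity of evaluation; the equation for the keys is kept because
  membership in \<open>mpoly_ring\<close> is a condition on keys.\<close>

lemma poly_mapping_add_single_induct [case_names zero add_single]:
  fixes f :: "'b \<Rightarrow>\<^sub>0 'c::monoid_add"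
  assumes "P 0"
    and "\<And>f k v. \<lbrakk>k \<notin> Poly_Mapping.keys f; v \<noteq> 0; P f;
        Poly_Mapping.keys (f + Poly_Mapping.single k v) = insert k (Poly_Mapping.keys f)\<rbrakk>
      \<Longrightarrow> P (f + Poly_Mapping.single k v)"
  shows "P f"
proof (induction f rule: update_induct)
  case (update f k v)
  have "Poly_Mapping.keys (f + Poly_Mapping.single k v) = insert k (Poly_Mapping.keys f)"
    using keys_update[of k v f] update update_eq_add_single[of k f v] by simp
  then show ?case
    using assms(2)[of k f v] update update_eq_add_single[of k f v] by simp
qed (rule assms(1))

lemma mpoly_ring_simps [simp]:
  "monoid.mult (mpoly_ring V) = (*)" "one (mpoly_ring V) = 1"
  "zero (mpoly_ring V) = 0" "add (mpoly_ring V) = (+)"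
  by (simp_all add: mpoly_ring_def)

lemma carrier_mpoly_ring:
  "p \<in> carrier (mpoly_ring V) \<longleftrightarrow> (\<forall>t \<in> Poly_Mapping.keys p. Poly_Mapping.keys t \<subseteq> V)"
  by (simp add: mpoly_ring_def)

lemma grade_mpoly_ring:
  "p \<in> grade (mpoly_ring V) d \<longleftrightarrow> p \<in> carrier (mpoly_ring V) \<and>
    (\<forall>t \<in> Poly_Mapping.keys p. (\<Sum>v\<in>Poly_Mapping.keys t. Poly_Mapping.lookup t v) = d)"
  by (auto simp: mpoly_ring_def)

lemma mpoly_add_closed:
  "\<lbrakk>p \<in> carrier (mpoly_ring V); q \<in> carrier (mpoly_ring V)\<rbrakk> \<Longrightarrow> p + q \<in> carrier (mpoly_ring V)"
  using Poly_Mapping.keys_add[of p q] by (auto simp: carrier_mpoly_ring)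

lemma mpoly_mult_keysE:
  assumes "t \<in> Poly_Mapping.keys (p * q :: ('v, 'a::field) mpol)"
  obtains r s where "r \<in> Poly_Mapping.keys p" "s \<in> Poly_Mapping.keys q" "t = r + s"
  using assms Poly_Mapping.keys_mult[of p q] by blast

lemma mpoly_mult_closed:
  assumes "p \<in> carrier (mpoly_ring V)" "q \<in> carrier (mpoly_ring V)"
  shows "p * q \<in> carrier (mpoly_ring V)"
  unfolding carrier_mpoly_ring
proof
  fix t assume "t \<in> Poly_Mapping.keys (p * q)"
  then obtain r s where "r \<in> Poly_Mapping.keys p" "s \<in> Poly_Mapping.keys q" "t = r + s"
    by (rule mpoly_mult_keysE)
  then show "Poly_Mapping.keys t \<subseteq> V"
    using assms Poly_Mapping.keys_add[of r s] unfolding carrier_mpoly_ring by blast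
qed

lemma cring_mpoly_ring: "cring (mpoly_ring V :: ('v, 'a::field) mpol graded_ring)"
proof (rule cringI)
  show "abelian_group (mpoly_ring V :: ('v, 'a) mpol graded_ring)"
  proof (rule abelian_groupI)
    fix p :: "('v, 'a) mpol" assume "p \<in> carrier (mpoly_ring V)"
    then have "- p \<in> carrier (mpoly_ring V)" by (simp add: carrier_mpoly_ring in_keys_iff)
    then show "\<exists>q\<in>carrier (mpoly_ring V). q \<oplus>\<^bsub>mpoly_ring V\<^esub> p = \<zero>\<^bsub>mpoly_ring V\<^esub>" by force
  qed (auto simp: algebra_simps mpoly_add_closed carrier_mpoly_ring[of 0])
  show "Group.comm_monoid (mpoly_ring V :: ('v, 'a) mpol graded_ring)"
    by (rule comm_monoidI)
      (auto simp: algebra_simps mpoly_mult_closed carrier_mpoly_ring[of 1])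
qed (simp add: algebra_simps)

lemma mpoly_ring_a_minus:
  assumes "p \<in> carrier (mpoly_ring V)" "q \<in> carrier (mpoly_ring V)"
  shows "p \<ominus>\<^bsub>mpoly_ring V\<^esub> q = p - q"
proof -
  interpret cring "mpoly_ring V" by (rule cring_mpoly_ring)
  have "\<ominus>\<^bsub>mpoly_ring V\<^esub> q + q = 0" using l_neg[OF assms(2)] by simp
  then show ?thesis using eq_neg_iff_add_eq_0 by (fastforce simp: a_minus_def)
qed

lemma sum_lookup_add:
  "(\<Sum>v\<in>Poly_Mapping.keys (s + t). Poly_Mapping.lookup (s + t) v) =
   (\<Sum>v\<in>Poly_Mapping.keys s. Poly_Mapping.lookup s v) +
   (\<Sum>v\<in>Poly_Mapping.keys t. Poly_Mapping.lookup (t :: 'v \<Rightarrow>\<^sub>0 nat) v)"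
  by (rule setsum_keys_plus_distrib) auto

lemma graded_mpoly_ring: "graded_cring (mpoly_ring V :: ('v, 'a::field) mpol graded_ring)"
proof (intro graded_cring.intro graded_cring_axioms.intro)
  fix p q :: "('v, 'a) mpol" and d e
  assume pq: "p \<in> grade (mpoly_ring V) d" "q \<in> grade (mpoly_ring V) e"
  have "(\<Sum>v\<in>Poly_Mapping.keys t. Poly_Mapping.lookup t v) = d + e"
    if "t \<in> Poly_Mapping.keys (p * q)" for t
    using that pq by (auto elim!: mpoly_mult_keysE simp: sum_lookup_add grade_mpoly_ring)
  then show "p \<otimes>\<^bsub>mpoly_ring V\<^esub> q \<in> grade (mpoly_ring V) (d + e)"
    using pq by (simp add: grade_mpoly_ring mpoly_mult_closed)
next
  fix p q :: "('v, 'a) mpol" and d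
  assume "p \<in> grade (mpoly_ring V) d" "q \<in> grade (mpoly_ring V) d"
  then show "p \<oplus>\<^bsub>mpoly_ring V\<^esub> q \<in> grade (mpoly_ring V) d"
    using Poly_Mapping.keys_add[of p q] by (auto simp: grade_mpoly_ring mpoly_add_closed)
qed (auto simp: cring_mpoly_ring grade_mpoly_ring carrier_mpoly_ring)

lemma mconst_grade: "mconst c \<in> grade (mpoly_ring V) 0"
  by (auto simp: mconst_def grade_mpoly_ring carrier_mpoly_ring)

lemma mvar_grade: "v \<in> V \<Longrightarrow> mvar v \<in> grade (mpoly_ring V) 1"
  by (auto simp: mvar_def grade_mpoly_ring carrier_mpoly_ring)

lemma mconst_carrier [simp]: "mconst c \<in> carrier (mpoly_ring V)"
  by (auto simp: mconst_def carrier_mpoly_ring)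

lemma mvar_carrier: "v \<in> V \<Longrightarrow> mvar v \<in> carrier (mpoly_ring V)"
  by (auto simp: mvar_def carrier_mpoly_ring)

lemma mconst_arith:
  "mconst 0 = 0" "mconst 1 = 1" "mconst (a + b) = mconst a + mconst b"
  "mconst (a * b) = mconst a * mconst b"
  by (simp_all add: mconst_def Poly_Mapping.single_add mult_single)

text \<open>Constants and variables generate the polynomial ring. The carrier premises in the sum
  and product cases are there because homomorphism laws hold only on the carrier.\<close>

lemma mpoly_ring_induct [consumes 1, case_names const var add mult]:
  fixes p :: "('v, 'a::field) mpol"
  assumes "p \<in> carrier (mpoly_ring V)"
    and const: "\<And>c. P (mconst c)" and var: "\<And>v. v \<in> V \<Longrightarrow> P (mvar v)"
    and add: "\<And>p q. \<lbrakk>p \<in> carrier (mpoly_ring V); q \<in> carrier (mpoly_ring V); P p; P q\<rbrakk> \<Longrightarrow> P (p + q)"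
    and mult: "\<And>p q. \<lbrakk>p \<in> carrier (mpoly_ring V); q \<in> carrier (mpoly_ring V); P p; P q\<rbrakk> \<Longrightarrow> P (p * q)"
  shows "P p"
proof -
  have power: "P (mvar v ^ k) \<and> (mvar v ^ k :: ('v, 'a) mpol) \<in> carrier (mpoly_ring V)" if "v \<in> V" for v k
  proof (induction k)
    case 0
    then show ?case using const[of 1] by (simp add: mconst_arith carrier_mpoly_ring)
  next
    case (Suc k)
    have "(mvar v :: ('v, 'a) mpol) \<in> carrier (mpoly_ring V)" by (rule mvar_carrier[OF that])
    then show ?case
      using Suc mult[of "mvar v" "mvar v ^ k"] var[OF that] by (simp add: mpoly_mult_closed)
  qed
  have pow: "Poly_Mapping.single (Poly_Mapping.single v k) (1::'a) = mvar v ^ k" for v :: 'v and k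
  proof (induction k)
    case (Suc k)
    have "Poly_Mapping.single (Poly_Mapping.single v (Suc k)) (1::'a) =
        mvar v * Poly_Mapping.single (Poly_Mapping.single v k) (1::'a)"
      by (simp add: mvar_def mult_single flip: Poly_Mapping.single_add)
    then show ?case using Suc by simp
  qed simp
  have monomial: "P (Poly_Mapping.single t (1::'a)) \<and>
      Poly_Mapping.single t (1::'a) \<in> carrier (mpoly_ring V)"
    if "Poly_Mapping.keys t \<subseteq> V" for t :: "'v \<Rightarrow>\<^sub>0 nat"
    using that
  proof (induction t rule: poly_mapping_add_single_induct)
    case zero
    then show ?case using const[of 1] by (simp add: mconst_def carrier_mpoly_ring)
  next
    case (add_single t v k)
    have "Poly_Mapping.single (t + Poly_Mapping.single v k) (1::'a) =
        Poly_Mapping.single t 1 * mvar v ^ k"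
      by (simp add: mult_single flip: pow)
    then show ?case using add_single power[of v k] mult mpoly_mult_closed by auto
  qed
  have scaled: "P (Poly_Mapping.single t c) \<and> Poly_Mapping.single t c \<in> carrier (mpoly_ring V)"
    if "Poly_Mapping.keys t \<subseteq> V" for t :: "'v \<Rightarrow>\<^sub>0 nat" and c :: 'a
  proof -
    have "Poly_Mapping.single t c = mconst c * Poly_Mapping.single t 1"
      by (simp add: mconst_def mult_single)
    then show ?thesis using monomial[OF that] const mult mpoly_mult_closed mconst_carrier by metis
  qed
  have "p \<in> carrier (mpoly_ring V) \<longrightarrow> P p"
  proof (induction p rule: poly_mapping_add_single_induct)
    case zero
    then show ?case using const[of 0] by (simp add: mconst_arith)
  next
    case (add_single p t c)
    then show ?case using scaled[of t c] add by (auto simp: carrier_mpoly_ring)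
  qed
  then show ?thesis using assms(1) by simp
qed

text \<open>The uniqueness half of the universal property of the polynomial ring; every identity
  between composites of coordinate maps and substitutions is proved through it.\<close>

lemma mpoly_ring_hom_eqI:
  fixes V :: "'v set" and h k :: "('v, 'a::field) mpol \<Rightarrow> 'b"
  assumes "h \<in> Ring.ring_hom (mpoly_ring V) H" "k \<in> Ring.ring_hom (mpoly_ring V) H"
    and "\<And>c. h (mconst c) = k (mconst c)" "\<And>v. v \<in> V \<Longrightarrow> h (mvar v) = k (mvar v)"
    and "p \<in> carrier (mpoly_ring V)"
  shows "h p = k p"
  using assms(5)
proof (induction rule: mpoly_ring_induct)
  case (add p q)
  then show ?case
    using ring_hom_add[OF assms(1), of p q] ring_hom_add[OF assms(2), of p q] by simp
next
  case (mult p q)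
  then show ?case
    using ring_hom_mult[OF assms(1), of p q] ring_hom_mult[OF assms(2), of p q] by simp
qed (use assms in auto)

context graded_cring
begin

lemma finsum_grade: "(\<And>i. i \<in> A \<Longrightarrow> f i \<in> grade G d) \<Longrightarrow> finsum G f A \<in> grade G d"
proof (induction A rule: infinite_finite_induct)
  case (insert x A)
  then have "f \<in> A \<rightarrow> carrier G" "f x \<in> carrier G" using grade_carrier by auto
  then show ?case using insert by (auto simp: finsum_insert intro: add_grade)
qed (simp_all add: zero_grade)

lemma pow_grade: "x \<in> grade G d \<Longrightarrow> x [^] (k::nat) \<in> grade G (k * d)"
  by (induction k) (auto simp: one_grade add.commute dest: mult_grade)

lemma finprod_grade:
  "\<lbrakk>finite A; \<And>i. i \<in> A \<Longrightarrow> f i \<in> grade G (d i)\<rbrakk> \<Longrightarrow> finprod G f A \<in> grade G (\<Sum>i\<in>A. d i)"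
proof (induction A rule: finite_induct)
  case (insert x A)
  then have "f \<in> A \<rightarrow> carrier G" "f x \<in> carrier G" using grade_carrier by auto
  then show ?case using insert by (auto intro: mult_grade)
qed (simp add: one_grade)

end

subsection \<open>Evaluation\<close>

text \<open>The coefficient field is a type and not a ring record, so the structure map of an
  F-algebra is axiomatised directly. That zero goes to zero follows by cancellation.\<close>

locale scalar_hom = cring G for G :: "('b, 'z) ring_scheme" (structure) +
  fixes c :: "'a::field \<Rightarrow> 'b"
  assumes c_closed [simp]: "c r \<in> carrier G"
    and c_one: "c 1 = \<one>"
    and c_add: "c (r + s) = c r \<oplus> c s"
    and c_mult: "c (r * s) = c r \<otimes> c s"
begin

lemma c_zero: "c 0 = \<zero>"
  using c_add[of 0 0] by (metis add.r_cancel_one c_closed add_0)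

definition monomial_value :: "('v \<Rightarrow> 'b) \<Rightarrow> ('v \<Rightarrow>\<^sub>0 nat) \<Rightarrow> 'b" where
  "monomial_value y t = (\<Otimes>v\<in>Poly_Mapping.keys t. y v [^] Poly_Mapping.lookup t v)"

lemma meval_altdef: "meval G c y p =
  (\<Oplus>t\<in>Poly_Mapping.keys p. c (Poly_Mapping.lookup p t) \<otimes> monomial_value y t)"
  by (simp add: meval_def monomial_value_def)

lemma meval_zero [simp]: "meval G c y 0 = \<zero>"
  by (simp add: meval_def)

text \<open>The computations that follow assume that \<open>y\<close> takes values in the carrier on
  the whole type of variables, whereas coordinate maps have junk values outside \<open>V\<close>.
  Replacing these by zero changes nothing, because no monomial of \<open>p\<close> involves such a
  variable.\<close>

lemma meval_restrict:
  assumes "\<And>v. v \<in> V \<Longrightarrow> y v \<in> carrier G" "p \<in> carrier (mpoly_ring V)"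
  shows "meval G c y p = meval G c (\<lambda>v. if v \<in> V then y v else \<zero>) p"
proof -
  have "monomial_value y t = monomial_value (\<lambda>v. if v \<in> V then y v else \<zero>) t"
    if "t \<in> Poly_Mapping.keys p" for t
    using that assms unfolding monomial_value_def
    by (intro finprod_cong') (auto simp: carrier_mpoly_ring)
  moreover have "monomial_value (\<lambda>v. if v \<in> V then y v else \<zero>) t \<in> carrier G" for t
    using assms unfolding monomial_value_def by (intro finprod_closed) auto
  ultimately show ?thesis unfolding meval_altdef by (intro finsum_cong') auto
qed

context
  fixes y :: "'v \<Rightarrow> 'b"
  assumes y: "\<And>v. y v \<in> carrier G"
begin

lemma monomial_value_closed: "monomial_value y t \<in> carrier G"
  unfolding monomial_value_def by (intro finprod_closed) (auto simp: y)

text \<open>Supports vary from one argument to another; extending the product by trivial factors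
  puts two monomials over a common finite index set. \<open>meval_superset\<close> does the same for
  sums.\<close>

lemma monomial_value_superset:
  assumes "finite A" "Poly_Mapping.keys t \<subseteq> A"
  shows "monomial_value y t = (\<Otimes>v\<in>A. y v [^] Poly_Mapping.lookup t v)"
  unfolding monomial_value_def using assms
  by (intro finprod_mono_neutral_cong_left) (auto simp: in_keys_iff y)

lemma monomial_value_add: "monomial_value y (s + t) = monomial_value y s \<otimes> monomial_value y t"
proof -
  let ?A = "Poly_Mapping.keys s \<union> Poly_Mapping.keys t"
  have "monomial_value y (s + t) =
      (\<Otimes>v\<in>?A. y v [^] Poly_Mapping.lookup s v \<otimes> y v [^] Poly_Mapping.lookup t v)"
    using Poly_Mapping.keys_add[of s t]
    by (subst monomial_value_superset[of ?A])
      (auto simp: lookup_add nat_pow_mult y intro!: finprod_cong')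
  also have "\<dots> = (\<Otimes>v\<in>?A. y v [^] Poly_Mapping.lookup s v) \<otimes>
      (\<Otimes>v\<in>?A. y v [^] Poly_Mapping.lookup t v)"
    by (intro finprod_multf) (auto simp: y)
  also have "\<dots> = monomial_value y s \<otimes> monomial_value y t"
    by (simp add: monomial_value_superset[of ?A s] monomial_value_superset[of ?A t])
  finally show ?thesis .
qed

lemma meval_superset:
  assumes "finite A" "Poly_Mapping.keys p \<subseteq> A"
  shows "meval G c y p = (\<Oplus>t\<in>A. c (Poly_Mapping.lookup p t) \<otimes> monomial_value y t)"
  unfolding meval_altdef using assms
  by (intro add.finprod_mono_neutral_cong_left)
    (auto simp: in_keys_iff c_zero monomial_value_closed)

lemma meval_closed: "meval G c y p \<in> carrier G"
  unfolding meval_altdef by (intro finsum_closed) (auto simp: monomial_value_closed)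

lemma meval_add: "meval G c y (p + q) = meval G c y p \<oplus> meval G c y q"
proof -
  let ?A = "Poly_Mapping.keys p \<union> Poly_Mapping.keys q"
  have "meval G c y (p + q) = (\<Oplus>t\<in>?A. c (Poly_Mapping.lookup p t) \<otimes> monomial_value y t \<oplus>
      c (Poly_Mapping.lookup q t) \<otimes> monomial_value y t)"
    using Poly_Mapping.keys_add[of p q]
    by (subst meval_superset[of ?A])
      (auto simp: lookup_add c_add l_distr monomial_value_closed intro!: finsum_cong')
  also have "\<dots> = meval G c y p \<oplus> meval G c y q"
    by (subst finsum_addf)
      (auto simp: monomial_value_closed meval_superset[of ?A p] meval_superset[of ?A q])
  finally show ?thesis .
qed

lemma meval_single: "meval G c y (Poly_Mapping.single t r) = c r \<otimes> monomial_value y t"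
  by (subst meval_superset[of "{t}"]) (auto simp: monomial_value_closed)

lemma meval_mult_single:
  "meval G c y (Poly_Mapping.single t r * q) = meval G c y (Poly_Mapping.single t r) \<otimes> meval G c y q"
proof (induction q rule: poly_mapping_add_single_induct)
  case zero
  then show ?case by (simp add: meval_closed)
next
  case (add_single q s u)
  have "meval G c y (Poly_Mapping.single t r * Poly_Mapping.single s u) =
      meval G c y (Poly_Mapping.single t r) \<otimes> meval G c y (Poly_Mapping.single s u)"
    by (simp add: mult_single meval_single c_mult monomial_value_add monomial_value_closed m_ac)
  then show ?case
    using add_single by (simp add: distrib_left meval_add r_distr meval_closed)
qed

lemma meval_mult: "meval G c y (p * q) = meval G c y p \<otimes> meval G c y q"
proof (induction p rule: poly_mapping_add_single_induct)
  case zero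
  then show ?case by (simp add: meval_closed)
next
  case (add_single p s u)
  then show ?case
    by (simp add: distrib_right meval_add l_distr meval_closed meval_mult_single)
qed

lemma meval_one: "meval G c y 1 = \<one>"
  using meval_single[of 0 1] by (simp add: monomial_value_def c_one)

end

lemma meval_ring_hom:
  assumes "\<And>v. v \<in> V \<Longrightarrow> y v \<in> carrier G"
  shows "meval G c y \<in> Ring.ring_hom (mpoly_ring V) G"
proof (rule ring_hom_memI)
  let ?y = "\<lambda>v. if v \<in> V then y v else \<zero>"
  have y: "?y v \<in> carrier G" for v using assms by simp
  have R: "meval G c y p = meval G c ?y p" if "p \<in> carrier (mpoly_ring V)" for p
    using assms that by (rule meval_restrict)
  interpret V: cring "mpoly_ring V" by (rule cring_mpoly_ring)
  show "meval G c y p \<in> carrier G" if "p \<in> carrier (mpoly_ring V)" for p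
    using R[OF that] meval_closed[OF y] by simp
  show "meval G c y (p \<otimes>\<^bsub>mpoly_ring V\<^esub> q) = meval G c y p \<otimes> meval G c y q"
    if "p \<in> carrier (mpoly_ring V)" "q \<in> carrier (mpoly_ring V)" for p q
    using R that meval_mult[OF y] V.m_closed[OF that] by simp
  show "meval G c y (p \<oplus>\<^bsub>mpoly_ring V\<^esub> q) = meval G c y p \<oplus> meval G c y q"
    if "p \<in> carrier (mpoly_ring V)" "q \<in> carrier (mpoly_ring V)" for p q
    using R that meval_add[OF y] V.a_closed[OF that] by simp
  show "meval G c y \<one>\<^bsub>mpoly_ring V\<^esub> = \<one>"
    using R[OF V.one_closed] meval_one[OF y] by simp
qed

lemma meval_mconst: "meval G c y (mconst r) = c r"
  by (cases "r = 0") (simp_all add: mconst_def meval_def c_zero)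

lemma meval_mvar: "y v \<in> carrier G \<Longrightarrow> meval G c y (mvar v) = y v"
  by (simp add: mvar_def meval_def c_one)

end

lemma (in scalar_hom) scalar_hom_comp:
  assumes "cring H" "h \<in> Ring.ring_hom G H"
  shows "scalar_hom H (\<lambda>r. h (c r))"
  using assms by (intro scalar_hom.intro scalar_hom_axioms.intro)
    (auto simp: ring_hom_closed ring_hom_add ring_hom_mult ring_hom_one c_one c_add c_mult)

lemma scalar_hom_mconst: "scalar_hom (mpoly_ring V) mconst"
  by (intro scalar_hom.intro scalar_hom_axioms.intro)
    (simp_all add: cring_mpoly_ring mconst_arith)

text \<open>Variables go to degree 1 and constants to degree 0, so the value of a monomial has its
  total degree; this is where the standard grading enters.\<close>

lemma meval_graded_hom:
  assumes "graded_cring G" "scalar_hom G c"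
    and c: "\<And>r. c r \<in> grade G 0" and y: "\<And>v. v \<in> V \<Longrightarrow> y v \<in> grade G 1"
  shows "meval G c y \<in> graded_hom (mpoly_ring V) G"
proof -
  interpret G: graded_cring G by fact
  interpret scalar_hom G c by fact
  have "meval G c y \<in> Ring.ring_hom (mpoly_ring V) G"
    using y G.grade_carrier by (intro meval_ring_hom) auto
  moreover have "meval G c y p \<in> grade G d" if p: "p \<in> grade (mpoly_ring V) d" for p d
    unfolding meval_altdef
  proof (rule G.finsum_grade)
    fix t assume t: "t \<in> Poly_Mapping.keys p"
    have "y v [^]\<^bsub>G\<^esub> Poly_Mapping.lookup t v \<in> grade G (Poly_Mapping.lookup t v)"
      if "v \<in> Poly_Mapping.keys t" for v
      using G.pow_grade[OF y[of v], of "Poly_Mapping.lookup t v"] t that p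
      by (auto simp: grade_mpoly_ring carrier_mpoly_ring)
    then have "monomial_value y t \<in> grade G (\<Sum>v\<in>Poly_Mapping.keys t. Poly_Mapping.lookup t v)"
      unfolding monomial_value_def by (intro G.finprod_grade) auto
    moreover have "(\<Sum>v\<in>Poly_Mapping.keys t. Poly_Mapping.lookup t v) = d"
      using t p by (simp add: grade_mpoly_ring)
    ultimately show "c (Poly_Mapping.lookup p t) \<otimes>\<^bsub>G\<^esub> monomial_value y t \<in> grade G d"
      using G.mult_grade[OF c, of "monomial_value y t" d] by simp
  qed
  ultimately show ?thesis by (simp add: graded_hom_def)
qed

section \<open>Quotients and adjunction of a variable\<close>

text \<open>The records \<open>G Quot J\<close> and \<open>gquot G J\<close> have different types,
  as have \<open>UP G\<close> and \<open>gadjoin G k\<close>, so the ring axioms are carried over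
  field by field.\<close>

lemma cring_cong_fields:
  assumes "cring R" "carrier S = carrier R" "monoid.mult S = monoid.mult R" "one S = one R"
    "zero S = zero R" "add S = add R"
  shows "cring S"
proof -
  interpret cring R by fact
  show ?thesis
  proof (rule cringI)
    show "abelian_group S"
      by (rule abelian_groupI) (use l_neg a_inv_closed in \<open>auto simp: assms a_ac\<close>)
    show "Group.comm_monoid S"
      by (rule comm_monoidI) (auto simp: assms m_ac)
  qed (simp add: assms l_distr)
qed

text \<open>Additive inverses come for free, as multiples by -1.\<close>

lemma (in cring) ideal_if_closed:
  assumes "I \<subseteq> carrier R" "\<zero> \<in> I" "\<And>x y. \<lbrakk>x \<in> I; y \<in> I\<rbrakk> \<Longrightarrow> x \<oplus> y \<in> I"
    and mult: "\<And>r x. \<lbrakk>r \<in> carrier R; x \<in> I\<rbrakk> \<Longrightarrow> r \<otimes> x \<in> I"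
  shows "ideal I R"
proof (rule idealI)
  have "\<ominus> x \<in> I" if "x \<in> I" for x
  proof -
    have "\<ominus> x = \<ominus> \<one> \<otimes> x" using that assms(1) by (auto simp: l_minus)
    then show ?thesis using mult[of "\<ominus> \<one>" x] that by simp
  qed
  then show "subgroup I (add_monoid R)"
    using assms by (intro add.subgroupI) (auto simp: a_inv_def)
  show "x \<otimes> r \<in> I" if "x \<in> I" "r \<in> carrier R" for x r
    using mult[of r x] that assms(1) m_comm[of x r] by auto
qed (use assms ring_axioms in auto)

lemma graded_homD:
  assumes "h \<in> graded_hom G H"
  shows "h \<in> Ring.ring_hom G H" "x \<in> grade G d \<Longrightarrow> h x \<in> grade H d"
  using assms by (auto simp: graded_hom_def)

lemma graded_hom_comp:
  "\<lbrakk>h \<in> graded_hom G H; k \<in> graded_hom H K\<rbrakk> \<Longrightarrow> (\<lambda>x. k (h x)) \<in> graded_hom G K"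
  using ring_hom_trans[of h G H k K] by (auto simp: graded_hom_def comp_def)

lemma gquot_fields [simp]:
  "carrier (gquot G J) = carrier (G Quot J)" "monoid.mult (gquot G J) = monoid.mult (G Quot J)"
  "one (gquot G J) = one (G Quot J)" "zero (gquot G J) = zero (G Quot J)"
  "add (gquot G J) = add (G Quot J)"
  "grade (gquot G J) d = (\<lambda>x. J +>\<^bsub>G\<^esub> x) ` grade G d"
  by (simp_all add: gquot_def ring.defs graded_ring.defs)

lemma gquot_carrierE:
  assumes "X \<in> carrier (gquot G J)"
  obtains x where "x \<in> carrier G" "X = J +>\<^bsub>G\<^esub> x"
  using assms by (auto simp: FactRing_simps)

context graded_cring
begin

context
  fixes J assumes J: "ideal J G"
begin

interpretation J: ideal J G by (rule J)

lemma gquot_proj: "(\<lambda>x. J +> x) \<in> graded_hom G (gquot G J)"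
  using J.rcos_ring_hom by (auto simp: graded_hom_def Ring.ring_hom_def)

lemma graded_gquot: "graded_cring (gquot G J)"
proof (intro graded_cring.intro graded_cring_axioms.intro)
  show "cring (gquot G J)"
    by (rule cring_cong_fields[OF J.quotient_is_cring[OF cring_axioms]]) simp_all
  note P = graded_homD(1)[OF gquot_proj]
  fix d e
  show "grade (gquot G J) d \<subseteq> carrier (gquot G J)"
    using ring_hom_closed[OF P] grade_carrier by auto
  show "\<zero>\<^bsub>gquot G J\<^esub> \<in> grade (gquot G J) d"
    using zero_grade[of d] a_rcos_zero[OF J J.zero_closed] by (force simp: FactRing_def)
  show "\<one>\<^bsub>gquot G J\<^esub> \<in> grade (gquot G J) 0"
    using one_grade by (auto simp: FactRing_def)
  fix X Y
  assume X: "X \<in> grade (gquot G J) d"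
  {
    assume Y: "Y \<in> grade (gquot G J) d"
    obtain x y where xy: "x \<in> grade G d" "X = J +> x" "y \<in> grade G d" "Y = J +> y"
      using X Y by auto
    then have "X \<oplus>\<^bsub>gquot G J\<^esub> Y = J +> (x \<oplus> y)"
      using ring_hom_add[OF P, of x y] grade_carrier by simp
    then show "X \<oplus>\<^bsub>gquot G J\<^esub> Y \<in> grade (gquot G J) d"
      using add_grade[OF xy(1,3)] by simp
  }
  {
    assume Y: "Y \<in> grade (gquot G J) e"
    obtain x y where xy: "x \<in> grade G d" "X = J +> x" "y \<in> grade G e" "Y = J +> y"
      using X Y by auto
    then have "X \<otimes>\<^bsub>gquot G J\<^esub> Y = J +> (x \<otimes> y)"
      using ring_hom_mult[OF P, of x y] grade_carrier by simp
    then show "X \<otimes>\<^bsub>gquot G J\<^esub> Y \<in> grade (gquot G J) (d + e)"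
      using mult_grade[OF xy(1,3)] by simp
  }
qed

lemma gquot_lift:
  assumes H: "graded_cring H" and g: "g \<in> graded_hom G H" and gJ: "\<And>x. x \<in> J \<Longrightarrow> g x = \<zero>\<^bsub>H\<^esub>"
  obtains h where "h \<in> graded_hom (gquot G J) H" "\<And>x. x \<in> carrier G \<Longrightarrow> h (J +> x) = g x"
proof -
  interpret g: graded_hom_cring G H g
    by (intro graded_hom_cring.intro graded_hom_cring_axioms.intro graded_cring_axioms H g)
  \<comment> \<open>The lift evaluates \<open>g\<close> at a chosen representative; two
    representatives differ by an element of \<open>J\<close>, which \<open>g\<close> kills.\<close>
  define h where "h X = g (SOME x. x \<in> carrier G \<and> X = J +> x)" for X
  have h: "h (J +> x) = g x" if x: "x \<in> carrier G" for x
  proof -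
    define y where "y = (SOME y. y \<in> carrier G \<and> J +> x = J +> y)"
    have y: "y \<in> carrier G \<and> J +> x = J +> y"
      unfolding y_def by (rule someI[of _ x]) (simp add: x)
    then have "y \<ominus> x \<in> J" using quotient_eq_iff_same_a_r_cos[OF J, of y x] x by simp
    then have "g y \<ominus>\<^bsub>H\<^esub> g x = \<zero>\<^bsub>H\<^esub>" using gJ[of "y \<ominus> x"] g.hom_minus y x by simp
    moreover have "g y = (g y \<ominus>\<^bsub>H\<^esub> g x) \<oplus>\<^bsub>H\<^esub> g x"
      using y x g.hom_closed by algebra
    ultimately have "g y = g x" using x by simp
    then show ?thesis by (simp add: h_def y_def)
  qed
  note P = graded_homD(1)[OF gquot_proj]
  have "h \<in> Ring.ring_hom (gquot G J) H"
  proof (rule ring_hom_memI)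
    fix X assume "X \<in> carrier (gquot G J)"
    then show "h X \<in> carrier H" by (rule gquot_carrierE) (simp add: h)
  next
    fix X Y assume X: "X \<in> carrier (gquot G J)" and Y: "Y \<in> carrier (gquot G J)"
    obtain x where x: "x \<in> carrier G" "X = J +> x" using X by (rule gquot_carrierE)
    obtain y where y: "y \<in> carrier G" "Y = J +> y" using Y by (rule gquot_carrierE)
    show "h (X \<otimes>\<^bsub>gquot G J\<^esub> Y) = h X \<otimes>\<^bsub>H\<^esub> h Y"
      unfolding x(2) y(2) ring_hom_mult[OF P x(1) y(1), symmetric] using x(1) y(1) by (simp add: h)
    show "h (X \<oplus>\<^bsub>gquot G J\<^esub> Y) = h X \<oplus>\<^bsub>H\<^esub> h Y"
      unfolding x(2) y(2) ring_hom_add[OF P x(1) y(1), symmetric] using x(1) y(1) by (simp add: h)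
  next
    show "h \<one>\<^bsub>gquot G J\<^esub> = \<one>\<^bsub>H\<^esub>"
      using h[OF one_closed] by (simp add: FactRing_def)
  qed
  moreover have "h X \<in> grade H d" if "X \<in> grade (gquot G J) d" for X d
    using that by (auto simp: h grade_carrier g.hom_grade)
  ultimately have "h \<in> graded_hom (gquot G J) H" by (simp add: graded_hom_def)
  then show thesis using that h by blast
qed

end

end

section \<open>Adjoining a graded variable\<close>

lemma gadjoin_fields [simp]:
  "carrier (gadjoin G k) = carrier (UP G)" "monoid.mult (gadjoin G k) = monoid.mult (UP G)"
  "one (gadjoin G k) = one (UP G)" "zero (gadjoin G k) = zero (UP G)"
  "add (gadjoin G k) = add (UP G)"
  by (simp_all add: gadjoin_def ring.defs graded_ring.defs)

lemma grade_gadjoin: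
  "p \<in> grade (gadjoin G k) d \<longleftrightarrow> p \<in> carrier (UP G) \<and>
    (\<forall>i. if i * k \<le> d then up_ring.coeff (UP G) p i \<in> grade G (d - i * k)
         else up_ring.coeff (UP G) p i = \<zero>\<^bsub>G\<^esub>)"
  by (simp add: gadjoin_def ring.defs graded_ring.defs)

context graded_cring
begin

lemma finsum_eq_zeroI: "(\<And>i. i \<in> A \<Longrightarrow> f i = \<zero>) \<Longrightarrow> finsum G f A = \<zero>"
  by (rule add.finprod_one_eqI)

interpretation UP_cring G "UP G"
  by unfold_locales simp

lemma cring_gadjoin: "cring (gadjoin G k)"
  by (rule cring_cong_fields[OF UP_cring]) simp_all

lemma monom_grade:
  assumes "a \<in> grade G e"
  shows "up_ring.monom (UP G) a i \<in> grade (gadjoin G k) (e + i * k)"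
  using assms by (simp add: grade_gadjoin grade_carrier zero_grade)

lemma graded_gadjoin: "graded_cring (gadjoin G k)"
proof (intro graded_cring.intro graded_cring_axioms.intro cring_gadjoin)
  fix d e p q
  show "grade (gadjoin G k) d \<subseteq> carrier (gadjoin G k)" by (auto simp: grade_gadjoin)
  show "\<zero>\<^bsub>gadjoin G k\<^esub> \<in> grade (gadjoin G k) d" by (simp add: grade_gadjoin zero_grade)
  show "\<one>\<^bsub>gadjoin G k\<^esub> \<in> grade (gadjoin G k) 0"
    by (simp add: grade_gadjoin zero_grade one_grade)
  assume p: "p \<in> grade (gadjoin G k) d"
  {
    assume "q \<in> grade (gadjoin G k) d"
    then show "p \<oplus>\<^bsub>gadjoin G k\<^esub> q \<in> grade (gadjoin G k) d"
      using p by (auto simp: grade_gadjoin intro: add_grade)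
  }
  {
    assume q: "q \<in> grade (gadjoin G k) e"
    have pq: "p \<in> carrier (UP G)" "q \<in> carrier (UP G)" using p q by (auto simp: grade_gadjoin)
    \<comment> \<open>The degrees in \<open>grade_gadjoin\<close> are truncated differences. If a
      degree would be negative, the corresponding coefficient is zero and so is the whole summand;
      otherwise both differences are genuine and add up to \<open>d + e - i * k\<close>.\<close>
    have term0: "up_ring.coeff (UP G) p j \<otimes> up_ring.coeff (UP G) q l = \<zero>"
      if "d < j * k \<or> e < l * k" for j l
      using that p q pq by (auto simp: grade_gadjoin)
    have mem: "up_ring.coeff (UP G) p j \<otimes> up_ring.coeff (UP G) q (i - j)
        \<in> grade G (d + e - i * k)" if "j \<le> i" for i j
    proof (cases "d < j * k \<or> e < (i - j) * k")
      case True
      then show ?thesis using term0 zero_grade by simp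
    next
      case False
      then have "up_ring.coeff (UP G) p j \<in> grade G (d - j * k)"
        "up_ring.coeff (UP G) q (i - j) \<in> grade G (e - (i - j) * k)"
        using p q by (auto simp: grade_gadjoin not_less)
      moreover have "d - j * k + (e - (i - j) * k) = d + e - i * k"
        using False that by (auto simp: not_less diff_mult_distrib)
      ultimately show ?thesis using mult_grade by metis
    qed
    have "up_ring.coeff (UP G) (p \<otimes>\<^bsub>UP G\<^esub> q) i \<in> grade G (d + e - i * k)" for i
      using pq mem[of _ i] by (auto intro!: finsum_grade)
    moreover have "up_ring.coeff (UP G) (p \<otimes>\<^bsub>UP G\<^esub> q) i = \<zero>" if "d + e < i * k" for i
    proof -
      have "d < j * k \<or> e < (i - j) * k" if "j \<le> i" for j
        using that \<open>d + e < i * k\<close> by (auto simp: diff_mult_distrib)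
      then have "up_ring.coeff (UP G) p j \<otimes> up_ring.coeff (UP G) q (i - j) = \<zero>" if "j \<le> i" for j
        using term0 that by simp
      then show ?thesis using pq by (auto intro!: finsum_eq_zeroI)
    qed
    ultimately show "p \<otimes>\<^bsub>gadjoin G k\<^esub> q \<in> grade (gadjoin G k) (d + e)"
      using pq by (simp add: grade_gadjoin)
  }
qed

lemma const_gadjoin: "(\<lambda>a. up_ring.monom (UP G) a 0) \<in> graded_hom G (gadjoin G k)"
  using const_ring_hom monom_grade[of _ _ 0] by (auto simp: graded_hom_def Ring.ring_hom_def)

lemma monom_eq_mult_pow:
  assumes "a \<in> carrier G"
  shows "up_ring.monom (UP G) a i =
    up_ring.monom (UP G) a 0 \<otimes>\<^bsub>gadjoin G k\<^esub> up_ring.monom (UP G) \<one> 1 [^]\<^bsub>gadjoin G k\<^esub> i"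
proof -
  have "up_ring.monom (UP G) \<one> 1 [^]\<^bsub>gadjoin G k\<^esub> i = up_ring.monom (UP G) \<one> 1 [^]\<^bsub>UP G\<^esub> i"
    by (simp add: nat_pow_def)
  also have "\<dots> = up_ring.monom (UP G) \<one> i" using monom_pow[of \<one> 1 i] by simp
  finally show ?thesis using monom_mult[of a \<one> 0 i] assms by simp
qed

lemma gadjoin_induct [consumes 1, case_names monom add]:
  assumes "p \<in> carrier (gadjoin G k)"
    and "\<And>a i. a \<in> carrier G \<Longrightarrow> P (up_ring.monom (UP G) a i)"
    and "\<And>p q. \<lbrakk>p \<in> carrier (gadjoin G k); q \<in> carrier (gadjoin G k); P p; P q\<rbrakk>
      \<Longrightarrow> P (p \<oplus>\<^bsub>gadjoin G k\<^esub> q)"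
  shows "P p"
proof -
  have p: "p \<in> carrier (UP G)" using assms(1) by simp
  have "P (\<Oplus>\<^bsub>UP G\<^esub> i \<in> A. up_ring.monom (UP G) (up_ring.coeff (UP G) p i) i)" if "finite A" for A
    using that
  proof (induction A rule: finite_induct)
    case empty
    then show ?case using assms(2)[of \<zero> 0] by simp
  next
    case (insert i A)
    then show ?case using p assms(2,3) by simp
  qed
  then show ?thesis using up_repr[OF p] by (metis finite_atMost)
qed

lemma gadjoin_lift:
  assumes H: "graded_cring H" and g: "g \<in> graded_hom G H" and t: "t \<in> grade H k"
  obtains h where "h \<in> graded_hom (gadjoin G k) H"
    "\<And>a i. a \<in> carrier G \<Longrightarrow> h (up_ring.monom (UP G) a i) = g a \<otimes>\<^bsub>H\<^esub> t [^]\<^bsub>H\<^esub> i"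
proof -
  interpret g: graded_hom_cring G H g
    by (intro graded_hom_cring.intro graded_hom_cring_axioms.intro graded_cring_axioms H g)
  interpret ev: UP_pre_univ_prop G H g "UP G"
    by unfold_locales simp
  have t': "t \<in> carrier H" using t by (rule g.H.grade_carrier)
  have "eval G H g t \<in> Ring.ring_hom (gadjoin G k) H"
    using ev.eval_ring_hom[OF t'] by (simp add: Ring.ring_hom_def)
  moreover have "eval G H g t p \<in> grade H d" if p: "p \<in> grade (gadjoin G k) d" for p d
  proof -
    have p': "p \<in> carrier (UP G)" using p by (simp add: grade_gadjoin)
    have "g (up_ring.coeff (UP G) p i) \<otimes>\<^bsub>H\<^esub> t [^]\<^bsub>H\<^esub> i \<in> grade H d" for i
    proof (cases "i * k \<le> d")
      case True
      then have "up_ring.coeff (UP G) p i \<in> grade G (d - i * k)" using p by (simp add: grade_gadjoin)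
      from g.H.mult_grade[OF g.hom_grade[OF this] g.H.pow_grade[OF t, of i]]
      show ?thesis using True by simp
    next
      case False
      then have "up_ring.coeff (UP G) p i = \<zero>" using p by (simp add: grade_gadjoin)
      then show ?thesis using g.H.zero_grade t' by simp
    qed
    then show ?thesis unfolding eval_on_carrier[OF p'] by (rule g.H.finsum_grade)
  qed
  ultimately have "eval G H g t \<in> graded_hom (gadjoin G k) H" by (simp add: graded_hom_def)
  then show thesis using that ev.eval_monom[OF _ t'] by blast
qed

end

section \<open>Presentations of the scroll and unprojection rings\<close>

text \<open>The minors are written with the subtraction of the polynomial type, while homomorphisms
  and cosets speak of subtraction in the ring record. The rule makes the passage once for all,
  together with the carrier facts it needs.\<close>

lemma scroll_minorsE:
  fixes x :: "(nat \<times> nat, 'a::field) mpol"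
  assumes "x \<in> scroll_minors m n"
  obtains i j k l where "(i, j) \<in> scroll_cols m n" "(k, l) \<in> scroll_cols m n"
    "(mvar (i, j) * mvar (k, l + 1) :: (nat \<times> nat, 'a) mpol) \<in> carrier (scroll_poly_ring m n)"
    "(mvar (k, l) * mvar (i, j + 1) :: (nat \<times> nat, 'a) mpol) \<in> carrier (scroll_poly_ring m n)"
    "x = mvar (i, j) * mvar (k, l + 1) \<ominus>\<^bsub>scroll_poly_ring m n\<^esub> mvar (k, l) * mvar (i, j + 1)"
proof -
  obtain i j k l where x: "x = mvar (i, j) * mvar (k, l + 1) - mvar (k, l) * mvar (i, j + 1)"
    and c: "(i, j) \<in> scroll_cols m n" "(k, l) \<in> scroll_cols m n"
    using assms by (auto simp: scroll_minors_def)
  have vars: "(i, j) \<in> scroll_vars m n" "(i, j + 1) \<in> scroll_vars m n"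
    "(k, l) \<in> scroll_vars m n" "(k, l + 1) \<in> scroll_vars m n"
    using c by (auto simp: scroll_cols_def scroll_vars_def)
  show thesis
    by (rule that[OF c]; unfold x scroll_poly_ring_def)
      (simp_all add: mpoly_ring_a_minus vars mvar_carrier mpoly_mult_closed del: One_nat_def add_Suc_right)
qed

lemma ideal_scroll_ideal:
  "ideal (scroll_ideal m n :: (nat \<times> nat, 'a::field) mpol set) (scroll_poly_ring m n)"
proof -
  interpret R: cring "scroll_poly_ring m n :: (nat \<times> nat, 'a) mpol graded_ring"
    unfolding scroll_poly_ring_def by (rule cring_mpoly_ring)
  have "x \<in> carrier (scroll_poly_ring m n)" if "x \<in> scroll_minors m n"
    for x :: "(nat \<times> nat, 'a) mpol"
    using that by (elim scroll_minorsE) (simp add: R.minus_closed)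
  then show ?thesis unfolding scroll_ideal_def by (intro R.genideal_ideal) blast
qed

lemma graded_scroll_poly_ring: "graded_cring (scroll_poly_ring m n)"
  unfolding scroll_poly_ring_def by (rule graded_mpoly_ring)

lemma graded_scroll_ring: "graded_cring (scroll_ring m n)"
  unfolding scroll_ring_def
  by (rule graded_cring.graded_gquot[OF graded_scroll_poly_ring ideal_scroll_ideal])

lemma scroll_cls_hom: "scroll_cls m n \<in> graded_hom (scroll_poly_ring m n) (scroll_ring m n)"
  using graded_cring.gquot_proj[OF graded_scroll_poly_ring ideal_scroll_ideal]
  unfolding scroll_ring_def scroll_cls_def[abs_def] .

lemma scroll_scalar_hom: "scalar_hom (scroll_ring m n) (\<lambda>c. scroll_cls m n (mconst c))"
  using scalar_hom.scalar_hom_comp[OF scalar_hom_mconst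
      graded_cring.axioms(1)[OF graded_scroll_ring] graded_homD(1)[OF scroll_cls_hom, unfolded scroll_poly_ring_def]] .

text \<open>The coordinate map from the polynomial ring in linearly ordered variables onto
  \<open>S\<close>, whose \<open>Proj_map\<close> is the embedding. Scroll and unprojection ring are
  both handled through such maps, so that one matrix can act on the variables of either.\<close>

definition scroll_eval :: "nat \<Rightarrow> nat \<Rightarrow> (nat, 'a::field) mpol \<Rightarrow> (nat \<times> nat, 'a) mpol set" where
  "scroll_eval m n = meval (scroll_ring m n) (\<lambda>c. scroll_cls m n (mconst c))
     (\<lambda>k. scroll_cls m n (mvar (scroll_coord m k)))"

lemma scroll_embedding_eq:
  "scroll_embedding m n = Proj_map (mpoly_ring {..m + n + 1}) (scroll_ring m n) (scroll_eval m n)"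
  by (simp add: scroll_embedding_def scroll_eval_def proj_coord_ring_def)

lemma scroll_coord_vars: "k \<le> m + n + 1 \<Longrightarrow> scroll_coord m k \<in> scroll_vars m n"
  by (auto simp: scroll_coord_def scroll_vars_def)

definition scroll_index :: "nat \<Rightarrow> nat \<times> nat \<Rightarrow> nat" where
  "scroll_index m = (\<lambda>(i, j). if i = 0 then j else m + 1 + j)"

lemma scroll_coord_index: "v \<in> scroll_vars m n \<Longrightarrow> scroll_coord m (scroll_index m v) = v"
  by (auto simp: scroll_coord_def scroll_index_def scroll_vars_def)

lemma scroll_index_coord: "scroll_index m (scroll_coord m k) = k"
  by (auto simp: scroll_coord_def scroll_index_def)

lemma scroll_index_le: "v \<in> scroll_vars m n \<Longrightarrow> scroll_index m v \<le> m + n + 1"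
  by (auto simp: scroll_index_def scroll_vars_def)

text \<open>The positions, in the order of \<open>scroll_coord\<close>, of the coordinates in the upper row.\<close>

definition top_indices :: "nat \<Rightarrow> nat \<Rightarrow> nat set" where
  "top_indices m n = {..m + n} - {m}"

lemma scroll_index_cols:
  "(i, j) \<in> scroll_cols m n \<Longrightarrow> scroll_index m (i, j) \<in> top_indices m n \<and>
    scroll_index m (i, j + 1) = scroll_index m (i, j) + 1 \<and>
    (i, j) \<in> scroll_vars m n \<and> (i, j + 1) \<in> scroll_vars m n"
  by (auto simp: scroll_cols_def scroll_index_def top_indices_def scroll_vars_def)

lemma top_indices_cols:
  assumes "k \<in> top_indices m n"
  shows "scroll_coord m k \<in> scroll_cols m n"
    "scroll_coord m (k + 1) = (fst (scroll_coord m k), snd (scroll_coord m k) + 1)"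
  using assms by (auto simp: scroll_cols_def scroll_coord_def top_indices_def)

lemma scroll_eval_mconst: "scroll_eval m n (mconst c) = scroll_cls m n (mconst c)"
  unfolding scroll_eval_def by (rule scalar_hom.meval_mconst[OF scroll_scalar_hom])

lemma scroll_cls_mvar_grade:
  assumes "v \<in> scroll_vars m n" shows "scroll_cls m n (mvar v) \<in> grade (scroll_ring m n) 1"
  using graded_homD(2)[OF scroll_cls_hom] mvar_grade[OF assms] by (simp add: scroll_poly_ring_def)

lemma scroll_cls_mvar_carrier:
  assumes "v \<in> scroll_vars m n" shows "scroll_cls m n (mvar v) \<in> carrier (scroll_ring m n)"
  using graded_cring.grade_carrier[OF graded_scroll_ring scroll_cls_mvar_grade[OF assms]] .

lemma scroll_eval_mvar:
  assumes "k \<le> m + n + 1"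
  shows "scroll_eval m n (mvar k) = scroll_cls m n (mvar (scroll_coord m k))"
  unfolding scroll_eval_def
  using scroll_cls_mvar_carrier[OF scroll_coord_vars[OF assms]]
  by (rule scalar_hom.meval_mvar[OF scroll_scalar_hom])

lemma scroll_eval_hom:
  "scroll_eval m n \<in> graded_hom (mpoly_ring {..m + n + 1}) (scroll_ring m n)"
  unfolding scroll_eval_def
proof (rule meval_graded_hom[OF graded_scroll_ring scroll_scalar_hom])
  show "scroll_cls m n (mconst r) \<in> grade (scroll_ring m n) 0" for r
    by (rule graded_homD(2)[OF scroll_cls_hom[unfolded scroll_poly_ring_def] mconst_grade])
qed (rule scroll_cls_mvar_grade, rule scroll_coord_vars, simp)

lemma scroll_eval_minor:
  assumes k: "k \<in> top_indices m n" and l: "l \<in> top_indices m n"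
  shows "scroll_eval m n (mvar k * mvar (l + 1)) =
    (scroll_eval m n (mvar l * mvar (k + 1)) :: (nat \<times> nat, 'a::field) mpol set)"
proof -
  let ?R = "scroll_poly_ring m n :: (nat \<times> nat, 'a) mpol graded_ring"
  let ?S = "scroll_ring m n :: (nat \<times> nat, 'a) mpol set graded_ring"
  interpret R: cring ?R
    unfolding scroll_poly_ring_def by (rule cring_mpoly_ring)
  have hom: "scroll_eval m n \<in> Ring.ring_hom (mpoly_ring {..m + n + 1}) ?S"
    by (rule graded_homD(1)[OF scroll_eval_hom])
  have cls: "scroll_cls m n \<in> Ring.ring_hom ?R ?S"
    by (rule graded_homD(1)[OF scroll_cls_hom])
  have le: "k + 1 \<le> m + n + 1" "l + 1 \<le> m + n + 1"
    using k l by (auto simp: top_indices_def)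
  obtain i j i' j' where ij: "scroll_coord m k = (i, j)" "scroll_coord m l = (i', j')"
    by force
  have c: "(i, j) \<in> scroll_cols m n" "(i', j') \<in> scroll_cols m n"
    and s: "scroll_coord m (k + 1) = (i, j + 1)" "scroll_coord m (l + 1) = (i', j' + 1)"
    using top_indices_cols[OF k] top_indices_cols[OF l] ij by auto
  have v: "(mvar (i, j) :: (nat \<times> nat, 'a) mpol) \<in> carrier ?R"
    "(mvar (i', j') :: (nat \<times> nat, 'a) mpol) \<in> carrier ?R"
    "(mvar (i, j + 1) :: (nat \<times> nat, 'a) mpol) \<in> carrier ?R"
    "(mvar (i', j' + 1) :: (nat \<times> nat, 'a) mpol) \<in> carrier ?R"
    using scroll_index_cols[OF c(1)] scroll_index_cols[OF c(2)]
    by (auto simp: scroll_poly_ring_def intro!: mvar_carrier)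
  let ?p = "mvar (i, j) * mvar (i', j' + 1) :: (nat \<times> nat, 'a) mpol"
  let ?q = "mvar (i', j') * mvar (i, j + 1) :: (nat \<times> nat, 'a) mpol"
  have pq: "?p \<in> carrier ?R" "?q \<in> carrier ?R"
    using v mpoly_mult_closed by (auto simp: scroll_poly_ring_def)
  have minus: "?p \<ominus>\<^bsub>?R\<^esub> ?q = ?p - ?q"
    using pq mpoly_ring_a_minus by (simp add: scroll_poly_ring_def)
  have "?p - ?q \<in> scroll_minors m n"
    using c by (auto simp: scroll_minors_def)
  then have "?p \<ominus>\<^bsub>?R\<^esub> ?q \<in> scroll_ideal m n"
    unfolding minus scroll_ideal_def genideal_def by blast
  then have "scroll_cls m n ?p = scroll_cls m n ?q"
    using R.quotient_eq_iff_same_a_r_cos[OF ideal_scroll_ideal pq] by (simp add: scroll_cls_def)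
  moreover have "scroll_cls m n ?p = scroll_eval m n (mvar k * mvar (l + 1))"
    using ring_hom_mult[OF cls v(1,4)] ring_hom_mult[OF hom mvar_carrier mvar_carrier, of k "l + 1"]
      le ij s by (simp add: scroll_poly_ring_def scroll_eval_mvar)
  moreover have "scroll_cls m n ?q = scroll_eval m n (mvar l * mvar (k + 1))"
    using ring_hom_mult[OF cls v(2,3)] ring_hom_mult[OF hom mvar_carrier mvar_carrier, of l "k + 1"]
      le ij s by (simp add: scroll_poly_ring_def scroll_eval_mvar)
  ultimately show ?thesis by simp
qed

lemma scroll_eval_surj:
  fixes X :: "(nat \<times> nat, 'a::field) mpol set"
  assumes "X \<in> carrier (scroll_ring m n)"
  obtains p where "p \<in> carrier (mpoly_ring {..m + n + 1})" "scroll_eval m n p = X"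
proof -
  note hom = graded_homD(1)[OF scroll_eval_hom[of m n]]
    and cls = graded_homD(1)[OF scroll_cls_hom[of m n]]
  obtain r where r: "r \<in> carrier (scroll_poly_ring m n)" "X = scroll_cls m n r"
    using assms unfolding scroll_ring_def scroll_cls_def by (rule gquot_carrierE)
  have "\<exists>p\<in>carrier (mpoly_ring {..m + n + 1}). scroll_eval m n p = scroll_cls m n r"
    using r(1)[unfolded scroll_poly_ring_def]
  proof (induction rule: mpoly_ring_induct)
    case (const c)
    show ?case using scroll_eval_mconst mconst_carrier by blast
  next
    case (var v)
    then show ?case
      using scroll_eval_mvar[OF scroll_index_le[OF var]] scroll_index_le[OF var]
      by (intro bexI[of _ "mvar (scroll_index m v)"])
        (auto simp: scroll_coord_index intro!: mvar_carrier)
  next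
    case (add p q)
    then obtain p' q' where p': "p' \<in> carrier (mpoly_ring {..m + n + 1})" "scroll_eval m n p' = scroll_cls m n p"
      "q' \<in> carrier (mpoly_ring {..m + n + 1})" "scroll_eval m n q' = scroll_cls m n q" by auto
    then show ?case
      using ring_hom_add[OF cls, of p q] add ring_hom_add[OF hom p'(1,3)] mpoly_add_closed[OF p'(1,3)]
      by (intro bexI[of _ "p' + q'"]) (auto simp: scroll_poly_ring_def)
  next
    case (mult p q)
    then obtain p' q' where p': "p' \<in> carrier (mpoly_ring {..m + n + 1})" "scroll_eval m n p' = scroll_cls m n p"
      "q' \<in> carrier (mpoly_ring {..m + n + 1})" "scroll_eval m n q' = scroll_cls m n q" by auto
    then show ?case
      using ring_hom_mult[OF cls, of p q] mult ring_hom_mult[OF hom p'(1,3)] mpoly_mult_closed[OF p'(1,3)]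
      by (intro bexI[of _ "p' * q'"]) (auto simp: scroll_poly_ring_def)
  qed
  then show ?thesis using that r by auto
qed

lemma scalar_hom_graded_hom:
  assumes "graded_cring H" "e \<in> graded_hom (mpoly_ring V) H"
  shows "scalar_hom H (\<lambda>c. e (mconst c))"
  using scalar_hom.scalar_hom_comp[OF scalar_hom_mconst graded_cring.axioms(1)[OF assms(1)]
      graded_homD(1)[OF assms(2)]] .

text \<open>A map out of the polynomial ring factors through \<open>S\<close> as soon as it
  identifies the two products in each minor. Relations are stated as equal values of products, which
  is the form delivered by column operations.\<close>

lemma scroll_lift:
  fixes e :: "(nat, 'a::field) mpol \<Rightarrow> 'b"
  assumes H: "graded_cring H" and e: "e \<in> graded_hom (mpoly_ring {..m + n + 1}) H"
    and rel: "\<And>k l. \<lbrakk>k \<in> top_indices m n; l \<in> top_indices m n\<rbrakk>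
      \<Longrightarrow> e (mvar k * mvar (l + 1)) = e (mvar l * mvar (k + 1))"
  obtains h where "h \<in> graded_hom (scroll_ring m n) H"
    "\<And>p. p \<in> carrier (mpoly_ring {..m + n + 1}) \<Longrightarrow> h (scroll_eval m n p) = e p"
proof -
  let ?R = "scroll_poly_ring m n :: (nat \<times> nat, 'a) mpol graded_ring"
  let ?P = "mpoly_ring {..m + n + 1} :: (nat, 'a) mpol graded_ring"
  interpret H: graded_cring H by fact
  interpret R: cring ?R unfolding scroll_poly_ring_def by (rule cring_mpoly_ring)
  interpret c: scalar_hom H "\<lambda>c. e (mconst c)" by (rule scalar_hom_graded_hom[OF H e])
  \<comment> \<open>This is \<open>e\<close> after renaming \<open>x_{i,j}\<close> to its position;
    it lives on the ring in which the scroll ideal is defined.\<close>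
  define g where "g = meval H (\<lambda>c. e (mconst c)) (\<lambda>v. e (mvar (scroll_index m v)))"
  have e_var: "e (mvar k) \<in> grade H 1" if "k \<le> m + n + 1" for k
    using graded_homD(2)[OF e mvar_grade] that by simp
  have g: "g \<in> graded_hom ?R H"
    unfolding g_def scroll_poly_ring_def
  proof (rule meval_graded_hom[OF H c.scalar_hom_axioms])
    show "e (mconst r) \<in> grade H 0" for r using graded_homD(2)[OF e mconst_grade] .
  qed (use e_var scroll_index_le in blast)
  have g_var: "g (mvar v) = e (mvar (scroll_index m v))" if "v \<in> scroll_vars m n" for v
    unfolding g_def using e_var[OF scroll_index_le[OF that]] H.grade_carrier
    by (intro c.meval_mvar) blast
  interpret g: graded_hom_cring ?R H g
    by (intro graded_hom_cring.intro graded_hom_cring_axioms.intro graded_scroll_poly_ring H g)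
  have gcols: "g (mvar (i, j) * mvar (i', j' + 1)) =
      e (mvar (scroll_index m (i, j)) * mvar (scroll_index m (i', j') + 1))"
    if "(i, j) \<in> scroll_cols m n" "(i', j') \<in> scroll_cols m n" for i j i' j'
  proof -
    have v: "(i, j) \<in> scroll_vars m n" "(i', j' + 1) \<in> scroll_vars m n"
      "scroll_index m (i', j' + 1) = scroll_index m (i', j') + 1"
      using scroll_index_cols that by auto
    have "g (mvar (i, j) * mvar (i', j' + 1)) = g (mvar (i, j)) \<otimes>\<^bsub>H\<^esub> g (mvar (i', j' + 1))"
      using g.hom_mult[of "mvar (i, j)" "mvar (i', j' + 1)"] v
      by (simp add: scroll_poly_ring_def mvar_carrier)
    also have "\<dots> = e (mvar (scroll_index m (i, j))) \<otimes>\<^bsub>H\<^esub> e (mvar (scroll_index m (i', j') + 1))"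
      using g_var v by simp
    also have "\<dots> = e (mvar (scroll_index m (i, j)) * mvar (scroll_index m (i', j') + 1))"
      using ring_hom_mult[OF graded_homD(1)[OF e] mvar_carrier mvar_carrier,
          of "scroll_index m (i, j)" "scroll_index m (i', j') + 1"]
        scroll_index_le[OF v(1)] scroll_index_le[OF v(2)] v(3) by simp
    finally show ?thesis .
  qed
  have "g x = \<zero>\<^bsub>H\<^esub>" if "x \<in> scroll_ideal m n" for x
  proof -
    have "scroll_minors m n \<subseteq> a_kernel ?R H g"
    proof
      fix x assume "x \<in> (scroll_minors m n :: (nat \<times> nat, 'a) mpol set)"
      then obtain i j k l where c: "(i, j) \<in> scroll_cols m n" "(k, l) \<in> scroll_cols m n"
        and pq: "mvar (i, j) * mvar (k, l + 1) \<in> carrier ?R" "mvar (k, l) * mvar (i, j + 1) \<in> carrier ?R"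
        and x': "x = mvar (i, j) * mvar (k, l + 1) \<ominus>\<^bsub>?R\<^esub> mvar (k, l) * mvar (i, j + 1)"
        by (rule scroll_minorsE)
      let ?p = "mvar (i, j) * mvar (k, l + 1) :: (nat \<times> nat, 'a) mpol"
      let ?q = "mvar (k, l) * mvar (i, j + 1) :: (nat \<times> nat, 'a) mpol"
      have "g ?p = g ?q"
        using gcols[OF c] gcols[OF c(2,1)] rel scroll_index_cols c by simp
      then have "g x = \<zero>\<^bsub>H\<^esub>"
        unfolding x' using g.hom_minus[OF pq] g.hom_closed[OF pq(2)] by (simp add: H.r_neg a_minus_def)
      moreover have "x \<in> carrier ?R" unfolding x' by (rule R.minus_closed[OF pq])
      ultimately show "x \<in> a_kernel ?R H g" unfolding a_kernel_def' by blast
    qed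
    then have "scroll_ideal m n \<subseteq> a_kernel ?R H g"
      unfolding scroll_ideal_def by (rule R.genideal_minimal[OF g.ring.kernel_is_ideal])
    then show ?thesis using that unfolding a_kernel_def' by blast
  qed
  from graded_cring.gquot_lift[OF graded_scroll_poly_ring ideal_scroll_ideal H g this]
  obtain h where h: "h \<in> graded_hom (scroll_ring m n) H"
    and hg: "\<And>x. x \<in> carrier ?R \<Longrightarrow> h (scroll_cls m n x) = g x"
    unfolding scroll_ring_def scroll_cls_def by blast
  have "h (scroll_eval m n p) = e p" if "p \<in> carrier ?P" for p
  proof (rule mpoly_ring_hom_eqI[where h = "\<lambda>p. h (scroll_eval m n p)" and V = "{..m + n + 1}"])
    show "(\<lambda>p. h (scroll_eval m n p)) \<in> Ring.ring_hom ?P H"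
      using graded_hom_comp[OF scroll_eval_hom h] by (rule graded_homD)
    show "e \<in> Ring.ring_hom ?P H" using e by (rule graded_homD)
    fix c :: 'a
    show "h (scroll_eval m n (mconst c)) = e (mconst c)"
      using hg[of "mconst c"] c.meval_mconst by (simp add: scroll_eval_mconst scroll_poly_ring_def g_def)
  next
    fix k assume k: "k \<in> {..m + n + 1}"
    then show "h (scroll_eval m n (mvar k)) = e (mvar k)"
      using hg[of "mvar (scroll_coord m k)"] scroll_coord_vars[of k m n] g_var
      by (simp add: scroll_eval_mvar scroll_poly_ring_def mvar_carrier scroll_index_coord)
  qed (rule that)
  then show thesis using that h by blast
qed

lemma carrier_mpoly_ring_mono:
  "\<lbrakk>p \<in> carrier (mpoly_ring V); V \<subseteq> W\<rbrakk> \<Longrightarrow> p \<in> carrier (mpoly_ring W)"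
  by (auto simp: carrier_mpoly_ring)

lemma graded_hom_mpoly_ring_mono:
  assumes "e \<in> graded_hom (mpoly_ring W) H" "V \<subseteq> W"
  shows "e \<in> graded_hom (mpoly_ring V) H"
  using assms carrier_mpoly_ring_mono[OF _ assms(2)]
  by (auto simp: graded_hom_def Ring.ring_hom_def grade_mpoly_ring)

section \<open>The unprojection ring and its coordinate map\<close>

locale scroll_unprojection =
  fixes m n :: nat and a b :: "'a::field"
    and \<phi> :: "(nat \<times> nat, 'a) mpol set \<Rightarrow> (nat \<times> nat, 'a) mpol set"
  assumes shift: "scroll_shift_hom m n \<phi>"
begin

abbreviation S :: "(nat \<times> nat, 'a) mpol set graded_ring" where
  "S \<equiv> scroll_ring m n"

abbreviation T :: "nat \<Rightarrow> (nat \<times> nat, 'a) mpol set" where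
  "T \<equiv> up_ring.monom (UP S) \<one>\<^bsub>S\<^esub> 1"

abbreviation const :: "(nat \<times> nat, 'a) mpol set \<Rightarrow> nat \<Rightarrow> (nat \<times> nat, 'a) mpol set" where
  "const s \<equiv> up_ring.monom (UP S) s 0"

text \<open>A lift of \<open>f\<close> to the ordered coordinates: \<open>m\<close> and
  \<open>m + n + 1\<close> are the positions of the last entries of the two blocks.\<close>

definition form :: "(nat, 'a) mpol" where
  "form = mconst a * mvar m + mconst b * mvar (m + n + 1)"

definition f :: "(nat \<times> nat, 'a) mpol set" where
  "f = scroll_linear_form m n a b"

abbreviation U :: "(nat \<Rightarrow> (nat \<times> nat, 'a) mpol set) set" where
  "U \<equiv> unprojection_ideal S (unproj_ideal m n) \<phi> 1 f"

abbreviation Sun :: "(nat \<Rightarrow> (nat \<times> nat, 'a) mpol set) set graded_ring" where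
  "Sun \<equiv> scroll_unproj_ring m n \<phi> 1 f"

abbreviation cls :: "(nat \<Rightarrow> (nat \<times> nat, 'a) mpol set) \<Rightarrow> (nat \<Rightarrow> (nat \<times> nat, 'a) mpol set) set" where
  "cls \<equiv> unprojection_cls S (unproj_ideal m n) \<phi> 1 f"

sublocale S: graded_cring S by (rule graded_scroll_ring)
sublocale ST: graded_cring "gadjoin S 1" by (rule S.graded_gadjoin)
sublocale R: cring "scroll_poly_ring m n :: (nat \<times> nat, 'a) mpol graded_ring"
  by (rule graded_cring.axioms(1)[OF graded_scroll_poly_ring])
sublocale ev: graded_hom_cring "mpoly_ring {..m + n + 1}" S "scroll_eval m n"
  by (intro graded_hom_cring.intro graded_hom_cring_axioms.intro graded_mpoly_ring
      graded_scroll_ring scroll_eval_hom)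
sublocale cst: graded_hom_cring S "gadjoin S 1" const
  by (intro graded_hom_cring.intro graded_hom_cring_axioms.intro S.graded_cring_axioms
      ST.graded_cring_axioms S.const_gadjoin)

lemma form_grade: "form \<in> grade (mpoly_ring {..m + n + 1}) 1"
proof -
  have "mconst c * mvar k \<in> grade (mpoly_ring {..m + n + 1}) 1" if "k \<le> m + n + 1" for c :: 'a and k
    using ev.G.mult_grade[OF mconst_grade mvar_grade, of k c] that by simp
  from ev.G.add_grade[OF this[of m a] this[of "m + n + 1" b]] show ?thesis
    by (simp add: form_def)
qed

lemma form_carrier: "form \<in> carrier (mpoly_ring {..m + n + 1})"
  using form_grade by (simp add: grade_mpoly_ring)

lemma f_eq: "f = scroll_eval m n form"
proof -
  have cls: "scroll_cls m n \<in> Ring.ring_hom (scroll_poly_ring m n) S"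
    by (rule graded_homD(1)[OF scroll_cls_hom])
  have c: "(mconst c :: (nat \<times> nat, 'a) mpol) \<in> carrier (scroll_poly_ring m n)" for c
    by (simp add: scroll_poly_ring_def)
  have v: "(mvar v :: (nat \<times> nat, 'a) mpol) \<in> carrier (scroll_poly_ring m n)"
    if "v \<in> scroll_vars m n" for v
    using that by (simp add: scroll_poly_ring_def mvar_carrier)
  have vars: "(0, m) \<in> scroll_vars m n" "(1, n) \<in> scroll_vars m n"
    by (auto simp: scroll_vars_def)
  have coord: "scroll_coord m m = (0, m)" "scroll_coord m (m + n + 1) = (1, n)"
    by (auto simp: scroll_coord_def)
  have term1: "scroll_cls m n (mconst c * mvar (scroll_coord m k)) = scroll_eval m n (mconst c * mvar k) \<and>
      mconst c * mvar (scroll_coord m k) \<in> carrier (scroll_poly_ring m n) \<and>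
      mconst c * mvar k \<in> carrier (mpoly_ring {..m + n + 1})"
    if "k \<le> m + n + 1" for c :: 'a and k
  proof -
    note v = v[OF scroll_coord_vars[OF that]]
    have "scroll_cls m n (mconst c * mvar (scroll_coord m k)) =
        scroll_cls m n (mconst c) \<otimes>\<^bsub>S\<^esub> scroll_cls m n (mvar (scroll_coord m k))"
      using ring_hom_mult[OF cls c v, of c] by (simp add: scroll_poly_ring_def)
    also have "\<dots> = scroll_eval m n (mconst c * mvar k)"
      using ev.hom_mult[of "mconst c" "mvar k"] that
      by (simp add: scroll_eval_mconst scroll_eval_mvar mvar_carrier)
    finally show ?thesis
      using R.m_closed[OF c v, of c] that
      by (simp add: scroll_poly_ring_def mpoly_mult_closed mvar_carrier)
  qed
  have m1: "m \<le> m + n + 1" "m + n + 1 \<le> m + n + 1" by simp_all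
  note t = term1[OF m1(1), of a, unfolded coord] term1[OF m1(2), of b, unfolded coord]
  have "f = scroll_cls m n (mconst a * mvar (0, m)) \<oplus>\<^bsub>S\<^esub> scroll_cls m n (mconst b * mvar (1, n))"
    using ring_hom_add[OF cls, of "mconst a * mvar (0, m)" "mconst b * mvar (1, n)"] t
    by (simp add: f_def scroll_linear_form_def scroll_poly_ring_def)
  also have "\<dots> = scroll_eval m n form"
    using ev.hom_add[of "mconst a * mvar m" "mconst b * mvar (m + n + 1)"] t by (simp add: form_def)
  finally show ?thesis .
qed

lemma f_carrier: "f \<in> carrier S"
  unfolding f_eq using form_carrier by (rule ev.hom_closed)

lemma ideal_unproj_ideal: "ideal (unproj_ideal m n) S"
  unfolding unproj_ideal_def
proof (rule S.genideal_ideal)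
  show "(\<lambda>v. scroll_cls m n (mvar v)) ` scroll_cols m n \<subseteq> carrier S"
    using scroll_index_cols scroll_cls_mvar_carrier by fast
qed

lemma phi:
  shows phi_closed: "u \<in> unproj_ideal m n \<Longrightarrow> \<phi> u \<in> carrier S"
    and phi_add: "\<lbrakk>u \<in> unproj_ideal m n; v \<in> unproj_ideal m n\<rbrakk> \<Longrightarrow> \<phi> (u \<oplus>\<^bsub>S\<^esub> v) = \<phi> u \<oplus>\<^bsub>S\<^esub> \<phi> v"
    and phi_mult: "\<lbrakk>s \<in> carrier S; u \<in> unproj_ideal m n\<rbrakk> \<Longrightarrow> \<phi> (s \<otimes>\<^bsub>S\<^esub> u) = s \<otimes>\<^bsub>S\<^esub> \<phi> u"
  using shift by (auto simp: scroll_shift_hom_def graded_ideal_hom_def)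

lemma top_index:
  assumes k: "k \<in> top_indices m n"
  shows "scroll_eval m n (mvar k) \<in> unproj_ideal m n"
    "\<phi> (scroll_eval m n (mvar k)) = scroll_eval m n (mvar (k + 1))"
proof -
  have le: "k \<le> m + n + 1" "k + 1 \<le> m + n + 1" using k by (auto simp: top_indices_def)
  have "scroll_coord m k \<in> scroll_cols m n" using top_indices_cols(1)[OF k] .
  then show "scroll_eval m n (mvar k) \<in> unproj_ideal m n"
    unfolding scroll_eval_mvar[OF le(1)] unproj_ideal_def genideal_def by blast
  have "(\<forall>i<m. \<phi> (scroll_cls m n (mvar (0, i))) = scroll_cls m n (mvar (0, i + 1))) \<and>
     (\<forall>j<n. \<phi> (scroll_cls m n (mvar (1, j))) = scroll_cls m n (mvar (1, j + 1)))"
    using shift by (auto simp: scroll_shift_hom_def)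
  then show "\<phi> (scroll_eval m n (mvar k)) = scroll_eval m n (mvar (k + 1))"
    unfolding scroll_eval_mvar[OF le(1)] scroll_eval_mvar[OF le(2)] top_indices_cols(2)[OF k]
    using \<open>scroll_coord m k \<in> scroll_cols m n\<close> by (auto simp: scroll_cols_def)
qed

lemma unproj_relation_closed:
  assumes "u \<in> unproj_ideal m n"
  shows "up_ring.monom (UP S) u 1 \<in> carrier (gadjoin S 1)" "const (f \<otimes>\<^bsub>S\<^esub> \<phi> u) \<in> carrier (gadjoin S 1)"
    "u \<in> carrier S" "f \<otimes>\<^bsub>S\<^esub> \<phi> u \<in> carrier S"
proof -
  show u: "u \<in> carrier S" using ideal.Icarr[OF ideal_unproj_ideal assms] .
  show fu: "f \<otimes>\<^bsub>S\<^esub> \<phi> u \<in> carrier S" using f_carrier phi_closed[OF assms] by simp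
  interpret UP_cring S "UP S" by unfold_locales simp
  show "up_ring.monom (UP S) u 1 \<in> carrier (gadjoin S 1)" "const (f \<otimes>\<^bsub>S\<^esub> \<phi> u) \<in> carrier (gadjoin S 1)"
    using u fu by simp_all
qed

lemma ideal_U: "ideal U (gadjoin S 1)"
  unfolding unprojection_ideal_def
proof (rule ST.genideal_ideal, safe)
  fix u :: "(nat \<times> nat, 'a) mpol set" assume "u \<in> unproj_ideal m n"
  from unproj_relation_closed(1,2)[OF this]
  show "up_ring.monom (UP S) u 1 \<ominus>\<^bsub>gadjoin S 1\<^esub> const (f \<otimes>\<^bsub>S\<^esub> \<phi> u) \<in> carrier (gadjoin S 1)"
    by (rule ST.minus_closed)
qed

lemma Sun_eq: "Sun = gquot (gadjoin S 1) U"
  by (simp add: scroll_unproj_ring_def unprojection_ring_def)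

sublocale Sun: graded_cring Sun
  unfolding Sun_eq by (rule ST.graded_gquot[OF ideal_U])

lemma cls_hom: "cls \<in> graded_hom (gadjoin S 1) Sun"
  using ST.gquot_proj[OF ideal_U] unfolding Sun_eq unprojection_cls_def[abs_def] .

sublocale cls: graded_hom_cring "gadjoin S 1" Sun cls
  by (intro graded_hom_cring.intro graded_hom_cring_axioms.intro ST.graded_cring_axioms
      Sun.graded_cring_axioms cls_hom)

lemma cls_const_hom: "(\<lambda>s. cls (const s)) \<in> graded_hom S Sun"
  by (rule graded_hom_comp[OF S.const_gadjoin cls_hom])

lemma cls_relation:
  assumes "u \<in> unproj_ideal m n"
  shows "cls (up_ring.monom (UP S) u 1) = cls (const (f \<otimes>\<^bsub>S\<^esub> \<phi> u))"
proof -
  note c = unproj_relation_closed[OF assms]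
  have "up_ring.monom (UP S) u 1 \<ominus>\<^bsub>gadjoin S 1\<^esub> const (f \<otimes>\<^bsub>S\<^esub> \<phi> u) \<in> U"
    unfolding unprojection_ideal_def genideal_def using assms by blast
  then show ?thesis
    unfolding unprojection_cls_def
    using ST.quotient_eq_iff_same_a_r_cos[OF ideal_U c(1,2)] by simp
qed

definition unproj_eval :: "(nat, 'a) mpol \<Rightarrow> (nat \<Rightarrow> (nat \<times> nat, 'a) mpol set) set" where
  "unproj_eval = meval Sun (\<lambda>c. cls (const (scroll_cls m n (mconst c))))
     (\<lambda>k. if k = m + n + 2 then cls T else cls (const (scroll_cls m n (mvar (scroll_coord m k)))))"

lemma unproj_embedding_eq:
  "scroll_unproj_embedding m n \<phi> f = Proj_map (mpoly_ring {..m + n + 2}) Sun unproj_eval"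
  unfolding scroll_unproj_embedding_def unproj_eval_def proj_coord_ring_def Let_def ..

lemma unproj_scalar_hom: "scalar_hom Sun (\<lambda>c. cls (const (scroll_cls m n (mconst c))))"
  by (rule scalar_hom.scalar_hom_comp[OF scroll_scalar_hom Sun.is_cring graded_homD(1)[OF cls_const_hom]])

lemma T_grade: "T \<in> grade (gadjoin S 1) 1"
  using S.monom_grade[OF S.one_grade, of 1 1] by simp

lemma unproj_var_grade:
  assumes "k \<le> m + n + 2"
  shows "(if k = m + n + 2 then cls T else cls (const (scroll_cls m n (mvar (scroll_coord m k)))))
    \<in> grade Sun 1"
proof (cases "k = m + n + 2")
  case True
  then show ?thesis using cls.hom_grade[OF T_grade] by simp
next
  case False
  then have "scroll_coord m k \<in> scroll_vars m n" using assms by (intro scroll_coord_vars) simp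
  from graded_homD(2)[OF cls_const_hom scroll_cls_mvar_grade[OF this]] show ?thesis
    using False by simp
qed

lemma unproj_eval_hom: "unproj_eval \<in> graded_hom (mpoly_ring {..m + n + 2}) Sun"
  unfolding unproj_eval_def
proof (rule meval_graded_hom[OF Sun.graded_cring_axioms unproj_scalar_hom])
  show "cls (const (scroll_cls m n (mconst r))) \<in> grade Sun 0" for r
    by (intro graded_homD(2)[OF cls_const_hom] graded_homD(2)[OF scroll_cls_hom])
      (simp add: mconst_grade scroll_poly_ring_def)
qed (rule unproj_var_grade, simp)

sublocale uev: graded_hom_cring "mpoly_ring {..m + n + 2}" Sun unproj_eval
  by (intro graded_hom_cring.intro graded_hom_cring_axioms.intro graded_mpoly_ring
      Sun.graded_cring_axioms unproj_eval_hom)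

lemma unproj_eval_mvar:
  assumes "k \<le> m + n + 2"
  shows "unproj_eval (mvar k) =
    (if k = m + n + 2 then cls T else cls (const (scroll_cls m n (mvar (scroll_coord m k)))))"
  unfolding unproj_eval_def
  by (rule scalar_hom.meval_mvar[OF unproj_scalar_hom])
    (rule Sun.grade_carrier[OF unproj_var_grade[OF assms]])

lemma unproj_eval_T: "unproj_eval (mvar (m + n + 2)) = cls T"
  by (simp add: unproj_eval_mvar)

text \<open>On polynomials free of the last variable the coordinate map of the unprojection ring
  factors through \<open>S\<close>; relations already known in \<open>S\<close> are imported this
  way.\<close>

lemma unproj_eval_scroll_eval:
  assumes "p \<in> carrier (mpoly_ring {..m + n + 1})"
  shows "unproj_eval p = cls (const (scroll_eval m n p))"
proof (rule mpoly_ring_hom_eqI[OF _ _ _ _ assms])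
  show "unproj_eval \<in> Ring.ring_hom (mpoly_ring {..m + n + 1}) Sun"
    by (rule graded_homD(1)[OF graded_hom_mpoly_ring_mono[OF unproj_eval_hom]]) auto
  show "(\<lambda>p. cls (const (scroll_eval m n p))) \<in> Ring.ring_hom (mpoly_ring {..m + n + 1}) Sun"
    by (rule graded_homD(1)[OF graded_hom_comp[OF scroll_eval_hom cls_const_hom]])
  show "unproj_eval (mconst c) = cls (const (scroll_eval m n (mconst c)))" for c
    unfolding scroll_eval_mconst unproj_eval_def
    by (rule scalar_hom.meval_mconst[OF unproj_scalar_hom])
  show "unproj_eval (mvar k) = cls (const (scroll_eval m n (mvar k)))" if "k \<in> {..m + n + 1}" for k
    using that by (simp add: unproj_eval_mvar scroll_eval_mvar)
qed

lemma unproj_eval_minor: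
  assumes "k \<in> top_indices m n" "l \<in> top_indices m n"
  shows "unproj_eval (mvar k * mvar (l + 1)) = unproj_eval (mvar l * mvar (k + 1))"
proof -
  have "mvar i * mvar (j + 1) \<in> carrier (mpoly_ring {..m + n + 1} :: (nat, 'a) mpol graded_ring)"
    if "i \<in> top_indices m n" "j \<in> top_indices m n" for i j
    using that by (intro mpoly_mult_closed mvar_carrier) (auto simp: top_indices_def)
  then show ?thesis
    using assms scroll_eval_minor[OF assms, where 'a = 'a] by (simp only: unproj_eval_scroll_eval)
qed

text \<open>The defining relation T u = f \<phi>(u), taken at a coordinate u of the upper row, says
  that the minor formed by the column of u and the new column with entries \<open>f\<close> and
  \<open>T\<close> vanishes.\<close>

lemma unproj_eval_relation:
  assumes k: "k \<in> top_indices m n"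
  shows "unproj_eval (mvar k * mvar (m + n + 2)) = unproj_eval (form * mvar (k + 1))"
proof -
  let ?u = "scroll_eval m n (mvar k)"
  have le: "k \<le> m + n + 1" "k + 1 \<le> m + n + 1" using k by (auto simp: top_indices_def)
  have v: "(mvar k :: (nat, 'a) mpol) \<in> carrier (mpoly_ring {..m + n + 1})"
    "(mvar (k + 1) :: (nat, 'a) mpol) \<in> carrier (mpoly_ring {..m + n + 1})"
    "(mvar k :: (nat, 'a) mpol) \<in> carrier (mpoly_ring {..m + n + 2})"
    "(mvar (m + n + 2) :: (nat, 'a) mpol) \<in> carrier (mpoly_ring {..m + n + 2})"
    using le by (auto intro!: mvar_carrier)
  have u: "?u \<in> carrier S" using ev.hom_closed v(1) .
  have "up_ring.monom (UP S) ?u 1 = const ?u \<otimes>\<^bsub>gadjoin S 1\<^esub> T"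
    using S.monom_eq_mult_pow[OF u, of 1 1] ST.grade_carrier[OF T_grade] by (simp only: ST.nat_pow_eone)
  then have "unproj_eval (mvar k * mvar (m + n + 2)) = cls (up_ring.monom (UP S) ?u 1)"
    using uev.hom_mult[OF v(3,4)] unproj_eval_scroll_eval[OF v(1)]
      cls.hom_mult[OF cst.hom_closed[OF u] ST.grade_carrier[OF T_grade]]
    by (simp only: unproj_eval_T mpoly_ring_simps)
  also have "\<dots> = cls (const (f \<otimes>\<^bsub>S\<^esub> \<phi> ?u))" by (rule cls_relation[OF top_index(1)[OF k]])
  also have "f \<otimes>\<^bsub>S\<^esub> \<phi> ?u = scroll_eval m n (form * mvar (k + 1))"
    using ev.hom_mult[OF form_carrier v(2)] by (simp only: top_index(2)[OF k] f_eq mpoly_ring_simps)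
  also have "cls (const \<dots>) = unproj_eval (form * mvar (k + 1))"
    by (rule unproj_eval_scroll_eval[OF mpoly_mult_closed[OF form_carrier v(2)], symmetric])
  finally show ?thesis .
qed

text \<open>A term s T^i is hit by q y^i, where q is a preimage of s in the old variables and y is
  the last variable.\<close>

lemma unproj_eval_surj:
  assumes "X \<in> carrier Sun"
  obtains p where "p \<in> carrier (mpoly_ring {..m + n + 2})" "unproj_eval p = X"
proof -
  let ?P = "mpoly_ring {..m + n + 2} :: (nat, 'a) mpol graded_ring"
  obtain r where r: "r \<in> carrier (gadjoin S 1)" "X = cls r"
    using assms unfolding Sun_eq unprojection_cls_def by (rule gquot_carrierE)
  have T: "(mvar (m + n + 2) :: (nat, 'a) mpol) \<in> carrier ?P" by (simp add: mvar_carrier)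
  have "\<exists>p\<in>carrier ?P. unproj_eval p = cls r"
    using r(1)
  proof (induction rule: S.gadjoin_induct)
    case (monom s i)
    obtain q where q: "q \<in> carrier (mpoly_ring {..m + n + 1})" "scroll_eval m n q = s"
      using scroll_eval_surj[OF monom] .
    have q': "q \<in> carrier ?P" using carrier_mpoly_ring_mono[OF q(1)] by simp
    have "unproj_eval (q \<otimes>\<^bsub>?P\<^esub> mvar (m + n + 2) [^]\<^bsub>?P\<^esub> i) = cls (up_ring.monom (UP S) s i)"
      unfolding S.monom_eq_mult_pow[OF monom, of i 1]
      using q q' T cst.hom_closed[OF monom] ST.grade_carrier[OF T_grade]
      by (simp only: uev.hom_mult uev.hom_pow cls.hom_mult cls.hom_pow unproj_eval_T
          unproj_eval_scroll_eval uev.G.nat_pow_closed ST.nat_pow_closed)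
    moreover have "q \<otimes>\<^bsub>?P\<^esub> mvar (m + n + 2) [^]\<^bsub>?P\<^esub> i \<in> carrier ?P"
      by (intro uev.G.m_closed uev.G.nat_pow_closed q' T)
    ultimately show ?case by blast
  next
    case (add p q)
    then obtain p' q' where p': "p' \<in> carrier ?P" "unproj_eval p' = cls p"
      and q': "q' \<in> carrier ?P" "unproj_eval q' = cls q" by blast
    then have "unproj_eval (p' \<oplus>\<^bsub>?P\<^esub> q') = cls (p \<oplus>\<^bsub>gadjoin S 1\<^esub> q)"
      using add(1,2) by (simp only: uev.hom_add cls.hom_add)
    then show ?case using uev.G.a_closed[OF p'(1) q'(1)] by blast
  qed
  then show thesis using that r by blast
qed

text \<open>The map is built in three stages: on \<open>S\<close> by \<open>scroll_lift\<close>, on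
  \<open>S[T]\<close> by sending \<open>T\<close> to the value of the last variable, and on the
  quotient after checking that \<open>U\<close> is killed. Only the relations at the coordinates of
  the upper row are assumed, whereas \<open>U\<close> has a generator for every element of the ideal
  \<open>I\<close>.\<close>

lemma unproj_lift:
  fixes e :: "(nat, 'a) mpol \<Rightarrow> 'b"
  assumes H: "graded_cring H" and e: "e \<in> graded_hom (mpoly_ring {..m + n + 2}) H"
    and minor: "\<And>k l. \<lbrakk>k \<in> top_indices m n; l \<in> top_indices m n\<rbrakk>
      \<Longrightarrow> e (mvar k * mvar (l + 1)) = e (mvar l * mvar (k + 1))"
    and rel: "\<And>k. k \<in> top_indices m n \<Longrightarrow> e (mvar k * mvar (m + n + 2)) = e (form * mvar (k + 1))"
  obtains h where "h \<in> graded_hom Sun H"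
    "\<And>p. p \<in> carrier (mpoly_ring {..m + n + 2}) \<Longrightarrow> h (unproj_eval p) = e p"
proof -
  let ?P = "mpoly_ring {..m + n + 1} :: (nat, 'a) mpol graded_ring"
  let ?P' = "mpoly_ring {..m + n + 2} :: (nat, 'a) mpol graded_ring"
  interpret H: graded_cring H by fact
  have e': "e \<in> graded_hom ?P H" by (rule graded_hom_mpoly_ring_mono[OF e]) auto
  interpret e: graded_hom_cring ?P' H e
    by (intro graded_hom_cring.intro graded_hom_cring_axioms.intro graded_mpoly_ring H e)
  obtain g where g: "g \<in> graded_hom S H" and ge: "\<And>p. p \<in> carrier ?P \<Longrightarrow> g (scroll_eval m n p) = e p"
    using scroll_lift[OF H e' minor] by blast
  interpret g: graded_hom_cring S H g
    by (intro graded_hom_cring.intro graded_hom_cring_axioms.intro S.graded_cring_axioms H g)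
  let ?t = "e (mvar (m + n + 2))"
  have t: "?t \<in> grade H 1" by (rule graded_homD(2)[OF e mvar_grade]) simp
  note t' = H.grade_carrier[OF t]
  obtain h where h: "h \<in> graded_hom (gadjoin S 1) H"
    and hm: "\<And>s i. s \<in> carrier S \<Longrightarrow> h (up_ring.monom (UP S) s i) = g s \<otimes>\<^bsub>H\<^esub> ?t [^]\<^bsub>H\<^esub> i"
    using S.gadjoin_lift[OF H g t] by blast
  interpret h: graded_hom_cring "gadjoin S 1" H h
    by (intro graded_hom_cring.intro graded_hom_cring_axioms.intro ST.graded_cring_axioms H h)
  \<comment> \<open>The elements u at which T u = f \<phi>(u) holds in the target. Since \<phi> is
    additive and \<open>S\<close>-linear they form an ideal; it contains the generators of
    \<open>unproj_ideal m n\<close> and is therefore all of it.\<close>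
  define K where "K = {u \<in> unproj_ideal m n. g u \<otimes>\<^bsub>H\<^esub> ?t = g f \<otimes>\<^bsub>H\<^esub> g (\<phi> u)}"
  interpret I: ideal "unproj_ideal m n" S by (rule ideal_unproj_ideal)
  have "ideal K S"
  proof (rule S.ideal_if_closed)
    show "K \<subseteq> carrier S" using I.Icarr by (auto simp: K_def)
    have "\<phi> \<zero>\<^bsub>S\<^esub> = \<zero>\<^bsub>S\<^esub>"
      using phi_mult[OF S.zero_closed I.zero_closed] phi_closed[OF I.zero_closed] by simp
    then show "\<zero>\<^bsub>S\<^esub> \<in> K" using I.zero_closed f_carrier t' by (simp add: K_def)
    show "u \<oplus>\<^bsub>S\<^esub> v \<in> K" if "u \<in> K" "v \<in> K" for u v
      using that I.a_closed I.Icarr f_carrier t' phi_closed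
      by (simp add: K_def phi_add H.l_distr H.r_distr)
    show "s \<otimes>\<^bsub>S\<^esub> u \<in> K" if "s \<in> carrier S" "u \<in> K" for s u
    proof -
      have u: "u \<in> unproj_ideal m n" "u \<in> carrier S" "g u \<otimes>\<^bsub>H\<^esub> ?t = g f \<otimes>\<^bsub>H\<^esub> g (\<phi> u)"
        using that I.Icarr by (auto simp: K_def)
      have "g (s \<otimes>\<^bsub>S\<^esub> u) \<otimes>\<^bsub>H\<^esub> ?t = g s \<otimes>\<^bsub>H\<^esub> (g u \<otimes>\<^bsub>H\<^esub> ?t)"
        using that(1) u t' by (simp add: H.m_assoc)
      also have "\<dots> = g f \<otimes>\<^bsub>H\<^esub> g (\<phi> (s \<otimes>\<^bsub>S\<^esub> u))"
        using that(1) u(1) u(3) f_carrier phi_closed[OF u(1)] by (simp add: phi_mult H.m_lcomm)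
      finally show ?thesis using I.I_l_closed[OF u(1) that(1)] by (simp add: K_def)
    qed
  qed
  moreover have "(\<lambda>v. scroll_cls m n (mvar v)) ` scroll_cols m n \<subseteq> K"
  proof safe
    fix i j assume ij: "(i, j) \<in> scroll_cols m n"
    let ?k = "scroll_index m (i, j)"
    have k: "?k \<in> top_indices m n" and "(i, j) \<in> scroll_vars m n" using scroll_index_cols[OF ij] by auto
    then have le: "?k \<le> m + n + 1" "?k + 1 \<le> m + n + 1" by (auto simp: top_indices_def)
    have u: "scroll_cls m n (mvar (i, j)) = scroll_eval m n (mvar ?k)"
      unfolding scroll_eval_mvar[OF le(1)] scroll_coord_index[OF \<open>(i, j) \<in> scroll_vars m n\<close>] ..
    have v: "(mvar ?k :: (nat, 'a) mpol) \<in> carrier ?P" "(mvar (?k + 1) :: (nat, 'a) mpol) \<in> carrier ?P"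
      using le by (auto intro!: mvar_carrier)
    have v': "(mvar ?k :: (nat, 'a) mpol) \<in> carrier ?P'" "(mvar (?k + 1) :: (nat, 'a) mpol) \<in> carrier ?P'"
      "(mvar (m + n + 2) :: (nat, 'a) mpol) \<in> carrier ?P'" "form \<in> carrier ?P'"
      using le carrier_mpoly_ring_mono[OF form_carrier] by (auto intro!: mvar_carrier)
    have "g (scroll_eval m n (mvar ?k)) \<otimes>\<^bsub>H\<^esub> ?t = e (mvar ?k * mvar (m + n + 2))"
      using e.hom_mult[OF v'(1,3)] ge[OF v(1)] by simp
    also have "\<dots> = e (form * mvar (?k + 1))" by (rule rel[OF k])
    also have "\<dots> = g f \<otimes>\<^bsub>H\<^esub> g (\<phi> (scroll_eval m n (mvar ?k)))"
      using e.hom_mult[OF v'(4,2)] ge[OF v(2)] ge[OF form_carrier]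
      by (simp only: top_index(2)[OF k] f_eq mpoly_ring_simps)
    finally show "scroll_cls m n (mvar (i, j)) \<in> K"
      using top_index(1)[OF k] by (simp add: K_def u)
  qed
  ultimately have IK: "unproj_ideal m n \<subseteq> K"
    unfolding unproj_ideal_def by (rule S.genideal_minimal)
  have "U \<subseteq> a_kernel (gadjoin S 1) H h"
    unfolding unprojection_ideal_def
  proof (rule ST.genideal_minimal[OF h.ring.kernel_is_ideal], safe)
    fix u :: "(nat \<times> nat, 'a) mpol set" assume u: "u \<in> unproj_ideal m n"
    note c = unproj_relation_closed[OF u]
    have "h (up_ring.monom (UP S) u 1) = g u \<otimes>\<^bsub>H\<^esub> ?t"
      using hm[OF c(3), of 1] t' by (simp only: H.nat_pow_eone)
    also have "\<dots> = g f \<otimes>\<^bsub>H\<^esub> g (\<phi> u)" using IK u by (auto simp: K_def)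
    also have "\<dots> = h (const (f \<otimes>\<^bsub>S\<^esub> \<phi> u))"
      using hm[OF c(4), of 0] f_carrier phi_closed[OF u] by simp
    finally have "h (up_ring.monom (UP S) u 1 \<ominus>\<^bsub>gadjoin S 1\<^esub> const (f \<otimes>\<^bsub>S\<^esub> \<phi> u)) = \<zero>\<^bsub>H\<^esub>"
      using h.hom_minus[OF c(1,2)] h.hom_closed[OF c(2)] by (simp only: H.r_neg a_minus_def)
    then show "up_ring.monom (UP S) u 1 \<ominus>\<^bsub>gadjoin S 1\<^esub> const (f \<otimes>\<^bsub>S\<^esub> \<phi> u)
        \<in> a_kernel (gadjoin S 1) H h"
      unfolding a_kernel_def' using ST.minus_closed[OF c(1,2)] by blast
  qed
  then have "\<And>x. x \<in> U \<Longrightarrow> h x = \<zero>\<^bsub>H\<^esub>" unfolding a_kernel_def' by blast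
  from ST.gquot_lift[OF ideal_U H h this]
  obtain k where k: "k \<in> graded_hom Sun H"
    and kh: "\<And>x. x \<in> carrier (gadjoin S 1) \<Longrightarrow> k (cls x) = h x"
    unfolding Sun_eq unprojection_cls_def by blast
  have ke: "k (unproj_eval p) = e p" if "p \<in> carrier ?P" for p
    using kh[OF cst.hom_closed[OF ev.hom_closed[OF that]]] hm[OF ev.hom_closed[OF that], of 0]
      g.hom_closed[OF ev.hom_closed[OF that]] ge[OF that] unproj_eval_scroll_eval[OF that] by simp
  have "k (unproj_eval p) = e p" if "p \<in> carrier ?P'" for p
  proof (rule mpoly_ring_hom_eqI[where h = "\<lambda>p. k (unproj_eval p)" and V = "{..m + n + 2}"])
    show "(\<lambda>p. k (unproj_eval p)) \<in> Ring.ring_hom ?P' H"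
      by (rule graded_homD(1)[OF graded_hom_comp[OF unproj_eval_hom k]])
    show "e \<in> Ring.ring_hom ?P' H" by (rule graded_homD(1)[OF e])
    show "k (unproj_eval (mconst c)) = e (mconst c)" for c by (rule ke) simp
    fix i assume "i \<in> {..m + n + 2}"
    then consider "i \<le> m + n + 1" | "i = m + n + 2" by fastforce
    then show "k (unproj_eval (mvar i)) = e (mvar i)"
    proof cases
      case 1
      then show ?thesis by (intro ke mvar_carrier) simp
    next
      case 2
      have "k (cls T) = ?t"
        using kh[OF ST.grade_carrier[OF T_grade]] hm[OF S.one_closed, of 1] t'
        by (simp only: H.nat_pow_eone g.hom_one H.l_one)
      then show ?thesis using 2 unproj_eval_T by simp
    qed
  qed (rule that)
  then show thesis using that k by blast
qed

end

section \<open>Equality and composition of induced morphisms\<close>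

lemma rs_map_eq_sym: "rs_map_eq X Y f g \<Longrightarrow> rs_map_eq X Y g f"
  by (simp add: rs_map_eq_def)

lemma rs_map_eq_trans: "\<lbrakk>rs_map_eq X Y f g; rs_map_eq X Y g h\<rbrakk> \<Longrightarrow> rs_map_eq X Y f h"
  by (simp add: rs_map_eq_def)

text \<open>Pullbacks and fractions involve elements of the carrier of \<open>G\<close> only, so
  agreement there determines both the map on points and the comorphism.\<close>

lemma rs_map_eq_Proj_map:
  assumes h: "graded_hom_cring G H h" and k: "graded_hom_cring G H k"
    and hk: "\<And>x. x \<in> carrier G \<Longrightarrow> h x = k x"
  shows "rs_map_eq (Proj H) (Proj G) (Proj_map G H h) (Proj_map G H k)"
proof -
  interpret h: graded_hom_cring G H h by fact
  interpret k: graded_hom_cring G H k by fact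
  have pb: "pullback G h q = pullback G k q" for q using hk by (auto simp: pullback_def)
  have "comorph (Proj_map G H h) V s q = comorph (Proj_map G H k) V s q"
    if s: "s \<in> carrier (proj_sections G V)" for V s q
  proof (cases "q \<in> proj_points H \<and> pullback G h q \<in> V")
    case True
    then obtain a f where af: "(a, f) \<in> hpairs G (pullback G h q)"
      "s (pullback G h q) = hfrac G (pullback G h q) a f"
      using h.G.proj_sectionsE[OF s] by blast
    have "comorph (Proj_map G H h) V s q = hfrac H q (h a) (h f)"
      using True by (intro h.comorph_Proj_map af) auto
    also have "\<dots> = hfrac H q (k a) (k f)" using hk h.G.hpairs_carrier[OF af(1)] by simp
    also have "\<dots> = comorph (Proj_map G H k) V s q"
      using k.comorph_Proj_map[of q V a f s] True af pb[of q] by simp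
    finally show ?thesis .
  next
    case False
    then show ?thesis
      using h.comorph_Proj_map_outside k.comorph_Proj_map_outside pb by simp
  qed
  then show ?thesis by (auto simp: rs_map_eq_def base_Proj_map pb Proj_def)
qed

text \<open>A composite formed in two steps could be defined at fewer points than the map induced by
  v \<circ> u, namely when the intermediate prime is no point of \<open>Proj H\<close>. The
  assumption \<open>points\<close> rules this out; it concerns only those q whose final image is a
  point, since open sets of \<open>Proj G\<close> contain nothing else.\<close>

lemma rs_comp_Proj_map:
  assumes u: "graded_hom_cring G H u" and v: "graded_hom_cring H K v"
    and points: "\<And>q. \<lbrakk>q \<in> proj_points K; pullback G (v \<circ> u) q \<in> proj_points G\<rbrakk>
      \<Longrightarrow> pullback H v q \<in> proj_points H"
  shows "rs_map_eq (Proj K) (Proj G)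
    (rs_comp (Proj H) (Proj_map G H u) (Proj_map H K v)) (Proj_map G K (v \<circ> u))"
proof -
  interpret u: graded_hom_cring G H u by fact
  interpret v: graded_hom_cring H K v by fact
  interpret vu: graded_hom_cring G K "v \<circ> u"
    using graded_hom_comp[OF u.graded_hom v.graded_hom]
    by (intro graded_hom_cring.intro graded_hom_cring_axioms.intro
        u.G.graded_cring_axioms v.H.graded_cring_axioms) (simp add: comp_def)
  have pb: "pullback G u (pullback H v q) = pullback G (v \<circ> u) q" for q
    by (auto simp: pullback_def)
  have "comorph (Proj_map H K v) {r \<in> proj_points H. pullback G u r \<in> W}
      (comorph (Proj_map G H u) W s) q = comorph (Proj_map G K (v \<circ> u)) W s q"
    if W: "openin (proj_top G) W" and s: "s \<in> carrier (proj_sections G W)" for W s q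
  proof -
    let ?r = "pullback H v q" and ?p = "pullback G (v \<circ> u) q"
    have iff: "(q \<in> proj_points K \<and> ?r \<in> {r \<in> proj_points H. pullback G u r \<in> W}) =
        (q \<in> proj_points K \<and> ?p \<in> W)"
      using points[of q] u.G.open_subset_proj_points[OF W] pb by auto
    show ?thesis
    proof (cases "q \<in> proj_points K \<and> ?p \<in> W")
      case True
      then have q: "q \<in> proj_points K" and p: "?p \<in> W"
        and r: "?r \<in> {r \<in> proj_points H. pullback G u r \<in> W}" using iff by auto
      obtain a f where af: "(a, f) \<in> hpairs G ?p" "s ?p = hfrac G ?p a f"
        using u.G.proj_sectionsE[OF s p] .
      have uaf: "(u a, u f) \<in> hpairs H ?r" using u.hpairs_hom af(1) pb by metis
      have "comorph (Proj_map G H u) W s ?r = hfrac H ?r (u a) (u f)"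
        using u.comorph_Proj_map[of ?r W a f s] r af pb by simp
      then have "comorph (Proj_map H K v) {r \<in> proj_points H. pullback G u r \<in> W}
          (comorph (Proj_map G H u) W s) q = hfrac K q (v (u a)) (v (u f))"
        by (rule v.comorph_Proj_map[OF q r uaf])
      then show ?thesis using vu.comorph_Proj_map[of q W a f s] q p af by simp
    next
      case False
      then have "comorph (Proj_map H K v) {r \<in> proj_points H. pullback G u r \<in> W}
          (comorph (Proj_map G H u) W s) q = undefined"
        using iff by (intro v.comorph_Proj_map_outside) (simp only: simp_thms)
      then show ?thesis using False vu.comorph_Proj_map_outside by simp
    qed
  qed
  then show ?thesis
    by (auto simp: rs_map_eq_def rs_comp_def base_Proj_map pb u.rs_vimage_Proj_map)
      (auto simp: Proj_def)
qed

section \<open>Columns and linear substitutions\<close>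

text \<open>Columns are pairs of an upper and a lower entry. A combination uses the same
  coefficients in both entries, which is what distinguishes a column operation from an arbitrary
  substitution.\<close>

inductive_set col_span :: "'v set \<Rightarrow> (('v, 'a::field) mpol \<times> ('v, 'a) mpol) set
    \<Rightarrow> (('v, 'a) mpol \<times> ('v, 'a) mpol) set"
  for V C where
  base: "x \<in> C \<Longrightarrow> x \<in> col_span V C"
| comb: "\<lbrakk>x \<in> col_span V C; y \<in> col_span V C; p \<in> carrier (mpoly_ring V); q \<in> carrier (mpoly_ring V)\<rbrakk>
    \<Longrightarrow> (p * fst x + q * fst y, p * snd x + q * snd y) \<in> col_span V C"

lemma col_span_carrier:
  assumes "x \<in> col_span V C" "C \<subseteq> carrier (mpoly_ring V) \<times> carrier (mpoly_ring V)"
  shows "fst x \<in> carrier (mpoly_ring V) \<and> snd x \<in> carrier (mpoly_ring V)"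
  using assms by induction (auto intro!: mpoly_add_closed mpoly_mult_closed)

lemma col_span_scale:
  assumes "(x, x') \<in> col_span V C" "p \<in> carrier (mpoly_ring V)"
  shows "(p * x, p * x') \<in> col_span V C"
proof -
  have "0 \<in> carrier (mpoly_ring V)" by (simp add: carrier_mpoly_ring)
  from comb[OF assms(1) assms(1) assms(2) this] show ?thesis by simp
qed

text \<open>A 2 by 2 minor is bilinear in its columns, so if \<open>e\<close> kills all minors of
  the generating columns, it kills those of their combinations.\<close>

lemma col_span_minors:
  assumes e: "e \<in> Ring.ring_hom (mpoly_ring V) H" and H: "cring H"
    and C: "C \<subseteq> carrier (mpoly_ring V) \<times> carrier (mpoly_ring V)"
    and minors: "\<And>x y. \<lbrakk>x \<in> C; y \<in> C\<rbrakk> \<Longrightarrow> e (fst x * snd y) = e (fst y * snd x)"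
    and x: "x \<in> col_span V C" and y: "y \<in> col_span V C"
  shows "e (fst x * snd y) = e (fst y * snd x)"
proof -
  let ?P = "mpoly_ring V"
  interpret e: ring_hom_cring ?P H e
    by (intro ring_hom_cring.intro ring_hom_cring_axioms.intro cring_mpoly_ring H e)
  have add: "e (p + q) = e p \<oplus>\<^bsub>H\<^esub> e q" and mult: "e (p * q) = e p \<otimes>\<^bsub>H\<^esub> e q"
    if "p \<in> carrier ?P" "q \<in> carrier ?P" for p q
    using e.hom_add[OF that] e.hom_mult[OF that] by simp_all
  note simps = add mult mpoly_add_closed mpoly_mult_closed
  \<comment> \<open>Linearity in one column while the other is fixed. It is applied twice: with the
    fixed column in \<open>C\<close>, and then with the fixed column in the span.\<close>
  have step: "e (fst x * snd y) = e (fst y * snd x)"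
    if y: "fst y \<in> carrier ?P" "snd y \<in> carrier ?P"
      and Cy: "\<And>x. x \<in> C \<Longrightarrow> e (fst x * snd y) = e (fst y * snd x)"
      and x: "x \<in> col_span V C" for x y
    using x
  proof induction
    case (comb x z p q)
    have c: "fst x \<in> carrier ?P" "snd x \<in> carrier ?P" "fst z \<in> carrier ?P" "snd z \<in> carrier ?P"
      using col_span_carrier[OF _ C] comb by auto
    have "e ((p * fst x + q * fst z) * snd y) = e (p * (fst x * snd y) + q * (fst z * snd y))"
      by (simp add: algebra_simps)
    also have "\<dots> = e p \<otimes>\<^bsub>H\<^esub> e (fst y * snd x) \<oplus>\<^bsub>H\<^esub> e q \<otimes>\<^bsub>H\<^esub> e (fst y * snd z)"
      using comb c y by (simp add: add mpoly_mult_closed mult[of p] mult[of q] comb.IH)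
    also have "\<dots> = e (p * (fst y * snd x) + q * (fst y * snd z))"
      using comb c y by (simp add: add mpoly_mult_closed mult[of p] mult[of q])
    also have "\<dots> = e (fst y * (p * snd x + q * snd z))"
      by (simp add: algebra_simps)
    finally show ?case by simp
  qed (rule Cy)
  have "e (fst x * snd y) = e (fst y * snd x)" if "x \<in> C" for x
    using step[of x y] that C minors y by fastforce
  then show ?thesis using step[OF _ _ _ x] col_span_carrier[OF y C] by blast
qed

text \<open>\<open>linear_form N A k\<close> is the form to which \<open>proj_linear_map N A\<close> pulls back the \<open>k\<close>-th
  coordinate.\<close>

definition linear_form :: "nat \<Rightarrow> 'a::field mat \<Rightarrow> nat \<Rightarrow> (nat, 'a) mpol" where
  "linear_form N A k = (\<Sum>j\<le>N. mconst (A $$ (k, j)) * mvar j)"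

definition linear_subst :: "nat \<Rightarrow> 'a::field mat \<Rightarrow> (nat, 'a) mpol \<Rightarrow> (nat, 'a) mpol" where
  "linear_subst N A = meval (mpoly_ring {..N}) mconst (linear_form N A)"

lemma proj_linear_map_eq:
  "proj_linear_map N A = Proj_map (mpoly_ring {..N}) (mpoly_ring {..N}) (linear_subst N A)"
  unfolding proj_linear_map_def linear_subst_def proj_coord_ring_def linear_form_def[abs_def] ..

lemma linear_form_grade: "linear_form N A k \<in> grade (mpoly_ring {..N}) 1"
proof -
  interpret P: graded_cring "mpoly_ring {..N} :: (nat, 'a) mpol graded_ring"
    by (rule graded_mpoly_ring)
  have "(\<Sum>j\<in>J. mconst (A $$ (k, j)) * mvar j) \<in> grade (mpoly_ring {..N}) 1"
    if "J \<subseteq> {..N}" for J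
    using finite_subset[OF that finite_atMost] that
  proof (induction J rule: finite_induct)
    case empty
    then show ?case using P.zero_grade by simp
  next
    case (insert j J)
    have "mconst (A $$ (k, j)) * mvar j \<in> grade (mpoly_ring {..N}) 1"
      using P.mult_grade[OF mconst_grade mvar_grade, of j "A $$ (k, j)"] insert by simp
    then show ?case using P.add_grade insert by simp
  qed
  then show ?thesis by (simp add: linear_form_def)
qed

lemma linear_form_carrier: "linear_form N A k \<in> carrier (mpoly_ring {..N})"
  using linear_form_grade[of N A k] by (simp add: grade_mpoly_ring)

lemma linear_subst_hom: "linear_subst N A \<in> graded_hom (mpoly_ring {..N}) (mpoly_ring {..N})"
  unfolding linear_subst_def
  by (rule meval_graded_hom[OF graded_mpoly_ring scalar_hom_mconst mconst_grade linear_form_grade])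

lemma linear_subst_mconst: "linear_subst N A (mconst c) = mconst c"
  unfolding linear_subst_def by (rule scalar_hom.meval_mconst[OF scalar_hom_mconst])

lemma linear_subst_mvar: "linear_subst N A (mvar k) = linear_form N A k"
  unfolding linear_subst_def
  by (rule scalar_hom.meval_mvar[OF scalar_hom_mconst]) (rule linear_form_carrier)

text \<open>The coefficients of a form are a row of \<open>A\<close>, and substituting the forms of
  \<open>B\<close> multiplies this row by \<open>B\<close> from the right. Hence substituting with
  \<open>A\<close> and then with \<open>B\<close> belongs to the product
  \<open>A * B\<close>.\<close>

lemma linear_subst_linear_form:
  assumes A: "A \<in> carrier_mat (N + 1) (N + 1)" and B: "B \<in> carrier_mat (N + 1) (N + 1)" and k: "k \<le> N"
  shows "linear_subst N B (linear_form N A k) = linear_form N (A * B) k"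
proof -
  let ?P = "mpoly_ring {..N} :: (nat, 'a::field) mpol graded_ring"
  interpret B: graded_hom_cring ?P ?P "linear_subst N B"
    by (intro graded_hom_cring.intro graded_hom_cring_axioms.intro graded_mpoly_ring linear_subst_hom)
  have "linear_subst N B (\<Sum>j\<in>J. mconst (A $$ (k, j)) * mvar j) =
      (\<Sum>j\<in>J. mconst (A $$ (k, j)) * linear_form N B j) \<and>
      (\<Sum>j\<in>J. mconst (A $$ (k, j)) * mvar j) \<in> carrier ?P"
    if "J \<subseteq> {..N}" for J
    using finite_subset[OF that finite_atMost] that
  proof (induction J rule: finite_induct)
    case empty
    then show ?case using B.hom_zero B.G.zero_closed by simp
  next
    case (insert j J)
    have v: "(mvar j :: (nat, 'a) mpol) \<in> carrier ?P" using insert by (simp add: mvar_carrier)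
    then have m: "mconst (A $$ (k, j)) * mvar j \<in> carrier ?P"
      by (simp add: mpoly_mult_closed)
    have "linear_subst N B (mconst (A $$ (k, j)) * mvar j) = mconst (A $$ (k, j)) * linear_form N B j"
      using B.hom_mult[OF mconst_carrier v] by (simp add: linear_subst_mconst linear_subst_mvar)
    then show ?case
      using insert B.hom_add[OF m, of "\<Sum>j\<in>J. mconst (A $$ (k, j)) * mvar j"] m
      by (simp add: mpoly_add_closed)
  qed
  from this[OF order_refl] have "linear_subst N B (linear_form N A k) =
      (\<Sum>j\<le>N. \<Sum>l\<le>N. mconst (A $$ (k, j) * B $$ (j, l)) * mvar l)"
    by (simp add: linear_form_def sum_distrib_left mconst_arith mult.assoc)
  also have "\<dots> = (\<Sum>l\<le>N. \<Sum>j\<le>N. mconst (A $$ (k, j) * B $$ (j, l)) * mvar l)"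
    by (rule sum.swap)
  also have "\<dots> = (\<Sum>l\<le>N. mconst ((A * B) $$ (k, l)) * mvar l)"
  proof (rule sum.cong[OF refl])
    fix l assume l: "l \<in> {..N}"
    have sum: "mconst (\<Sum>j\<in>J. g j) = (\<Sum>j\<in>J. mconst (g j) :: (nat, 'a) mpol)" if "finite J"
      for J :: "nat set" and g
      using that by (induction J rule: finite_induct) (simp_all add: mconst_arith)
    have "(A * B) $$ (k, l) = (\<Sum>j\<le>N. A $$ (k, j) * B $$ (j, l))"
      using A B k l by (simp add: scalar_prod_def lessThan_Suc_atMost flip: lessThan_atLeast0)
    then show "(\<Sum>j\<le>N. mconst (A $$ (k, j) * B $$ (j, l)) * mvar l) = mconst ((A * B) $$ (k, l)) * mvar l"
      by (simp add: sum sum_distrib_right)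
  qed
  finally show ?thesis by (simp add: linear_form_def)
qed

text \<open>The entry is a sum of two indicators and not a nested conditional, so that the positions
  i and i' may coincide; the case of a single variable is obtained in this way.\<close>

lemma linear_form_two:
  assumes "i \<le> N" "i' \<le> N"
    "\<And>j. j \<le> N \<Longrightarrow> A $$ (k, j) = (if j = i then c else 0) + (if j = i' then d else 0)"
  shows "linear_form N A k = mconst c * mvar i + mconst d * mvar i'"
proof -
  have "linear_form N A k =
      (\<Sum>j\<le>N. (if j = i then mconst c * mvar j else 0) + (if j = i' then mconst d * mvar j else 0))"
    unfolding linear_form_def using assms(3)
    by (intro sum.cong) (auto simp: mconst_arith distrib_right)
  then show ?thesis using assms(1,2) by (simp add: sum.distrib)
qed

lemma linear_form_one:
  assumes "i \<le> N" "\<And>j. j \<le> N \<Longrightarrow> A $$ (k, j) = (if j = i then c else 0)"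
  shows "linear_form N A k = mconst c * mvar i"
  using linear_form_two[of i N i A k c 0] assms by (simp add: mconst_arith)

lemma linear_form_one_mat: "k \<le> N \<Longrightarrow> linear_form N (1\<^sub>m (N + 1)) k = mvar k"
  by (subst linear_form_one[of k N _ k 1]) (auto simp: mconst_arith)

lemma linear_subst_inverse:
  assumes A: "A \<in> carrier_mat (N + 1) (N + 1)" and B: "B \<in> carrier_mat (N + 1) (N + 1)"
    and AB: "A * B = 1\<^sub>m (N + 1)" and p: "p \<in> carrier (mpoly_ring {..N})"
  shows "linear_subst N B (linear_subst N A p) = p"
proof (rule mpoly_ring_hom_eqI[OF _ _ _ _ p])
  show "(\<lambda>p. linear_subst N B (linear_subst N A p)) \<in> Ring.ring_hom (mpoly_ring {..N}) (mpoly_ring {..N})"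
    by (rule graded_homD(1)[OF graded_hom_comp[OF linear_subst_hom linear_subst_hom]])
  show "(\<lambda>p. p) \<in> Ring.ring_hom (mpoly_ring {..N}) (mpoly_ring {..N})"
    by (simp add: Ring.ring_hom_def)
  show "linear_subst N B (linear_subst N A (mvar k)) = mvar k" if "k \<in> {..N}" for k
    using linear_subst_linear_form[OF A B, of k] that AB linear_form_one_mat[of k N]
    by (simp add: linear_subst_mvar)
qed (simp add: linear_subst_mconst)

definition scroll_columns :: "nat \<Rightarrow> nat \<Rightarrow> ((nat, 'a::field) mpol \<times> (nat, 'a) mpol) set" where
  "scroll_columns m n = (\<lambda>k. (mvar k, mvar (k + 1))) ` top_indices m n"

lemma scroll_columns_minors:
  assumes x: "x \<in> col_span {..m + n + 1} (scroll_columns m n)"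
    and y: "y \<in> col_span {..m + n + 1} (scroll_columns m n)"
  shows "scroll_eval m n (fst x * snd y) = scroll_eval m n (fst y * snd x)"
proof (rule col_span_minors[OF graded_homD(1)[OF scroll_eval_hom]
      graded_cring.axioms(1)[OF graded_scroll_ring] _ _ x y])
  show "scroll_columns m n \<subseteq> carrier (mpoly_ring {..m + n + 1}) \<times> carrier (mpoly_ring {..m + n + 1})"
    by (auto simp: scroll_columns_def top_indices_def intro!: mvar_carrier)
  show "scroll_eval m n (fst x * snd y) = scroll_eval m n (fst y * snd x)"
    if "x \<in> scroll_columns m n" "y \<in> scroll_columns m n" for x y
    using that unfolding scroll_columns_def by (elim imageE) (simp only: fst_conv snd_conv scroll_eval_minor)
qed

context scroll_unprojection
begin

definition unproj_columns :: "((nat, 'a) mpol \<times> (nat, 'a) mpol) set" where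
  "unproj_columns = insert (form, mvar (m + n + 2)) (scroll_columns m n)"

lemma unproj_columns_minors:
  assumes x: "x \<in> col_span {..m + n + 2} unproj_columns" and y: "y \<in> col_span {..m + n + 2} unproj_columns"
  shows "unproj_eval (fst x * snd y) = unproj_eval (fst y * snd x)"
proof (rule col_span_minors[OF graded_homD(1)[OF unproj_eval_hom] Sun.is_cring _ _ x y])
  show "unproj_columns \<subseteq> carrier (mpoly_ring {..m + n + 2}) \<times> carrier (mpoly_ring {..m + n + 2})"
    using carrier_mpoly_ring_mono[OF form_carrier, of "{..m + n + 2}"]
    by (auto simp: unproj_columns_def scroll_columns_def top_indices_def intro!: mvar_carrier)
  show "unproj_eval (fst x * snd y) = unproj_eval (fst y * snd x)"
    if "x \<in> unproj_columns" "y \<in> unproj_columns" for x y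
    using that unproj_eval_minor unproj_eval_relation
    by (auto simp: unproj_columns_def scroll_columns_def)
qed

text \<open>The geometric claim becomes a matter of columns. If substitution by \<open>A\<close>
  takes the columns of the target scroll into the span of the enlarged columns, it induces a
  homomorphism from the scroll ring to \<open>Sun\<close>; if substitution by \<open>B\<close> takes
  the enlarged columns, the new one included, into the span of the scroll columns, it induces one in
  the other direction. As \<open>A\<close> and \<open>B\<close> are inverse to each other, so are
  the two maps, and their construction over the coordinate maps is the compatibility with the
  embeddings.\<close>

lemma proj_linearly_isomorphic_if_columns:
  assumes MN: "m' + n' = m + n + 1"
    and A: "A \<in> carrier_mat (m + n + 3) (m + n + 3)" and B: "B \<in> carrier_mat (m + n + 3) (m + n + 3)"
    and AB: "A * B = 1\<^sub>m (m + n + 3)"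
    and colA: "\<And>k. k \<in> top_indices m' n' \<Longrightarrow>
      (linear_form (m + n + 2) A k, linear_form (m + n + 2) A (k + 1)) \<in> col_span {..m + n + 2} unproj_columns"
    and colB: "\<And>k. k \<in> top_indices m n \<Longrightarrow>
      (linear_form (m + n + 2) B k, linear_form (m + n + 2) B (k + 1))
      \<in> col_span {..m + n + 2} (scroll_columns m' n')"
    and colB': "(mconst a * linear_form (m + n + 2) B m + mconst b * linear_form (m + n + 2) B (m + n + 1),
      linear_form (m + n + 2) B (m + n + 2)) \<in> col_span {..m + n + 2} (scroll_columns m' n')"
  shows "proj_linearly_isomorphic (m + n + 2) (Proj Sun) (scroll_unproj_embedding m n \<phi> f)
    (scroll m' n') (scroll_embedding m' n')"
proof -
  let ?N = "m + n + 2"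
  let ?P = "mpoly_ring {..?N} :: (nat, 'a) mpol graded_ring"
  let ?Y = "scroll_ring m' n' :: (nat \<times> nat, 'a) mpol set graded_ring"
  let ?\<alpha> = "linear_subst ?N A" and ?\<beta> = "linear_subst ?N B"
  have N: "m' + n' + 1 = ?N" using MN by simp
  have N3: "?N + 1 = m + n + 3" by simp
  have A': "A \<in> carrier_mat (?N + 1) (?N + 1)" and B': "B \<in> carrier_mat (?N + 1) (?N + 1)"
    using A B by (simp_all only: N3)
  have BA: "B * A = 1\<^sub>m (m + n + 3)" by (rule mat_mult_left_right_inverse[OF A B AB])
  have \<beta>\<alpha>: "?\<beta> (?\<alpha> p) = p" and \<alpha>\<beta>: "?\<alpha> (?\<beta> p) = p" if "p \<in> carrier ?P" for p
    using linear_subst_inverse[OF A' B' _ that] linear_subst_inverse[OF B' A' _ that] AB BA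
    by (simp_all only: N3)
  have inv: "invertible_mat A"
    using A B AB BA unfolding invertible_mat_def inverts_mat_def by auto
  interpret \<alpha>: graded_iso_cring ?P ?P ?\<alpha> ?\<beta>
    by (intro graded_iso_cring.intro graded_iso_cring_axioms.intro graded_hom_cring.intro
        graded_hom_cring_axioms.intro graded_mpoly_ring linear_subst_hom \<beta>\<alpha> \<alpha>\<beta>)
  have evY: "scroll_eval m' n' \<in> graded_hom ?P ?Y" using scroll_eval_hom[of m' n'] by (simp only: N)
  interpret evY: graded_hom_cring ?P ?Y "scroll_eval m' n'"
    by (intro graded_hom_cring.intro graded_hom_cring_axioms.intro graded_mpoly_ring
        graded_scroll_ring evY)
  have carr: "linear_form ?N C k \<in> carrier ?P" for C k by (rule linear_form_carrier)
  have le: "k \<le> ?N \<and> k + 1 \<le> ?N" if "k \<in> top_indices m n \<or> k \<in> top_indices m' n'" for k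
    using that MN by (auto simp: top_indices_def)
  have \<alpha>_mult: "?\<alpha> (mvar k * mvar l) = linear_form ?N A k * linear_form ?N A l"
    and \<beta>_mult: "?\<beta> (mvar k * mvar l) = linear_form ?N B k * linear_form ?N B l"
    if "k \<le> ?N" "l \<le> ?N" for k l
    using \<alpha>.hom_mult[of "mvar k" "mvar l"] \<alpha>.inv.hom_mult[of "mvar k" "mvar l"] that
    by (simp_all add: mvar_carrier linear_subst_mvar)
  have form: "form \<in> carrier ?P" using carrier_mpoly_ring_mono[OF form_carrier] by simp
  have \<beta>_form: "?\<beta> form = mconst a * linear_form ?N B m + mconst b * linear_form ?N B (m + n + 1)"
  proof -
    have v: "(mvar m :: (nat, 'a) mpol) \<in> carrier ?P" "(mvar (m + n + 1) :: (nat, 'a) mpol) \<in> carrier ?P"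
      by (simp_all add: mvar_carrier)
    have "?\<beta> form = ?\<beta> (mconst a * mvar m) + ?\<beta> (mconst b * mvar (m + n + 1))"
      using \<alpha>.inv.hom_add[OF mpoly_mult_closed[OF mconst_carrier v(1), of a]
          mpoly_mult_closed[OF mconst_carrier v(2), of b]] by (simp add: form_def)
    then show ?thesis
      using \<alpha>.inv.hom_mult[OF mconst_carrier v(1), of a] \<alpha>.inv.hom_mult[OF mconst_carrier v(2), of b]
      by (simp add: linear_subst_mconst linear_subst_mvar)
  qed
  \<comment> \<open>The homomorphism starts at the scroll ring because Proj reverses directions: it
    is to induce the morphism from \<open>Proj Sun\<close> to the scroll.\<close>
  obtain \<theta> where \<theta>: "\<theta> \<in> graded_hom ?Y Sun"
    and \<theta>_eval: "\<And>p. p \<in> carrier ?P \<Longrightarrow> \<theta> (scroll_eval m' n' p) = unproj_eval (?\<alpha> p)"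
  proof (rule scroll_lift[of Sun "\<lambda>p. unproj_eval (?\<alpha> p)" m' n', unfolded N])
    show "graded_cring Sun" by (rule Sun.graded_cring_axioms)
    show "(\<lambda>p. unproj_eval (?\<alpha> p)) \<in> graded_hom ?P Sun"
      by (rule graded_hom_comp[OF linear_subst_hom unproj_eval_hom])
    fix k l assume k: "k \<in> top_indices m' n'" and l: "l \<in> top_indices m' n'"
    then show "unproj_eval (?\<alpha> (mvar k * mvar (l + 1))) = unproj_eval (?\<alpha> (mvar l * mvar (k + 1)))"
      using unproj_columns_minors[OF colA[OF k] colA[OF l]] le[of k] le[of l]
      by (simp only: \<alpha>_mult fst_conv snd_conv simp_thms)
  qed blast
  obtain \<eta> where \<eta>: "\<eta> \<in> graded_hom Sun ?Y"
    and \<eta>_eval: "\<And>p. p \<in> carrier ?P \<Longrightarrow> \<eta> (unproj_eval p) = scroll_eval m' n' (?\<beta> p)"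
  proof (rule unproj_lift[of ?Y "\<lambda>p. scroll_eval m' n' (?\<beta> p)"])
    show "graded_cring ?Y" by (rule graded_scroll_ring)
    show "(\<lambda>p. scroll_eval m' n' (?\<beta> p)) \<in> graded_hom ?P ?Y"
      by (rule graded_hom_comp[OF linear_subst_hom evY])
    fix k assume k: "k \<in> top_indices m n"
    show "scroll_eval m' n' (?\<beta> (mvar k * mvar (l + 1))) = scroll_eval m' n' (?\<beta> (mvar l * mvar (k + 1)))"
      if l: "l \<in> top_indices m n" for l
      using scroll_columns_minors[OF colB[OF k, folded N] colB[OF l, folded N]] le[of k] le[of l] k l
      unfolding N by (simp only: \<beta>_mult fst_conv snd_conv simp_thms)
    have "?\<beta> (form * mvar (k + 1)) = ?\<beta> form * linear_form ?N B (k + 1)"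
      using \<alpha>.inv.hom_mult[OF form, of "mvar (k + 1)"] le[of k] k
      by (simp add: mvar_carrier linear_subst_mvar)
    then show "scroll_eval m' n' (?\<beta> (mvar k * mvar ?N)) = scroll_eval m' n' (?\<beta> (form * mvar (k + 1)))"
      using scroll_columns_minors[OF colB[OF k, folded N] colB'[folded N]] le[of k] k
      unfolding N by (simp only: \<beta>_mult \<beta>_form fst_conv snd_conv simp_thms order_refl)
  qed blast
  \<comment> \<open>Each element of the scroll ring is the value of a polynomial p, and on such
    values the composite of the two maps is evaluation at \<open>?\<beta> (?\<alpha> p)\<close>,
    which is p.\<close>
  have \<eta>\<theta>: "\<eta> (\<theta> y) = y" if y: "y \<in> carrier ?Y" for y
  proof -
    obtain p where "p \<in> carrier ?P" "scroll_eval m' n' p = y"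
      by (rule scroll_eval_surj[OF y, unfolded N])
    then show ?thesis using \<theta>_eval \<eta>_eval[OF \<alpha>.hom_closed] \<beta>\<alpha> by metis
  qed
  have \<theta>\<eta>: "\<theta> (\<eta> x) = x" if x: "x \<in> carrier Sun" for x
  proof -
    obtain p where "p \<in> carrier ?P" "unproj_eval p = x" by (rule unproj_eval_surj[OF x])
    then show ?thesis using \<eta>_eval \<theta>_eval[OF \<alpha>.inv.hom_closed] \<alpha>\<beta> by metis
  qed
  interpret \<theta>: graded_iso_cring ?Y Sun \<theta> \<eta>
    by (intro graded_iso_cring.intro graded_iso_cring_axioms.intro graded_hom_cring.intro
        graded_hom_cring_axioms.intro graded_scroll_ring Sun.graded_cring_axioms \<theta> \<eta> \<eta>\<theta> \<theta>\<eta>)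
  let ?\<psi> = "Proj_map ?Y Sun \<theta>"
  have 1: "rs_map_eq (Proj Sun) (Proj ?P)
      (rs_comp (Proj ?Y) (Proj_map ?P ?Y (scroll_eval m' n')) ?\<psi>)
      (Proj_map ?P Sun (\<theta> \<circ> scroll_eval m' n'))"
    by (rule rs_comp_Proj_map[OF evY.graded_hom_cring_axioms \<theta>.graded_hom_cring_axioms])
      (rule \<theta>.pullback_proj_points)
  have 2: "rs_map_eq (Proj Sun) (Proj ?P)
      (rs_comp (Proj ?P) (Proj_map ?P ?P ?\<alpha>) (Proj_map ?P Sun unproj_eval))
      (Proj_map ?P Sun (unproj_eval \<circ> ?\<alpha>))"
  proof (rule rs_comp_Proj_map[OF \<alpha>.graded_hom_cring_axioms uev.graded_hom_cring_axioms])
    \<comment> \<open>The intermediate prime \<open>?r\<close> is recovered from its pullback along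
      the automorphism \<open>?\<alpha>\<close> by pulling back along \<open>?\<beta>\<close>; since
      the former is a point by assumption, so is \<open>?r\<close>.\<close>
    fix q assume q: "pullback ?P (unproj_eval \<circ> ?\<alpha>) q \<in> proj_points ?P"
    interpret \<beta>: graded_iso_cring ?P ?P ?\<beta> ?\<alpha> by (rule \<alpha>.graded_iso_sym)
    let ?r = "pullback ?P unproj_eval q"
    have "pullback ?P ?\<alpha> ?r = pullback ?P (unproj_eval \<circ> ?\<alpha>) q"
      using \<alpha>.hom_closed by (auto simp: pullback_def)
    moreover have "pullback ?P ?\<beta> (pullback ?P ?\<alpha> ?r) = ?r"
      by (rule \<beta>.pullback_pullback) (auto simp: pullback_def)
    ultimately show "?r \<in> proj_points ?P" using \<beta>.proj_points_pullback[OF q] by simp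
  qed
  have 3: "rs_map_eq (Proj Sun) (Proj ?P)
      (Proj_map ?P Sun (\<theta> \<circ> scroll_eval m' n')) (Proj_map ?P Sun (unproj_eval \<circ> ?\<alpha>))"
  proof (rule rs_map_eq_Proj_map)
    show "graded_hom_cring ?P Sun (\<theta> \<circ> scroll_eval m' n')"
      "graded_hom_cring ?P Sun (unproj_eval \<circ> ?\<alpha>)"
      unfolding comp_def
      by (intro graded_hom_cring.intro graded_hom_cring_axioms.intro graded_mpoly_ring
          Sun.graded_cring_axioms graded_hom_comp[OF evY \<theta>]
          graded_hom_comp[OF linear_subst_hom unproj_eval_hom])+
  qed (simp add: \<theta>_eval)
  have "rs_map_eq (Proj Sun) (Proj ?P)
      (rs_comp (Proj ?Y) (Proj_map ?P ?Y (scroll_eval m' n')) ?\<psi>)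
      (rs_comp (Proj ?P) (Proj_map ?P ?P ?\<alpha>) (Proj_map ?P Sun unproj_eval))"
    by (rule rs_map_eq_trans[OF 1 rs_map_eq_trans[OF 3 rs_map_eq_sym[OF 2]]])
  then have "rs_map_eq (Proj Sun) (Proj (proj_coord_ring ?N))
      (rs_comp (scroll m' n') (scroll_embedding m' n') ?\<psi>)
      (rs_comp (Proj (proj_coord_ring ?N)) (proj_linear_map ?N A) (scroll_unproj_embedding m n \<phi> f))"
    unfolding scroll_embedding_eq proj_linear_map_eq unproj_embedding_eq scroll_def
      proj_coord_ring_def N .
  moreover have "rs_iso (Proj Sun) (scroll m' n') ?\<psi>"
    unfolding scroll_def by (rule \<theta>.rs_iso_Proj_map)
  ultimately show ?thesis
    unfolding proj_linearly_isomorphic_def using A' inv by blast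
qed

end

section \<open>The coordinate changes in the two cases\<close>

lemma (in scroll_unprojection) iso_if_second_coordinate:
  assumes "a = 0" "b \<noteq> 0"
  shows "proj_linearly_isomorphic (m + n + 2) (Proj Sun) (scroll_unproj_embedding m n \<phi> f)
    (scroll m (n + 1)) (scroll_embedding m (n + 1))"
proof -
  let ?N = "m + n + 2"
  \<comment> \<open>The last position is that of \<open>T\<close> on one side and of
    \<open>x_{1,n+1}\<close> on the other, and all other positions agree, so the change of
    coordinates is a scaling of the last one: by 1/b for the pullback to the unprojection, by b for
    the inverse.\<close>
  define D :: "'a \<Rightarrow> 'a mat" where
    "D c = mat (?N + 1) (?N + 1) (\<lambda>(k, j). if j = k then (if k = ?N then c else 1) else 0)" for c
  have D: "D c \<in> carrier_mat (m + n + 3) (m + n + 3)" for c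
    by (auto simp: D_def)
  have form_D: "linear_form ?N (D c) k = (if k = ?N then mconst c * mvar k else mvar k)" if "k \<le> ?N" for c k
    using that linear_form_one[of k ?N "D c" k "if k = ?N then c else 1"]
    by (auto simp: D_def mconst_arith)
  have DD: "D (1 / b) * D b = 1\<^sub>m (m + n + 3)"
  proof (rule eq_matI)
    fix k l assume kl: "k < dim_row (1\<^sub>m (m + n + 3) :: 'a mat)" "l < dim_col (1\<^sub>m (m + n + 3) :: 'a mat)"
    have "(D (1 / b) * D b) $$ (k, l) = (\<Sum>j\<le>?N. D (1 / b) $$ (k, j) * D b $$ (j, l))"
      using kl by (simp add: D_def scalar_prod_def lessThan_Suc_atMost numeral_3_eq_3
          flip: lessThan_atLeast0)
    also have "\<dots> = (\<Sum>j\<le>?N. if j = k then (if k = ?N then 1 / b else 1) * D b $$ (k, l) else 0)"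
      using kl by (intro sum.cong) (auto simp: D_def)
    also have "\<dots> = (if k = ?N then 1 / b else 1) * D b $$ (k, l)"
      using kl by simp
    also have "\<dots> = (1\<^sub>m (m + n + 3) :: 'a mat) $$ (k, l)"
      using kl \<open>b \<noteq> 0\<close> by (auto simp: D_def)
    finally show "(D (1 / b) * D b) $$ (k, l) = (1\<^sub>m (m + n + 3) :: 'a mat) $$ (k, l)" .
  qed (simp_all add: D_def)
  show ?thesis
  proof (rule proj_linearly_isomorphic_if_columns[OF _ D D DD])
    fix k assume k: "k \<in> top_indices m (n + 1)"
    show "(linear_form ?N (D (1 / b)) k, linear_form ?N (D (1 / b)) (k + 1))
        \<in> col_span {..?N} unproj_columns"
    \<comment> \<open>The only column of the target that \<open>S\<close> does not have is the last
      one, with entries \<open>x_{1,n}\<close> and \<open>x_{1,n+1}\<close>; it is 1/b times the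
      column of \<open>form\<close> and \<open>T\<close>, because a = 0 leaves \<open>form\<close>
      equal to b \<open>x_{1,n}\<close>.\<close>
    proof (cases "k = m + n + 1")
      case True
      have "(form, mvar ?N) \<in> col_span {..?N} unproj_columns"
        by (rule col_span.base) (simp add: unproj_columns_def)
      from col_span_scale[OF this mconst_carrier, of "1 / b"]
      have "(mconst (1 / b) * form, mconst (1 / b) * mvar ?N) \<in> col_span {..?N} unproj_columns" .
      moreover have "mconst (1 / b) * form = mconst (1 / b * b) * mvar (m + n + 1)"
        unfolding form_def mconst_arith(4) by (simp add: \<open>a = 0\<close> mconst_arith(1) mult.assoc)
      ultimately show ?thesis
        using True \<open>b \<noteq> 0\<close> form_D[of "m + n + 1" "1 / b"] form_D[of ?N "1 / b"]
        by (simp add: mconst_arith)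
    next
      case False
      then have "k \<in> top_indices m n" using k by (auto simp: top_indices_def)
      then have "(mvar k, mvar (k + 1)) \<in> col_span {..?N} unproj_columns"
        by (intro col_span.base) (auto simp: unproj_columns_def scroll_columns_def)
      then show ?thesis using False k form_D[of k "1 / b"] form_D[of "k + 1" "1 / b"] by (auto simp: top_indices_def)
    qed
  next
    have col: "(mvar k, mvar (k + 1)) \<in> col_span {..?N} (scroll_columns m (n + 1))"
      if "k \<in> top_indices m (n + 1)" for k
      using that by (intro col_span.base) (simp add: scroll_columns_def)
    show "(linear_form ?N (D b) k, linear_form ?N (D b) (k + 1))
        \<in> col_span {..?N} (scroll_columns m (n + 1))" if k: "k \<in> top_indices m n" for k
    proof -
      have "k \<in> top_indices m (n + 1)" "k \<le> m + n" using k by (auto simp: top_indices_def)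
      then show ?thesis using col[of k] form_D[of k b] form_D[of "k + 1" b] by simp
    qed
    have "m + n + 1 \<in> top_indices m (n + 1)" by (simp add: top_indices_def)
    from col_span_scale[OF col[OF this] mconst_carrier, of b]
    show "(mconst a * linear_form ?N (D b) m + mconst b * linear_form ?N (D b) (m + n + 1),
        linear_form ?N (D b) ?N) \<in> col_span {..?N} (scroll_columns m (n + 1))"
      using \<open>a = 0\<close> form_D[of "m + n + 1" b] form_D[of ?N b] by (simp add: mconst_arith)
  qed simp
qed

lemma (in scroll_unprojection) iso_if_first_coordinate:
  assumes "a \<noteq> 0" "m \<le> n"
  shows "proj_linearly_isomorphic (m + n + 2) (Proj Sun) (scroll_unproj_embedding m n \<phi> f)
    (scroll (m + 1) n) (scroll_embedding (m + 1) n)"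
proof -
  let ?N = "m + n + 2"
  \<comment> \<open>Row k is the pullback of the k-th coordinate of the target. In the rows k \<le>
    m stands \<open>y_k\<close>, where \<open>n + 1 + k\<close> is the position of
    \<open>x_{1,n-m+k}\<close>; row \<open>m + 1\<close> is \<open>T\<close>; the later rows are the
    second block, whose positions move by one because the first block has gained an entry.\<close>
  define rA where "rA k j = (if k \<le> m then (if j = k then a else 0) + (if j = n + 1 + k then b else 0)
     else if j = (if k = m + 1 then ?N else k - 1) then 1 else 0)" for k j
  \<comment> \<open>The equations for \<open>y_k\<close> solved for \<open>x_{0,k}\<close>. The
    offset is now \<open>n + 2\<close> since in the target the second block begins at
    \<open>m + 2\<close>, and \<open>T\<close> is read off at position \<open>m + 1\<close>.\<close>
  define rB where "rB k j = (if k \<le> m then (if j = k then 1 / a else 0) + (if j = n + 2 + k then - b / a else 0)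
     else if j = (if k = ?N then m + 1 else k + 1) then 1 else 0)" for k j
  define A where "A = mat (?N + 1) (?N + 1) (\<lambda>(k, j). rA k j)"
  define B where "B = mat (?N + 1) (?N + 1) (\<lambda>(k, j). rB k j)"
  have A: "A \<in> carrier_mat (m + n + 3) (m + n + 3)" and B: "B \<in> carrier_mat (m + n + 3) (m + n + 3)"
    by (auto simp: A_def B_def)
  have A_entry: "A $$ (k, j) = rA k j" and B_entry: "B $$ (k, j) = rB k j" if "k \<le> ?N" "j \<le> ?N" for k j
    using that by (simp_all add: A_def B_def)
  have A1: "linear_form ?N A k = mconst a * mvar k + mconst b * mvar (n + 1 + k)" if "k \<le> m" for k
    using that \<open>m \<le> n\<close> by (intro linear_form_two) (auto simp: A_entry rA_def)
  have A2: "linear_form ?N A (m + 1) = mvar ?N"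
    using linear_form_one[of ?N ?N A "m + 1" 1] by (simp add: A_entry rA_def mconst_arith)
  have A3: "linear_form ?N A k = mvar (k - 1)" if "m + 2 \<le> k" "k \<le> ?N" for k
    using that linear_form_one[of "k - 1" ?N A k 1] by (simp add: A_entry rA_def mconst_arith)
  have B1: "linear_form ?N B k = mconst (1 / a) * mvar k + mconst (- b / a) * mvar (n + 2 + k)" if "k \<le> m" for k
    using that \<open>m \<le> n\<close> by (intro linear_form_two) (auto simp: B_entry rB_def)
  have B2: "linear_form ?N B ?N = mvar (m + 1)"
    using linear_form_one[of "m + 1" ?N B ?N 1] by (simp add: B_entry rB_def mconst_arith)
  have B3: "linear_form ?N B k = mvar (k + 1)" if "m + 1 \<le> k" "k \<le> m + n + 1" for k
    using that linear_form_one[of "k + 1" ?N B k 1] by (simp add: B_entry rB_def mconst_arith)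
  have AB: "A * B = 1\<^sub>m (m + n + 3)"
  proof (rule eq_matI)
    fix k l assume "k < dim_row (1\<^sub>m (m + n + 3) :: 'a mat)" "l < dim_col (1\<^sub>m (m + n + 3) :: 'a mat)"
    then have kl: "k \<le> ?N" "l \<le> ?N" by simp_all
    have "(A * B) $$ (k, l) = (\<Sum>j\<le>?N. rA k j * rB j l)"
      using kl by (simp add: A_def B_def scalar_prod_def lessThan_Suc_atMost numeral_3_eq_3
          flip: lessThan_atLeast0)
    also have "\<dots> = (if k \<le> m then a * rB k l + b * rB (n + 1 + k) l
        else rB (if k = m + 1 then ?N else k - 1) l)"
    proof (cases "k \<le> m")
      case True
      then have "(\<Sum>j\<le>?N. rA k j * rB j l) =
          (\<Sum>j\<le>?N. (if j = k then a * rB j l else 0) + (if j = n + 1 + k then b * rB j l else 0))"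
        by (intro sum.cong) (auto simp: rA_def distrib_right)
      moreover have "k \<in> {..?N}" "n + 1 + k \<in> {..?N}" using True by auto
      ultimately show ?thesis
        using True by (simp only: sum.distrib sum.delta finite_atMost if_True)
    next
      case False
      then have "(\<Sum>j\<le>?N. rA k j * rB j l) =
          (\<Sum>j\<le>?N. if j = (if k = m + 1 then ?N else k - 1) then rB j l else 0)"
        by (intro sum.cong) (auto simp: rA_def)
      moreover have "(if k = m + 1 then ?N else k - 1) \<in> {..?N}" using kl by auto
      ultimately show ?thesis using False by (simp only: sum.delta finite_atMost if_True if_False)
    qed
    \<comment> \<open>For k \<le> m the position \<open>n + 1 + k\<close> lies past
      \<open>m\<close>, by m \<le> n, and before \<open>?N\<close>, so its row of \<open>rB\<close>
      is the indicator of \<open>n + 2 + k\<close>; multiplied by b it cancels the entry a (- b /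
      a).\<close>
    also have "\<dots> = (if k = l then 1 else 0)"
      using kl \<open>a \<noteq> 0\<close> \<open>m \<le> n\<close> by (auto simp: rB_def)
    also have "\<dots> = (1\<^sub>m (m + n + 3) :: 'a mat) $$ (k, l)" using kl by simp
    finally show "(A * B) $$ (k, l) = (1\<^sub>m (m + n + 3) :: 'a mat) $$ (k, l)" .
  qed (simp_all add: A_def B_def)
  show ?thesis
  proof (rule proj_linearly_isomorphic_if_columns[OF _ A B AB])
    have col: "(mvar k, mvar (k + 1)) \<in> col_span {..?N} unproj_columns" if "k \<in> top_indices m n" for k
      using that by (intro col_span.base) (simp add: unproj_columns_def scroll_columns_def)
    fix k assume k: "k \<in> top_indices (m + 1) n"
    then consider "k < m" | "k = m" | "m + 2 \<le> k" "k \<le> m + n + 1"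
      by (fastforce simp: top_indices_def)
    then show "(linear_form ?N A k, linear_form ?N A (k + 1)) \<in> col_span {..?N} unproj_columns"
    proof cases
      \<comment> \<open>Both old columns exist: k < m gives the one in the first block, and m \<le>
        n puts \<open>n + 1 + k\<close> beyond the excluded position \<open>m\<close>.\<close>
      case 1
      then have "k \<in> top_indices m n" "n + 1 + k \<in> top_indices m n"
        using \<open>m \<le> n\<close> by (auto simp: top_indices_def)
      from col_span.comb[OF col[OF this(1)] col[OF this(2)] mconst_carrier mconst_carrier, of a b]
      show ?thesis using 1 A1[of k] A1[of "k + 1"] by simp
    next
      \<comment> \<open>The column joining the old entries to the new one: its upper entry
        \<open>y_m\<close> is \<open>form\<close> itself, so it is the new column with no further
        operation.\<close>
      case 2
      have "(form, mvar ?N) \<in> col_span {..?N} unproj_columns"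
        by (rule col_span.base) (simp add: unproj_columns_def)
      then show ?thesis using 2 A1[of m] A2 by (simp add: form_def add.commute)
    next
      case 3
      then have "k - 1 \<in> top_indices m n" by (auto simp: top_indices_def)
      then show ?thesis using col[of "k - 1"] 3 A3[of k] A3[of "k + 1"] by simp
    qed
  next
    have col: "(mvar k, mvar (k + 1)) \<in> col_span {..?N} (scroll_columns (m + 1) n)"
      if "k \<in> top_indices (m + 1) n" for k
      using that by (intro col_span.base) (simp add: scroll_columns_def)
    show "(linear_form ?N B k, linear_form ?N B (k + 1)) \<in> col_span {..?N} (scroll_columns (m + 1) n)"
      if k: "k \<in> top_indices m n" for k
    proof (cases "k < m")
      case True
      then have "k \<in> top_indices (m + 1) n" "n + 2 + k \<in> top_indices (m + 1) n"
        using \<open>m \<le> n\<close> by (auto simp: top_indices_def)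
      from col_span.comb[OF col[OF this(1)] col[OF this(2)] mconst_carrier mconst_carrier, of "1 / a" "- b / a"]
      show ?thesis using True B1[of k] B1[of "k + 1"] by simp
    next
      \<comment> \<open>In the second block the substitution merely moves each position up by one,
        making room for the new entry at \<open>m + 1\<close>.\<close>
      case False
      then have "k + 1 \<in> top_indices (m + 1) n" "m + 1 \<le> k" "k \<le> m + n"
        using k by (auto simp: top_indices_def)
      then show ?thesis using col[of "k + 1"] B3[of k] B3[of "k + 1"] by simp
    qed
    have "m \<in> top_indices (m + 1) n" by (simp add: top_indices_def)
    note col[OF this]
    \<comment> \<open>Under the inverse substitution \<open>form\<close> has to become
      \<open>y_m\<close>, so that the new column turns into the target column with entries
      \<open>y_m\<close> and \<open>y_{m+1}\<close>. The two contributions of the last coordinate of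
      the second block cancel.\<close>
    moreover have "mconst a * linear_form ?N B m + mconst b * linear_form ?N B (m + n + 1) = mvar m"
    proof -
      have "linear_form ?N B (m + n + 1) = mvar (n + 2 + m)"
        using B3[of "m + n + 1"] by (simp add: add.commute)
      then have "mconst a * linear_form ?N B m + mconst b * linear_form ?N B (m + n + 1) =
          mconst (a * (1 / a)) * mvar m + mconst (a * (- b / a) + b) * mvar (n + 2 + m)"
        by (simp only: B1[OF order_refl] mconst_arith) (simp add: algebra_simps)
      then show ?thesis using \<open>a \<noteq> 0\<close> by (simp add: mconst_arith)
    qed
    ultimately show "(mconst a * linear_form ?N B m + mconst b * linear_form ?N B (m + n + 1),
        linear_form ?N B ?N) \<in> col_span {..?N} (scroll_columns (m + 1) n)"
      by (simp only: B2)
  qed simp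
qed

theorem proposition3p1:
  fixes a b :: "'a::field" and m n :: nat
    and \<phi> :: "(nat \<times> nat, 'a) mpol set \<Rightarrow> (nat \<times> nat, 'a) mpol set"
  assumes "1 \<le> m" and "m \<le> n"
    and "scroll_shift_hom m n \<phi>"
    and "(a, b) \<noteq> (0, 0)"
  defines "f \<equiv> scroll_linear_form m n a b"
  shows "if proj_line_eq (a, b) (0, 1)
    then proj_linearly_isomorphic (m + n + 2)
           (Proj (scroll_unproj_ring m n \<phi> 1 f)) (scroll_unproj_embedding m n \<phi> f)
           (scroll m (n + 1)) (scroll_embedding m (n + 1))
    else proj_linearly_isomorphic (m + n + 2)
           (Proj (scroll_unproj_ring m n \<phi> 1 f)) (scroll_unproj_embedding m n \<phi> f)
           (scroll (m + 1) n) (scroll_embedding (m + 1) n)"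
proof -
  interpret U: scroll_unprojection m n a b \<phi>
    by unfold_locales fact
  have f: "U.f = f" by (simp add: f_def U.f_def)
  show ?thesis
  proof (cases "proj_line_eq (a, b) (0, 1)")
    case True
    then have "a = 0" "b \<noteq> 0" by (auto simp: proj_line_eq_def)
    from U.iso_if_second_coordinate[OF this] True show ?thesis unfolding f by (simp only: if_True)
  next
    case False
    \<comment> \<open>If a were zero, then b would be nonzero, and the scaling factor t = b would
      identify the point with [0:1].\<close>
    then have "a \<noteq> 0" using assms(4) by (auto simp: proj_line_eq_def)
    from U.iso_if_first_coordinate[OF this assms(2)] False show ?thesis unfolding f by (simp only: if_False)
  qed
qed

end
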